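(* Let $\Gamma$ be a dual polar graph with base vertex $x$, with $D$, $e$, $q$ as in the context, and let $L,F,R,K$ be as defined in the context. Then $$KL=q^2LK,\quad KF=FK,\quad KR=q^{-2}RK,$$ $$LF-q^2FL=(q^{2e}-1)L,\qquad FR-q^2RF=(q^{2e}-1)R,$$ $$\frac{q^4}{q^2+1}RL^2-LRL+\frac{q^{-2}}{q^2+1}L^2R=-q^{2e+2D-2}L,\qquad \frac{q^4}{q^2+1}R^2L-RLR+\frac{q^{-2}}{q^2+1}LR^2=-q^{2e+2D-2}R.$$
   Context: Let $b$ be a prime power, $D\ge3$ an integer, and $U$ a finite-dimensional vector space over $\mathbb{F}_b$ with one of the following nondegenerate forms, with attached number $e$: symplectic, $\dim U=2D$ ($e=1$); quadratic, $\dim U=2D+1$ ($e=1$); quadratic of Witt index $D$, $\dim U=2D$ ($e=0$); quadratic of Witt index $D$, $\dim U=2D+2$ ($e=2$); Hermitean, $\dim U=2D+1$, $b$ a square ($e=3/2$); Hermitean, $\dim U=2D$, $b$ a square ($e=1/2$). The dual polar graph $\Gamma$ has vertex set $X$ = maximal isotropic subspaces (dimension $D$), $y\sim z$ iff $\dim(y\cap z)=D-1$, with path-length distance $\partial(y,z)=D-\dim(y\cap z)$. Let $q=\sqrt b>0$. Fix $x\in X$. Let $A$ be the adjacency matrix and for $0\le i\le D$ let $E^*_i$ be the diagonal matrix in $\mathrm{Mat}_X(\mathbb{C})$ with $(y,y)$-entry $1$ if $\partial(x,y)=i$ and $0$ otherwise. Define $L=\sum_{i=1}^DE^*_{i-1}AE^*_i$,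 $F=\sum_{i=0}^DE^*_iAE^*_i$, $R=\sum_{i=0}^{D-1}E^*_{i+1}AE^*_i$, $K=\sum_{i=0}^Dq^{-2i}E^*_i$. (Equivalently, $L_{yz}$, $F_{yz}$, $R_{yz}$ equal $1$ iff $y,z$ are adjacent and $\partial(x,z)-\partial(x,y)$ is $1$, $0$, $-1$ respectively, and $0$ otherwise.) *)

theory Defs
  imports "HOL-Analysis.Analysis"
begin

text \<open>The space \<open>U\<close> is the whole type \<open>'v\<close>, a vector space over the finite field \<open>'a\<close> with scalar
  multiplication \<open>smul\<close>; over a finite field, finite-dimensional means that \<open>'v\<close> is finite.\<close>

definition bilinear_form ::
  "('a::field \<Rightarrow> 'v::ab_group_add \<Rightarrow> 'v) \<Rightarrow> ('v \<Rightarrow> 'v \<Rightarrow> 'a) \<Rightarrow> bool" where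
  "bilinear_form smul B \<longleftrightarrow>
     (\<forall>v. Vector_Spaces.linear smul (*) (\<lambda>u. B u v)) \<and>
     (\<forall>u. Vector_Spaces.linear smul (*) (\<lambda>v. B u v))"

definition symplectic_form ::
  "('a::field \<Rightarrow> 'v::ab_group_add \<Rightarrow> 'v) \<Rightarrow> ('v \<Rightarrow> 'v \<Rightarrow> 'a) \<Rightarrow> bool" where
  "symplectic_form smul B \<longleftrightarrow> bilinear_form smul B \<and> (\<forall>u. B u u = 0)"

definition polarization :: "('v::ab_group_add \<Rightarrow> 'a::field) \<Rightarrow> 'v \<Rightarrow> 'v \<Rightarrow> 'a" where
  "polarization Q u v = Q (u + v) - Q u - Q v"

definition quadratic_form ::
  "('a::field \<Rightarrow> 'v::ab_group_add \<Rightarrow> 'v) \<Rightarrow> ('v \<Rightarrow> 'a) \<Rightarrow> bool" where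
  "quadratic_form smul Q \<longleftrightarrow>
     (\<forall>a u. Q (smul a u) = a\<^sup>2 * Q u) \<and> bilinear_form smul (polarization Q)"

text \<open>Hermitean forms are taken with respect to the involution \<open>a \<mapsto> a ^ r\<close> of the field with
  \<open>r\<^sup>2\<close> elements, its only automorphism of order two. Semilinearity in the second argument
  follows from the two clauses.\<close>

definition hermitean_form ::
  "('a::field \<Rightarrow> 'v::ab_group_add \<Rightarrow> 'v) \<Rightarrow> nat \<Rightarrow> ('v \<Rightarrow> 'v \<Rightarrow> 'a) \<Rightarrow> bool" where
  "hermitean_form smul r H \<longleftrightarrow>
     (\<forall>v. Vector_Spaces.linear smul (*) (\<lambda>u. H u v)) \<and> (\<forall>u v. H v u = H u v ^ r)"

definition nondegenerate :: "('v::zero \<Rightarrow> 'v \<Rightarrow> 'a::zero) \<Rightarrow> bool" where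
  "nondegenerate B \<longleftrightarrow> (\<forall>u. (\<forall>v. B u v = 0) \<longrightarrow> u = 0)"

text \<open>In characteristic two and odd dimension the polarization always has a nonzero radical, so
  nondegeneracy of a quadratic form only asks that \<open>Q\<close> have no nonzero zero on this radical. In
  odd characteristic this says that the polarization is nondegenerate.\<close>

definition nondegenerate_quadratic :: "('v::ab_group_add \<Rightarrow> 'a::field) \<Rightarrow> bool" where
  "nondegenerate_quadratic Q \<longleftrightarrow>
     (\<forall>u. Q u = 0 \<and> (\<forall>v. polarization Q u v = 0) \<longrightarrow> u = 0)"

datatype ('a, 'v) form =
    Symplectic "'v \<Rightarrow> 'v \<Rightarrow> 'a"
  | Quadratic "'v \<Rightarrow> 'a"
  | Hermitean "'v \<Rightarrow> 'v \<Rightarrow> 'a"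

fun vanishes_on :: "('a::zero, 'v) form \<Rightarrow> 'v set \<Rightarrow> bool" where
  "vanishes_on (Symplectic B) W \<longleftrightarrow> (\<forall>u\<in>W. \<forall>v\<in>W. B u v = 0)"
| "vanishes_on (Quadratic Q) W \<longleftrightarrow> (\<forall>u\<in>W. Q u = 0)"
| "vanishes_on (Hermitean H) W \<longleftrightarrow> (\<forall>u\<in>W. \<forall>v\<in>W. H u v = 0)"

definition isotropic ::
  "('a::field \<Rightarrow> 'v::ab_group_add \<Rightarrow> 'v) \<Rightarrow> ('a, 'v) form \<Rightarrow> 'v set \<Rightarrow> bool" where
  "isotropic smul f W \<longleftrightarrow> module.subspace smul W \<and> vanishes_on f W"

definition maximal_isotropic ::
  "('a::field \<Rightarrow> 'v::ab_group_add \<Rightarrow> 'v) \<Rightarrow> ('a, 'v) form \<Rightarrow> 'v set set" where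
  "maximal_isotropic smul f =
     {W. isotropic smul f W \<and> (\<forall>W'. isotropic smul f W' \<and> W \<subseteq> W' \<longrightarrow> W' = W)}"

definition witt_index ::
  "('a::field \<Rightarrow> 'v::{ab_group_add, finite} \<Rightarrow> 'v) \<Rightarrow> ('a, 'v) form \<Rightarrow> nat" where
  "witt_index smul f = Max (vector_space.dim smul ` {W. isotropic smul f W})"

inductive polar_type ::
  "('a::{field, finite} \<Rightarrow> 'v::{ab_group_add, finite} \<Rightarrow> 'v) \<Rightarrow> ('a, 'v) form \<Rightarrow> nat \<Rightarrow> real \<Rightarrow> bool"
  for smul where
  symplectic:
    "\<lbrakk>symplectic_form smul B; nondegenerate B; vector_space.dim smul (UNIV :: 'v set) = 2 * D\<rbrakk>
      \<Longrightarrow> polar_type smul (Symplectic B) D 1"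
| quadratic_odd:
    "\<lbrakk>quadratic_form smul Q; nondegenerate_quadratic Q;
      vector_space.dim smul (UNIV :: 'v set) = 2 * D + 1\<rbrakk>
      \<Longrightarrow> polar_type smul (Quadratic Q) D 1"
| quadratic_plus:
    "\<lbrakk>quadratic_form smul Q; nondegenerate_quadratic Q;
      vector_space.dim smul (UNIV :: 'v set) = 2 * D; witt_index smul (Quadratic Q) = D\<rbrakk>
      \<Longrightarrow> polar_type smul (Quadratic Q) D 0"
| quadratic_minus:
    "\<lbrakk>quadratic_form smul Q; nondegenerate_quadratic Q;
      vector_space.dim smul (UNIV :: 'v set) = 2 * D + 2; witt_index smul (Quadratic Q) = D\<rbrakk>
      \<Longrightarrow> polar_type smul (Quadratic Q) D 2"
| hermitean_odd:
    "\<lbrakk>CARD('a) = r\<^sup>2; hermitean_form smul r H; nondegenerate H;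
      vector_space.dim smul (UNIV :: 'v set) = 2 * D + 1\<rbrakk>
      \<Longrightarrow> polar_type smul (Hermitean H) D (3/2)"
| hermitean_even:
    "\<lbrakk>CARD('a) = r\<^sup>2; hermitean_form smul r H; nondegenerate H;
      vector_space.dim smul (UNIV :: 'v set) = 2 * D\<rbrakk>
      \<Longrightarrow> polar_type smul (Hermitean H) D (1/2)"

definition dual_polar_edges ::
  "('a::field \<Rightarrow> 'v::ab_group_add \<Rightarrow> 'v) \<Rightarrow> ('a, 'v) form \<Rightarrow> nat \<Rightarrow> ('v set \<times> 'v set) set" where
  "dual_polar_edges smul f D =
     {(y, z). y \<in> maximal_isotropic smul f \<and> z \<in> maximal_isotropic smul f \<and>
              vector_space.dim smul (y \<inter> z) = D - 1}"

definition path_dist :: "('i \<times> 'i) set \<Rightarrow> 'i \<Rightarrow> 'i \<Rightarrow> nat" where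
  "path_dist E y z = (LEAST n. (y, z) \<in> E ^^ n)"

text \<open>The vertex set \<open>X\<close> is a set of elements of a finite type \<open>'i\<close>. A matrix with rows and columns
  indexed by \<open>X\<close> is represented by the matrix over \<open>'i\<close> that has zero entries outside
  \<open>X \<times> X\<close>; sums, scalar multiples and products are then those of matrices over \<open>X\<close>.\<close>

definition adjacency_matrix :: "('i::finite \<times> 'i) set \<Rightarrow> complex ^ 'i ^ 'i" where
  "adjacency_matrix E = (\<chi> y z. if (y, z) \<in> E then 1 else 0)"

definition dual_idempotent ::
  "'i::finite set \<Rightarrow> ('i \<times> 'i) set \<Rightarrow> 'i \<Rightarrow> nat \<Rightarrow> complex ^ 'i ^ 'i" where
  "dual_idempotent X E x i = (\<chi> y z. if y = z \<and> y \<in> X \<and> path_dist E x y = i then 1 else 0)"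

definition lowering_matrix ::
  "'i::finite set \<Rightarrow> ('i \<times> 'i) set \<Rightarrow> 'i \<Rightarrow> nat \<Rightarrow> complex ^ 'i ^ 'i" where
  "lowering_matrix X E x D =
     (\<Sum>i=1..D. dual_idempotent X E x (i - 1) ** adjacency_matrix E ** dual_idempotent X E x i)"

definition flat_matrix ::
  "'i::finite set \<Rightarrow> ('i \<times> 'i) set \<Rightarrow> 'i \<Rightarrow> nat \<Rightarrow> complex ^ 'i ^ 'i" where
  "flat_matrix X E x D =
     (\<Sum>i=0..D. dual_idempotent X E x i ** adjacency_matrix E ** dual_idempotent X E x i)"

definition raising_matrix ::
  "'i::finite set \<Rightarrow> ('i \<times> 'i) set \<Rightarrow> 'i \<Rightarrow> nat \<Rightarrow> complex ^ 'i ^ 'i" where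
  "raising_matrix X E x D =
     (\<Sum>i=0..<D. dual_idempotent X E x (i + 1) ** adjacency_matrix E ** dual_idempotent X E x i)"

definition K_matrix ::
  "'i::finite set \<Rightarrow> ('i \<times> 'i) set \<Rightarrow> 'i \<Rightarrow> nat \<Rightarrow> real \<Rightarrow> complex ^ 'i ^ 'i" where
  "K_matrix X E x D q = (\<Sum>i=0..D. q powi (- 2 * int i) *\<^sub>R dual_idempotent X E x i)"

end

theory Submission
  imports Defs "HOL-Algebra.Sylow"
begin

text \<open>
  Write \<open>b\<close> for the size of the field and \<open>s = b\<^sup>e\<close>. The geometry enters only through two facts: every
  isotropic subspace \<open>G\<close> of dimension \<open>D - 1\<close> lies in exactly \<open>s + 1\<close> maximal ones, and exactly one of
  these meets a given maximal isotropic \<open>w\<close> outside \<open>G\<close>. Hence adjacent \<open>y\<close>, \<open>z\<close> satisfy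
  \<open>\<partial>(x,z) = \<partial>(x,y) + 1\<close> iff \<open>x \<inter> y\<close> is not contained in \<open>z\<close>, and the common neighbours of two vertices at
  distance two correspond to the \<open>b + 1\<close> hyperplanes of one of them that contain their intersection.

  The relations are checked entrywise at \<open>(y, z)\<close> with \<open>\<partial>(x,z) = \<partial>(x,y) + 1\<close>. For the cubic one, two
  vertices \<open>y\<close>, \<open>w\<close> of the same level with \<open>x \<inter> y \<noteq> x \<inter> w\<close> have \<open>b\<close> times as many common upper
  neighbours as common lower ones; this turns \<open>LRL\<close> into \<open>RLL\<close>-paths whose middle vertex \<open>w\<close> has
  \<open>x \<inter> w \<noteq> x \<inter> y\<close>. If \<open>x \<inter> z \<subseteq> y\<close>, precisely one of the \<open>b + 1\<close> middle vertices is lost and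
  \<open>LLR\<close> vanishes unless \<open>y\<close>, \<open>z\<close> are adjacent; otherwise none is lost and \<open>LLR = b\<^sup>2 RLL\<close>.

  The three kinds of forms differ only in the number \<open>\<tau>\<close> of singular vectors on an affine line
  \<open>v + F p\<close> with \<open>p\<close> singular and \<open>v\<close> not orthogonal to \<open>p\<close> (\<open>b\<close>, \<open>1\<close> and \<open>\<surd>b\<close> for symplectic, quadratic and
  Hermitean forms), and \<open>s = b ^ (dim U - 2 D) \<tau>\<close>.
\<close>

section \<open>Counting in finite vector spaces\<close>

lemma double_counting:
  assumes "finite A" "finite B"
  shows "(\<Sum>a\<in>A. card {b\<in>B. P a b}) = (\<Sum>b\<in>B. card {a\<in>A. P a b})"
proof -
  have "(\<Sum>a\<in>A. card {b\<in>B. P a b}) = (\<Sum>a\<in>A. \<Sum>b\<in>B. if P a b then 1 else 0)"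
    using assms by (simp add: sum.If_cases Collect_conj_eq)
  also have "\<dots> = (\<Sum>b\<in>B. \<Sum>a\<in>A. if P a b then 1 else 0)"
    by (rule sum.swap)
  also have "\<dots> = (\<Sum>b\<in>B. card {a\<in>A. P a b})"
    using assms by (simp add: sum.If_cases Collect_conj_eq)
  finally show ?thesis .
qed

lemma sum_Collect_if:
  fixes c :: "'b::semiring_1"
  assumes "finite (Collect P)"
  shows "(\<Sum>u | P u. if Q u then c else 0) = of_nat (card {u. P u \<and> Q u}) * c"
  using assms by (simp add: sum.If_cases Collect_conj_eq)

lemma card_finite_field_ge_2: "2 \<le> CARD('a::{field,finite})"
  using card_mono[of UNIV "{0, 1::'a}"] by simp

locale finite_vector_space = vector_space scale
  for scale :: "'a::{field,finite} \<Rightarrow> 'v::{ab_group_add,finite} \<Rightarrow> 'v" (infixr \<open>*s\<close> 75)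
begin

sublocale finite_dimensional_vector_space scale "extend_basis {}"
proof
  show "finite (extend_basis {})" by simp
  show "independent (extend_basis {})" "span (extend_basis {}) = UNIV"
    by (simp_all add: independent_extend_basis independent_empty)
qed


text \<open>\<open>dim\<close> of a set is the dimension of its span, so a union can stand for the
  sum of two subspaces, here and in the pencil arguments below.\<close>

lemma dim_Un_Int:
  assumes "subspace A" "subspace B"
  shows "dim (A \<union> B) + dim (A \<inter> B) = dim A + dim B"
proof -
  have "dim (A \<union> B) = dim (span (A \<union> B))" by simp
  also have "span (A \<union> B) = {x + y |x y. x \<in> A \<and> y \<in> B}"
    using assms by (simp add: span_Un span_eq_iff[THEN iffD2])
  finally show ?thesis
    using dim_sums_Int[OF assms] by simp
qed

lemma dim_Un_le:
  assumes "subspace C" "A \<subseteq> C" "B \<subseteq> C"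
  shows "dim (A \<union> B) \<le> dim C"
  using assms by (intro dim_subset) auto

lemma dim_insert_subspace:
  assumes "subspace A" "v \<notin> A"
  shows "dim (insert v A) = Suc (dim A)"
  using assms by (simp add: dim_insert span_eq_iff[THEN iffD2])

lemma subspace_eqI:
  assumes "subspace A" "subspace B" "A \<subseteq> B" "dim B \<le> dim A"
  shows "A = B"
  using assms subspace_dim_equal by blast

lemma dim_Int_codim_one:
  assumes "subspace A" "subspace B" "subspace H" "B \<subseteq> A" "H \<subseteq> A" "dim A \<le> Suc (dim H)"
  shows "dim B \<le> Suc (dim (B \<inter> H))"
  using dim_Un_Int[OF assms(2,3)] dim_Un_le[OF assms(1,4,5)] assms(6) by linarith

lemma dim_strict_mono:
  assumes "subspace A" "subspace B" "A \<subseteq> B" "A \<noteq> B"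
  shows "dim A < dim B"
  using assms subspace_eqI not_le by metis

lemma card_span_independent:
  assumes "independent B"
  shows "card (span B) = CARD('a) ^ card B"
proof -
  have "finite B" by simp
  then show ?thesis using assms
  proof (induction B)
    case empty
    then show ?case by simp
  next
    case (insert a B)
    have a: "a \<notin> span B" and B: "independent B"
      using insert.prems insert.hyps by (simp_all add: independent_insert)
    \<comment> \<open>The coordinates \<open>x\<close> and \<open>k\<close> are unique, so a new
      basis vector multiplies the size by that of the field.\<close>
    have "bij_betw (\<lambda>(x, k). x + k *s a) (span B \<times> UNIV) (span (insert a B))"
    proof (rule bij_betwI')
      fix p p' assume "p \<in> span B \<times> (UNIV :: 'a set)" "p' \<in> span B \<times> (UNIV :: 'a set)"
      moreover obtain x k x' k' where pp: "p = (x, k)" "p' = (x', k')" by (cases p; cases p')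
      ultimately have x: "x \<in> span B" "x' \<in> span B" by auto
      have "k = k' \<and> x = x'" if e: "x + k *s a = x' + k' *s a"
      proof -
        have d: "(k - k') *s a = x' - x"
          using e by (simp add: scale_left_diff_distrib algebra_simps)
        have "k = k'"
        proof (rule ccontr)
          assume "k \<noteq> k'"
          then have "a = inverse (k - k') *s (x' - x)" by (simp flip: d)
          then have "a \<in> span B" using x by (metis span_diff span_scale)
          then show False using a by simp
        qed
        with e show ?thesis by simp
      qed
      then show "((case p of (x, k) \<Rightarrow> x + k *s a) = (case p' of (x, k) \<Rightarrow> x + k *s a)) = (p = p')"
        by (auto simp: pp)
    next
      fix p assume "p \<in> span B \<times> (UNIV :: 'a set)"
      then show "(case p of (x, k) \<Rightarrow> x + k *s a) \<in> span (insert a B)"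
        by (auto intro!: span_add span_scale intro: span_base span_mono[THEN subsetD, of B])
    next
      fix y assume "y \<in> span (insert a B)"
      then obtain k where "y - k *s a \<in> span B" by (auto simp: span_insert)
      then show "\<exists>p\<in>span B \<times> UNIV. y = (case p of (x, k) \<Rightarrow> x + k *s a)"
        by (intro bexI[of _ "(y - k *s a, k)"]) auto
    qed
    then have "card (span (insert a B)) = card (span B \<times> (UNIV :: 'a set))"
      by (simp add: bij_betw_same_card)
    then show ?case
      using insert B by (simp add: card_cartesian_product mult.commute)
  qed
qed

lemma card_subspace:
  assumes "subspace A"
  shows "card A = CARD('a) ^ dim A"
proof -
  obtain B where "B \<subseteq> A" "independent B" "A \<subseteq> span B" "card B = dim A"
    using basis_exists by blast
  then show ?thesis
    using card_span_independent[of B] span_minimal[of B A] assms by (metis subset_antisym)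
qed

section \<open>Hyperplanes of a subspace through a given set\<close>

text \<open>\<open>C\<close> is an arbitrary set, which lets further points be demanded by
  \<open>insert v C\<close> or \<open>C \<union> S\<close>; \<open>hyperplanes_span\<close> passes
  to the span.\<close>

definition hyperplanes :: "'v set \<Rightarrow> 'v set \<Rightarrow> 'v set set" where
  "hyperplanes C A = {H. subspace H \<and> C \<subseteq> H \<and> H \<subseteq> A \<and> Suc (dim H) = dim A}"

lemma hyperplanesD:
  assumes "H \<in> hyperplanes C A"
  shows "subspace H" "C \<subseteq> H" "H \<subseteq> A" "Suc (dim H) = dim A"
  using assms by (auto simp: hyperplanes_def)

lemma hyperplanes_unique:
  assumes "subspace C" "C \<subseteq> A" "Suc (dim C) = dim A"
  shows "hyperplanes C A = {C}"
  proof -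
  have "H = C" if "H \<in> hyperplanes C A" for H
    using subspace_eqI[of C H] hyperplanesD[OF that] assms by simp
  then show ?thesis using assms by (auto simp: hyperplanes_def)
qed

lemma hyperplanes_span: "hyperplanes (span C) A = hyperplanes C A"
  using span_minimal[of C] span_superset[of C] unfolding hyperplanes_def by blast

text \<open>Pairs of a hyperplane \<open>H\<close> and a vector \<open>v\<close> of
  \<open>A - C\<close> outside \<open>H\<close> are counted twice; induction on the codimension
  supplies the hyperplanes through \<open>v\<close>. The Gaussian number
  \<open>(b ^ k - 1) / (b - 1)\<close> appears without division.\<close>

lemma card_hyperplanes_mult:
  assumes "subspace C" "subspace A" "C \<subseteq> A"
  shows "int (card (hyperplanes C A)) * (int CARD('a) - 1) = int CARD('a) ^ (dim A - dim C) - 1"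
  using assms
proof (induction "dim A - dim C" arbitrary: C)
  case 0
  then have "C = A" using subspace_eqI[of C A] by simp
  then have "hyperplanes C A = {}"
    by (auto simp: hyperplanes_def)
  then show ?case using 0 by simp
next
  case (Suc k)
  note sub = Suc.prems
  let ?b = "int CARD('a)"
  have b: "?b \<ge> 2" using card_finite_field_ge_2[where 'a = 'a] by simp
  have dC: "dim A = dim C + k + 1" using Suc.hyps(2) by simp
  show ?case
  \<comment> \<open>Codimension one is separate because the final cancellation divides by
    \<open>b ^ k - 1\<close>.\<close>
  proof (cases "k = 0")
    case True
    then have "hyperplanes C A = {C}" using hyperplanes_unique[OF sub(1,3)] dC by simp
    then show ?thesis using True dC by simp
  next
    case False
    define h where "h = int (card (hyperplanes C A))"
    have fin: "finite (hyperplanes C A)" by simp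
    have IH: "int (card (hyperplanes (insert v C) A)) * (?b - 1) = ?b ^ k - 1" if v: "v \<in> A - C" for v
    proof -
      have "dim (span (insert v C)) = Suc (dim C)"
        using v sub by (simp add: dim_insert_subspace)
      moreover have "span (insert v C) \<subseteq> A"
        using v sub by (intro span_minimal) auto
      ultimately show ?thesis
        using Suc.hyps(1)[of "span (insert v C)"] sub dC hyperplanes_span[of "insert v C" A] by simp
    qed
    have c1: "int (card {v\<in>A - C. v \<notin> H}) = ?b ^ dim A - ?b ^ (dim A - 1)"
      if H: "H \<in> hyperplanes C A" for H
    proof -
      note H' = hyperplanesD[OF H]
      have "{v\<in>A - C. v \<notin> H} = A - H" using H'(2) by auto
      moreover have "int (card (A - H)) = int (card A) - int (card H)"
        using H'(3) by (simp add: card_Diff_subset card_mono of_nat_diff)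
      ultimately show ?thesis
        using card_subspace[OF H'(1)] card_subspace[OF sub(2)] by (simp flip: H'(4))
    qed
    have c2: "(?b - 1) * int (card {H\<in>hyperplanes C A. v \<notin> H}) = (?b - 1) * h - (?b ^ k - 1)"
      if v: "v \<in> A - C" for v
    proof -
      have s: "hyperplanes (insert v C) A \<subseteq> hyperplanes C A"
        by (auto simp: hyperplanes_def)
      have "{H\<in>hyperplanes C A. v \<notin> H} = hyperplanes C A - hyperplanes (insert v C) A"
        by (auto simp: hyperplanes_def)
      then have "int (card {H\<in>hyperplanes C A. v \<notin> H}) = h - int (card (hyperplanes (insert v C) A))"
        using s by (simp add: h_def card_Diff_subset card_mono of_nat_diff)
      then show ?thesis using IH[OF v] by (simp only: right_diff_distrib mult.commute[of "?b - 1"])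
    qed
    have "int (card (A - C)) = int (card A) - int (card C)"
      using sub by (simp add: card_Diff_subset card_mono of_nat_diff)
    then have cAC: "int (card (A - C)) = ?b ^ dim A - ?b ^ dim C"
      using sub by (simp add: card_subspace)
    have "(\<Sum>H\<in>hyperplanes C A. card {v\<in>A - C. v \<notin> H}) = (\<Sum>v\<in>A - C. card {H\<in>hyperplanes C A. v \<notin> H})"
      by (rule double_counting) simp_all
    then have "(?b - 1) * (\<Sum>H\<in>hyperplanes C A. int (card {v\<in>A - C. v \<notin> H}))
        = (\<Sum>v\<in>A - C. (?b - 1) * int (card {H\<in>hyperplanes C A. v \<notin> H}))"
      by (simp flip: sum_distrib_left of_nat_sum)
    then have "(?b - 1) * (h * (?b ^ dim A - ?b ^ (dim A - 1)))
        = (?b ^ dim A - ?b ^ dim C) * ((?b - 1) * h - (?b ^ k - 1))"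
      by (simp only: c1 c2 cong: sum.cong) (simp add: h_def cAC)
    then have "?b ^ dim C * ((?b ^ k - 1) * (h * (?b - 1)))
        = ?b ^ dim C * ((?b ^ k - 1) * (?b ^ (k + 1) - 1))"
      by (simp add: dC power_add algebra_simps)
    moreover have "?b ^ k \<noteq> 1"
      using one_less_power[of ?b k] b False by linarith
    ultimately have "h * (?b - 1) = ?b ^ (k + 1) - 1"
      using b by simp
    then show ?thesis by (simp add: h_def dC)
  qed
qed

lemma card_hyperplanes_codim_two:
  assumes "subspace C" "subspace A" "C \<subseteq> A" "dim A = dim C + 2"
  shows "card (hyperplanes C A) = CARD('a) + 1"
proof -
  have "int (card (hyperplanes C A)) * (int CARD('a) - 1) = (int CARD('a) + 1) * (int CARD('a) - 1)"
    using card_hyperplanes_mult[OF assms(1-3)] assms(4) by (simp add: power2_eq_square algebra_simps)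
  then have "int (card (hyperplanes C A)) = int CARD('a) + 1"
    using card_finite_field_ge_2[where 'a = 'a] by simp
  then show ?thesis by linarith
qed

text \<open>Those that do contain \<open>S\<close> are the hyperplanes over
  \<open>C \<union> S\<close>, and their number is subtracted.\<close>

lemma card_hyperplanes_avoiding:
  assumes "subspace C" "subspace A" "C \<subseteq> A" "S \<subseteq> A"
  shows "int (card {H \<in> hyperplanes C A. \<not> S \<subseteq> H}) * (int CARD('a) - 1)
    = int CARD('a) ^ (dim A - dim C) - int CARD('a) ^ (dim A - dim (C \<union> S))"
proof -
  have s: "hyperplanes (C \<union> S) A \<subseteq> hyperplanes C A"
    by (auto simp: hyperplanes_def)
  have "{H \<in> hyperplanes C A. \<not> S \<subseteq> H} = hyperplanes C A - hyperplanes (C \<union> S) A"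
    by (auto simp: hyperplanes_def)
  then have "int (card {H \<in> hyperplanes C A. \<not> S \<subseteq> H})
      = int (card (hyperplanes C A)) - int (card (hyperplanes (C \<union> S) A))"
    using s by (simp add: card_Diff_subset card_mono of_nat_diff)
  moreover have "int (card (hyperplanes (C \<union> S) A)) * (int CARD('a) - 1)
      = int CARD('a) ^ (dim A - dim (C \<union> S)) - 1"
    using card_hyperplanes_mult[of "span (C \<union> S)" A] assms hyperplanes_span
    by (simp add: span_minimal)
  ultimately show ?thesis
    using card_hyperplanes_mult[OF assms(1-3)] by (simp only: left_diff_distrib)
qed

text \<open>Among the \<open>b + 1\<close> hyperplanes over a subspace of codimension two, only the
  span of \<open>C \<union> S\<close> can contain \<open>S\<close>. This split into \<open>1\<close>
  and \<open>b\<close> drives the path counts.\<close>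

lemma card_hyperplanes_pencil:
  assumes "subspace C" "subspace A" "C \<subseteq> A" "S \<subseteq> A"
    and "dim A = dim C + 2" "Suc (dim (C \<union> S)) = dim A"
  shows "card {H \<in> hyperplanes C A. S \<subseteq> H} = 1"
    and "card {H \<in> hyperplanes C A. \<not> S \<subseteq> H} = CARD('a)"
proof -
  have "{H \<in> hyperplanes C A. S \<subseteq> H} = hyperplanes (C \<union> S) A"
    by (auto simp: hyperplanes_def)
  also have "\<dots> = {span (C \<union> S)}"
    using hyperplanes_unique[of "span (C \<union> S)" A] assms hyperplanes_span[of "C \<union> S" A]
    by (simp add: span_minimal)
  finally show c: "card {H \<in> hyperplanes C A. S \<subseteq> H} = 1" by simp
  have "{H \<in> hyperplanes C A. \<not> S \<subseteq> H} = hyperplanes C A - {H \<in> hyperplanes C A. S \<subseteq> H}"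
    by auto
  then show "card {H \<in> hyperplanes C A. \<not> S \<subseteq> H} = CARD('a)"
    using c card_hyperplanes_codim_two[OF assms(1-3,5)] by (simp add: card_Diff_subset)
qed

end

section \<open>Polar spaces\<close>

text \<open>The axioms fit all three kinds of forms: linearity in the first argument with symmetric
  orthogonality covers the Hermitean case, a separate predicate \<open>sing\<close> covers quadratic
  forms, and \<open>sing_radical\<close> asks for nondegeneracy at singular vectors only, as
  quadratic forms in characteristic two require.\<close>

locale polar_space = finite_vector_space scale
  for scale :: "'a::{field,finite} \<Rightarrow> 'v::{ab_group_add,finite} \<Rightarrow> 'v" (infixr \<open>*s\<close> 75) +
  fixes \<beta> :: "'v \<Rightarrow> 'v \<Rightarrow> 'a" and sing :: "'v \<Rightarrow> bool"
  assumes form_add: "\<beta> (u + v) w = \<beta> u w + \<beta> v w"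
    and form_scale: "\<beta> (k *s u) w = k * \<beta> u w"
    and form_zero_sym: "\<beta> u v = 0 \<Longrightarrow> \<beta> v u = 0"
    and sing_zero: "sing 0"
    and sing_scale: "sing u \<Longrightarrow> sing (k *s u)"
    and sing_add: "\<lbrakk>sing u; sing v; \<beta> u v = 0\<rbrakk> \<Longrightarrow> sing (u + v)"
    and sing_self: "sing u \<Longrightarrow> \<beta> u u = 0"
    and sing_radical: "\<lbrakk>sing u; \<And>v. \<beta> u v = 0\<rbrakk> \<Longrightarrow> u = 0"
begin

section \<open>Orthogonal complements\<close>

definition perp :: "'v set \<Rightarrow> 'v set" where
  "perp S = {v. \<forall>w\<in>S. \<beta> v w = 0}"

lemma form_zero_left: "\<beta> 0 w = 0"
  using form_scale[of 0 0 w] by simp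

lemma form_diff: "\<beta> (u - v) w = \<beta> u w - \<beta> v w"
  using form_add[of "u - v" v w] by simp

lemma subspace_perp: "subspace (perp S)"
  by (auto simp: subspace_def perp_def form_add form_scale form_zero_left)

lemma perp_sym: "S \<subseteq> perp T \<longleftrightarrow> T \<subseteq> perp S"
  using form_zero_sym by (auto simp: perp_def)

text \<open>Only the first argument of \<open>\<beta>\<close> is linear, so the second is treated
  through the double complement: \<open>perp (perp S)\<close> is a subspace containing
  \<open>S\<close>.\<close>

lemma perp_span: "perp (span S) = perp S"
proof -
  have "S \<subseteq> perp (perp S)" using perp_sym[of S "perp S"] by simp
  then have "span S \<subseteq> perp (perp S)" by (intro span_minimal subspace_perp)
  then have "perp S \<subseteq> perp (span S)" by (simp only: perp_sym[of "perp S"])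
  then show ?thesis using span_superset[of S] by (auto simp: perp_def)
qed

lemma perp_Un: "perp (S \<union> T) = perp S \<inter> perp T"
  by (auto simp: perp_def)

lemma dim_perp_singleton:
  assumes "subspace A"
  shows "dim A \<le> Suc (dim (A \<inter> perp {w}))"
proof (cases "A \<subseteq> perp {w}")
  case True
  then show ?thesis by (simp add: Int_absorb2)
next
  case False
  then obtain a where a: "a \<in> A" "\<beta> a w \<noteq> 0" by (auto simp: perp_def)
  have "A \<subseteq> span (insert a (A \<inter> perp {w}))"
  proof
    fix v assume v: "v \<in> A"
    have "v - (\<beta> v w / \<beta> a w) *s a \<in> A \<inter> perp {w}"
      using v a assms by (auto simp: perp_def form_diff form_scale intro: subspace_diff subspace_scale)
    then show "v \<in> span (insert a (A \<inter> perp {w}))"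
      unfolding span_insert using span_base by blast
  qed
  then have "dim A \<le> dim (insert a (A \<inter> perp {w}))" by (rule dim_mono)
  also have "\<dots> \<le> Suc (dim (A \<inter> perp {w}))" by (simp add: dim_insert)
  finally show ?thesis .
qed

lemma dim_perp_finite:
  assumes "subspace A"
  shows "dim A \<le> dim (A \<inter> perp S) + card S"
proof -
  have "finite S" by simp
  then show ?thesis
  proof (induction S)
    case empty
    then show ?case by (simp add: perp_def)
  next
    case (insert w S)
    have "dim (A \<inter> perp S) \<le> Suc (dim (A \<inter> perp S \<inter> perp {w}))"
      using assms by (intro dim_perp_singleton subspace_inter subspace_perp)
    moreover have "A \<inter> perp S \<inter> perp {w} = A \<inter> perp (insert w S)"
      by (auto simp: perp_def)
    ultimately show ?case using insert by simp
  qed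
qed

text \<open>Extend a basis of \<open>B \<inter> perp A\<close> to one of \<open>B\<close>. The
  former vectors impose no condition on \<open>A\<close>, so \<open>A \<inter> perp B\<close> is cut
  out by the remaining \<open>dim B - dim (B \<inter> perp A)\<close> ones.\<close>

lemma dim_perp_le:
  assumes "subspace A" "subspace B"
  shows "dim A + dim (B \<inter> perp A) \<le> dim (A \<inter> perp B) + dim B"
proof -
  obtain B0 where B0: "B0 \<subseteq> B \<inter> perp A" "independent B0" "B \<inter> perp A \<subseteq> span B0"
      "card B0 = dim (B \<inter> perp A)"
    using basis_exists by blast
  then obtain B1 where B1: "B0 \<subseteq> B1" "B1 \<subseteq> B" "independent B1" "B \<subseteq> span B1"
    using maximal_independent_subset_extend[of B0 B] by auto
  have spB: "span B1 = B"
    using B1 assms(2) span_minimal by blast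
  have "card B1 = dim B"
    using B1 basis_card_eq_dim by blast
  then have c: "card (B1 - B0) + dim (B \<inter> perp A) = dim B"
    using B0(4) B1(1) card_mono[of B1 B0] by (simp add: card_Diff_subset)
  have "A \<inter> perp (B1 - B0) \<subseteq> perp B1"
  proof
    fix v assume v: "v \<in> A \<inter> perp (B1 - B0)"
    have "\<beta> v w = 0" if "w \<in> B1" for w
    proof (cases "w \<in> B0")
      case True
      then have "\<beta> w v = 0" using B0(1) v by (auto simp: perp_def)
      then show ?thesis by (rule form_zero_sym)
    next
      case False
      then show ?thesis using v that by (auto simp: perp_def)
    qed
    then show "v \<in> perp B1" by (simp add: perp_def)
  qed
  then have "A \<inter> perp (B1 - B0) \<subseteq> A \<inter> perp B"
    using perp_span[of B1] spB by auto
  then have "dim (A \<inter> perp (B1 - B0)) \<le> dim (A \<inter> perp B)" by (rule dim_subset)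
  then show ?thesis using dim_perp_finite[OF assms(1), of "B1 - B0"] c by linarith
qed

text \<open>This is equality of row and column rank for \<open>\<beta>\<close> between
  \<open>A\<close> and \<open>B\<close>.\<close>

lemma dim_perp:
  assumes "subspace A" "subspace B"
  shows "dim A + dim (B \<inter> perp A) = dim (A \<inter> perp B) + dim B"
  using dim_perp_le[OF assms] dim_perp_le[OF assms(2,1)] by linarith

section \<open>Totally isotropic subspaces\<close>

definition iso :: "'v set \<Rightarrow> bool" where
  "iso W \<longleftrightarrow> subspace W \<and> W \<subseteq> Collect sing \<and> W \<subseteq> perp W"

definition maxiso :: "'v set set" where
  "maxiso = {W. iso W \<and> (\<forall>W'. iso W' \<and> W \<subseteq> W' \<longrightarrow> W' = W)}"

lemma isoD:
  assumes "iso W"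
  shows "subspace W" "u \<in> W \<Longrightarrow> sing u" "u \<in> W \<Longrightarrow> v \<in> W \<Longrightarrow> \<beta> u v = 0"
  using assms by (auto simp: iso_def perp_def)

lemma iso_subset:
  assumes "iso W" "subspace V" "V \<subseteq> W"
  shows "iso V"
  using assms unfolding iso_def perp_def by blast

text \<open>Every vector of the span is a multiple of \<open>v\<close> plus an element of
  \<open>W\<close>, a sum of two orthogonal singular vectors.\<close>

lemma iso_insert:
  assumes "iso W" "sing v" "v \<in> perp W"
  shows "iso (span (insert v W))"
proof -
  note W = isoD[OF assms(1)]
  have "insert v W \<subseteq> perp (insert v W)"
    using assms W form_zero_sym sing_self by (auto simp: perp_def)
  then have "insert v W \<subseteq> perp (span (insert v W))" by (simp only: perp_span)
  then have p: "span (insert v W) \<subseteq> perp (span (insert v W))"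
    by (intro span_minimal subspace_perp)
  have "sing u" if u: "u \<in> span (insert v W)" for u
  proof -
    obtain k where k: "u - k *s v \<in> W"
      using u W(1) by (auto simp: span_insert span_eq_iff[THEN iffD2])
    have "\<beta> (k *s v) (u - k *s v) = 0"
      using k assms(3) by (auto simp: form_scale perp_def)
    then show ?thesis
      using sing_add[OF sing_scale[OF assms(2), of k] W(2)[OF k]] by simp
  qed
  with p show ?thesis by (auto simp: iso_def)
qed

lemma maxiso_iso: "W \<in> maxiso \<Longrightarrow> iso W"
  by (simp add: maxiso_def)

lemma maxiso_subspace: "W \<in> maxiso \<Longrightarrow> subspace W"
  using maxiso_iso isoD(1) by blast

lemma maxiso_memI:
  assumes "W \<in> maxiso" "sing v" "v \<in> perp W"
  shows "v \<in> W"
proof -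
  have "span (insert v W) = W"
    using iso_insert[OF maxiso_iso[OF assms(1)] assms(2,3)] assms(1) span_superset[of "insert v W"]
    by (auto simp: maxiso_def)
  then show ?thesis using span_base[of v "insert v W"] by simp
qed

lemma iso_extend:
  assumes "iso W"
  shows "\<exists>W'\<in>maxiso. W \<subseteq> W'"
proof -
  obtain V where V: "iso V" "W \<subseteq> V" "\<forall>V'\<in>Collect iso. V \<subseteq> V' \<longrightarrow> V = V'"
    using finite_has_maximal2[of "Collect iso" W] assms by auto
  then have "V \<in> maxiso" by (auto simp: maxiso_def)
  with V show ?thesis by blast
qed

text \<open>By maximality \<open>V \<inter> perp W\<close> lies in \<open>W\<close>, hence in
  \<open>W \<inter> perp V\<close>; \<open>dim_perp\<close> turns this into an inequality of
  dimensions. In particular all members of \<open>maxiso\<close> have the same dimension.\<close>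

lemma dim_iso_le_maxiso:
  assumes "iso V" "W \<in> maxiso"
  shows "dim V \<le> dim W"
proof -
  have "V \<inter> perp W \<subseteq> V \<inter> W"
    using maxiso_memI[OF assms(2)] isoD(2)[OF assms(1)] by auto
  also have "\<dots> \<subseteq> W \<inter> perp V"
    using assms(1) by (auto simp: iso_def)
  finally have "dim (V \<inter> perp W) \<le> dim (W \<inter> perp V)" by (rule dim_subset)
  then show ?thesis
    using dim_perp[OF isoD(1)[OF assms(1)] maxiso_subspace[OF assms(2)]] by linarith
qed

lemma dim_maxiso_eq:
  assumes "V \<in> maxiso" "W \<in> maxiso"
  shows "dim V = dim W"
  using assms by (intro le_antisym dim_iso_le_maxiso maxiso_iso)

lemma maxiso_iff_dim:
  assumes "W \<in> maxiso"
  shows "V \<in> maxiso \<longleftrightarrow> iso V \<and> dim V = dim W"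
proof
  assume "iso V \<and> dim V = dim W"
  then have V: "iso V" "dim V = dim W" by auto
  obtain V' where V': "V' \<in> maxiso" "V \<subseteq> V'" using iso_extend[OF V(1)] by blast
  have "V = V'"
    using V V' assms subspace_eqI[of V V'] isoD(1) maxiso_subspace dim_maxiso_eq[of V' W] by simp
  then show "V \<in> maxiso" using V' by simp
qed (use dim_maxiso_eq[OF _ assms] maxiso_iso in auto)

text \<open>No nonzero vector of \<open>W\<close> is orthogonal to everything, by
  \<open>sing_radical\<close>, so the form between \<open>W\<close> and the whole space has rank
  \<open>dim W\<close>.\<close>

lemma dim_perp_iso:
  assumes "iso W"
  shows "dim W + dim (perp W) = dim (UNIV :: 'v set)"
proof -
  have "u = 0" if "u \<in> W \<inter> perp UNIV" for u
    using that isoD(2)[OF assms] by (intro sing_radical) (simp_all add: perp_def)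
  then have "W \<inter> perp UNIV = {0}"
    using subspace_0[OF isoD(1)[OF assms]] subspace_0[OF subspace_perp] by blast
  then show ?thesis
    using dim_perp[OF subspace_UNIV isoD(1)[OF assms]] by simp
qed

section \<open>Size of the lines of the dual polar space\<close>

lemma card_affine_level:
  assumes "subspace A" "\<not> A \<subseteq> perp {p}"
  shows "card {v\<in>A. \<beta> v p = 1} = card (A \<inter> perp {p})"
proof -
  obtain a where a: "a \<in> A" "\<beta> a p \<noteq> 0" using assms(2) by (auto simp: perp_def)
  define c where "c = inverse (\<beta> a p) *s a"
  have c: "c \<in> A" "\<beta> c p = 1" using a assms(1) by (simp_all add: c_def form_scale subspace_scale)
  have "bij_betw (\<lambda>v. v + c) (A \<inter> perp {p}) {v\<in>A. \<beta> v p = 1}"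
    by (rule bij_betw_byWitness[of _ "\<lambda>v. v - c"])
       (use c assms(1) in \<open>auto simp: perp_def form_add form_diff subspace_add subspace_diff\<close>)
  then show ?thesis by (simp add: bij_betw_same_card)
qed

text \<open>Fix one \<open>z\<close> over \<open>G\<close> and \<open>p\<close> in
  \<open>z - G\<close>. The singular \<open>v\<close> of \<open>perp G\<close> with
  \<open>\<beta> v p = 1\<close> are counted along the affine lines \<open>v + F p\<close>, which
  brings in \<open>\<tau>\<close>, and by the subspaces \<open>t \<noteq> z\<close> over
  \<open>G\<close>. The formula for \<open>s\<close> is multiplied out to avoid truncated
  subtraction.\<close>

lemma card_maxiso_over_codim_one:
  assumes D: "\<And>W. W \<in> maxiso \<Longrightarrow> dim W = D"
    and \<tau>: "\<And>p v. \<lbrakk>sing p; \<beta> v p = 1\<rbrakk> \<Longrightarrow> card {k. sing (v + k *s p)} = \<tau>"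
    and s: "s * CARD('a) ^ (2 * D) = CARD('a) ^ dim (UNIV :: 'v set) * \<tau>"
    and G: "iso G" "Suc (dim G) = D"
  shows "card {t \<in> maxiso. G \<subseteq> t} = Suc s"
proof -
  let ?b = "CARD('a)" and ?N = "dim (UNIV :: 'v set)"
  have b: "?b > 0" by simp
  obtain z where z: "z \<in> maxiso" "G \<subseteq> z" using iso_extend[OF G(1)] by blast
  note subG = isoD(1)[OF G(1)] and subz = maxiso_subspace[OF z(1)] and isoz = maxiso_iso[OF z(1)]
  have "G \<noteq> z" using D[OF z(1)] G(2) by auto
  then obtain p where p: "p \<in> z" "p \<notin> G" using z by auto
  have singp: "sing p" using isoD(2)[OF isoz p(1)] .
  have pG: "p \<in> perp G" using isoD(3)[OF isoz p(1)] z(2) by (auto simp: perp_def)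
  have Gp: "G \<subseteq> perp {p}" using pG perp_sym[of "{p}" G] by simp
  have span_eq: "span (insert v G) = t" if "t \<in> maxiso" "G \<subseteq> t" "v \<in> t" "v \<notin> G" for t v
    using that G(2) D[OF that(1)] subG maxiso_subspace[OF that(1)]
    by (intro subspace_eqI span_minimal) (auto simp: dim_insert_subspace)
  have perpz: "perp z = perp G \<inter> perp {p}"
    using span_eq[OF z p] perp_span[of "insert p G"] perp_Un[of "{p}" G] by auto
  define T where "T = {v \<in> perp G. \<beta> v p = 1}"
  define T' where "T' = {v \<in> T. sing v}"
  define \<T> where "\<T> = {t \<in> maxiso. G \<subseteq> t} - {z}"
  have "dim (perp z) < dim (perp G)"
    using dim_perp_iso[OF isoz] dim_perp_iso[OF G(1)] G(2) D[OF z(1)] by linarith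
  then have "\<not> perp G \<subseteq> perp {p}" using perpz by (auto simp: Int_absorb2)
  then have cT: "card T = ?b ^ dim (perp z)"
    using card_affine_level[OF subspace_perp, of G p] card_subspace[OF subspace_perp, of z]
    by (simp add: T_def perpz)
  \<comment> \<open>Translation by multiples of \<open>p\<close> maps \<open>T\<close> to itself
    because \<open>p\<close> lies in \<open>perp G\<close> and is orthogonal to itself.\<close>
  have shift: "card {v\<in>T. sing (v + k *s p)} = card T'" for k
  proof -
    have "bij_betw (\<lambda>v. v + k *s p) {v\<in>T. sing (v + k *s p)} T'"
      by (rule bij_betw_byWitness[of _ "\<lambda>v. v - k *s p"])
         (use pG sing_self[OF singp] subspace_perp[of G] in
           \<open>auto simp: T_def T'_def form_add form_diff form_scale subspace_add subspace_diff subspace_scale\<close>)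
    then show ?thesis by (simp add: bij_betw_same_card)
  qed
  have "card T * \<tau> = (\<Sum>v\<in>T. card {k\<in>UNIV. sing (v + k *s p)})"
    using \<tau>[OF singp] by (simp add: T_def)
  also have "\<dots> = (\<Sum>k\<in>UNIV. card {v\<in>T. sing (v + k *s p)})"
    by (rule double_counting) simp_all
  finally have c1: "card T * \<tau> = ?b * card T'" by (simp add: shift)
  have fib1: "card {t\<in>\<T>. v \<in> t} = 1" if v: "v \<in> T'" for v
  proof -
    have v': "sing v" "v \<in> perp G" "\<beta> v p = 1" using v by (auto simp: T'_def T_def)
    have vz: "v \<notin> z" using isoD(3)[OF isoz _ p(1), of v] v'(3) by auto
    then have vG: "v \<notin> G" using z(2) by blast
    have "iso (span (insert v G))" by (rule iso_insert[OF G(1) v'(1,2)])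
    moreover have "dim (span (insert v G)) = dim z"
      using vG subG G(2) D[OF z(1)] by (simp add: dim_insert_subspace)
    ultimately have m: "span (insert v G) \<in> maxiso" using maxiso_iff_dim[OF z(1)] by blast
    have i: "G \<subseteq> span (insert v G)" "v \<in> span (insert v G)"
      using span_superset[of "insert v G"] by auto
    with m vz have "span (insert v G) \<in> {t\<in>\<T>. v \<in> t}" by (auto simp: \<T>_def)
    moreover have "t = span (insert v G)" if "t \<in> {t\<in>\<T>. v \<in> t}" for t
      using span_eq[of t v] vG that by (simp add: \<T>_def)
    ultimately have "{t\<in>\<T>. v \<in> t} = {span (insert v G)}" by blast
    then show ?thesis by simp
  qed
  \<comment> \<open>A \<open>t\<close> orthogonal to \<open>p\<close> would contain \<open>p\<close>
    and equal \<open>z\<close>; hence \<open>t \<inter> perp {p} = G\<close>, and the vectors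
    counted form a translate of \<open>G\<close>.\<close>
  have fib2: "card {v\<in>T'. v \<in> t} = ?b ^ dim G" if t: "t \<in> \<T>" for t
  proof -
    have t': "t \<in> maxiso" "G \<subseteq> t" "t \<noteq> z" using t by (auto simp: \<T>_def)
    note subt = maxiso_subspace[OF t'(1)] and isot = maxiso_iso[OF t'(1)]
    have np: "\<not> t \<subseteq> perp {p}"
    proof
      assume "t \<subseteq> perp {p}"
      then have "p \<in> t" using maxiso_memI[OF t'(1) singp] perp_sym[of "{p}" t] by simp
      then show False using span_eq[OF t'(1,2) _ p(2)] span_eq[OF z p] t'(3) by simp
    qed
    have "G = t \<inter> perp {p}"
    proof (rule subspace_eqI[OF subG])
      show "subspace (t \<inter> perp {p})" using subt subspace_perp by (rule subspace_inter)
      have "dim (t \<inter> perp {p}) < dim t"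
        using np subt subspace_perp by (intro dim_strict_mono subspace_inter) auto
      then show "dim (t \<inter> perp {p}) \<le> dim G" using D[OF t'(1)] G(2) by simp
    qed (use Gp t' in auto)
    moreover have "{v\<in>T'. v \<in> t} = {v\<in>t. \<beta> v p = 1}"
      using isoD[OF isot] t'(2) by (auto simp: T'_def T_def perp_def)
    ultimately show ?thesis
      using card_affine_level[OF subt np] card_subspace[OF subG] by simp
  qed
  have "card T' = (\<Sum>v\<in>T'. card {t\<in>\<T>. v \<in> t})" using fib1 by simp
  also have "\<dots> = (\<Sum>t\<in>\<T>. card {v\<in>T'. v \<in> t})" by (rule double_counting) simp_all
  finally have c2: "card T' = card \<T> * ?b ^ dim G" using fib2 by simp
  have "card \<T> * ?b ^ D = ?b ^ dim (perp z) * \<tau>"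
    using c1 c2 cT G(2)[symmetric] by (simp add: mult_ac)
  then have "card \<T> * ?b ^ (2 * D) = ?b ^ (D + dim (perp z)) * \<tau>"
    by (simp add: power_add mult_2 mult.assoc[symmetric])
  then have "card \<T> * ?b ^ (2 * D) = s * ?b ^ (2 * D)"
    by (simp only: s dim_perp_iso[OF isoz, unfolded D[OF z(1)]])
  then have "card \<T> = s" by (simp only: mult_cancel2) simp
  moreover have "card {t \<in> maxiso. G \<subseteq> t} = Suc (card \<T>)"
    unfolding \<T>_def by (rule card.remove) (use z in auto)
  ultimately show ?thesis by (simp only:)
qed

end

section \<open>Dual polar graphs\<close>

locale dual_polar_space = polar_space scale \<beta> sing
  for scale :: "'a::{field,finite} \<Rightarrow> 'v::{ab_group_add,finite} \<Rightarrow> 'v" (infixr \<open>*s\<close> 75)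
    and \<beta> :: "'v \<Rightarrow> 'v \<Rightarrow> 'a" and sing :: "'v \<Rightarrow> bool" +
  fixes D s :: nat and x :: "'v set"
  assumes dim_maxiso: "W \<in> maxiso \<Longrightarrow> dim W = D"
    and card_line: "\<lbrakk>iso G; Suc (dim G) = D\<rbrakk> \<Longrightarrow> card {t \<in> maxiso. G \<subseteq> t} = Suc s"
    and base: "x \<in> maxiso"
begin

definition adj :: "'v set \<Rightarrow> 'v set \<Rightarrow> bool" where
  "adj y z \<longleftrightarrow> y \<in> maxiso \<and> z \<in> maxiso \<and> Suc (dim (y \<inter> z)) = D"

text \<open>This is the support of \<open>L\<close>: as
  \<open>\<partial>(x,y) = D - dim (x \<inter> y)\<close> by \<open>path_dist_adj\<close>, the
  vertex \<open>y\<close> is one step nearer to the base vertex. A \<open>t\<close> with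
  \<open>low y t\<close> is an upper neighbour of \<open>y\<close>.\<close>

definition low :: "'v set \<Rightarrow> 'v set \<Rightarrow> bool" where
  "low y z \<longleftrightarrow> adj y z \<and> dim (x \<inter> y) = Suc (dim (x \<inter> z))"

definition flat :: "'v set \<Rightarrow> 'v set \<Rightarrow> bool" where
  "flat y z \<longleftrightarrow> adj y z \<and> dim (x \<inter> y) = dim (x \<inter> z)"

lemma adj_sym: "adj y z \<longleftrightarrow> adj z y"
  by (auto simp: adj_def Int_commute)

lemma adjD:
  assumes "adj y z"
  shows "y \<in> maxiso" "z \<in> maxiso" "Suc (dim (y \<inter> z)) = D" "y \<noteq> z"
  using assms dim_maxiso[of y] by (auto simp: adj_def)

lemma subspace_Int_maxiso: "\<lbrakk>y \<in> maxiso; z \<in> maxiso\<rbrakk> \<Longrightarrow> subspace (y \<inter> z)"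
  by (simp add: maxiso_subspace subspace_inter)

lemma maxiso_orth: "\<lbrakk>y \<in> maxiso; u \<in> y; v \<in> y\<rbrakk> \<Longrightarrow> \<beta> u v = 0"
  using isoD(3)[OF maxiso_iso] .

text \<open>Orthogonality passes from \<open>S\<close> to its span, which is all of
  \<open>y\<close>, and maximality absorbs \<open>v\<close>. Usually \<open>S\<close> is a
  hyperplane of \<open>y\<close> with one vector added.\<close>

lemma mem_if_orth_spanning:
  assumes "y \<in> maxiso" "z \<in> maxiso" "v \<in> z" "S \<subseteq> y" "D \<le> dim S" "\<And>u. u \<in> S \<Longrightarrow> \<beta> v u = 0"
  shows "v \<in> y"
proof -
  have "span S = y"
    using assms maxiso_subspace[OF assms(1)] dim_maxiso[OF assms(1)]
    by (intro subspace_eqI span_minimal) auto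
  then have "v \<in> perp y"
    using assms(6) perp_span[of S] by (auto simp: perp_def)
  then show ?thesis
    using maxiso_memI[OF assms(1)] isoD(2)[OF maxiso_iso[OF assms(2)] assms(3)] by blast
qed

lemma maxiso_eqI:
  assumes "y \<in> maxiso" "z \<in> maxiso" "S \<subseteq> y" "S \<subseteq> z" "D \<le> dim S"
  shows "y = z"
proof -
  have "span S = t" if "t \<in> maxiso" "S \<subseteq> t" for t
    using that assms(5) maxiso_subspace[OF that(1)] dim_maxiso[OF that(1)]
    by (intro subspace_eqI span_minimal) simp_all
  from this[OF assms(1,3)] this[OF assms(2,4)] show ?thesis by simp
qed

lemma adjI:
  assumes "y \<in> maxiso" "z \<in> maxiso" "y \<noteq> z" "G \<subseteq> y" "G \<subseteq> z" "Suc (dim G) = D"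
  shows "adj y z"
proof -
  have "\<not> D \<le> dim (y \<inter> z)"
    using maxiso_eqI[OF assms(1,2), of "y \<inter> z"] assms(3) by auto
  moreover have "dim G \<le> dim (y \<inter> z)" using assms(4,5) by (intro dim_subset) auto
  ultimately show ?thesis using assms by (simp add: adj_def)
qed

lemma adj_Int_eq:
  assumes "adj y z" "subspace G" "G \<subseteq> y" "G \<subseteq> z" "Suc (dim G) = D"
  shows "y \<inter> z = G"
  using subspace_eqI[of G "y \<inter> z"] adjD[OF assms(1)] assms by (simp add: subspace_Int_maxiso)

lemma dim_Int_lt:
  assumes "y \<in> maxiso" "z \<in> maxiso" "y \<noteq> z"
  shows "dim (y \<inter> z) < D"
  using maxiso_eqI[OF assms(1,2), of "y \<inter> z"] assms(3) by (meson Int_lower1 Int_lower2 not_le)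

text \<open>The maximal isotropic subspaces through \<open>G\<close> form a line of the dual polar space; the one that meets
  \<open>w\<close> outside \<open>G\<close> is its point nearest to \<open>w\<close>.\<close>

lemma line_gate_unique:
  assumes "t \<in> maxiso" "t' \<in> maxiso" "w \<in> maxiso" "subspace G" "Suc (dim G) = D" "G \<subseteq> t" "G \<subseteq> t'"
    and "\<not> t \<inter> w \<subseteq> G" "\<not> t' \<inter> w \<subseteq> G"
  shows "t = t'"
proof -
  obtain v where v: "v \<in> t" "v \<in> w" "v \<notin> G" using assms by blast
  obtain v' where v': "v' \<in> t'" "v' \<in> w" "v' \<notin> G" using assms by blast
  \<comment> \<open>Both vectors lie in \<open>w\<close>, so \<open>v'\<close> is orthogonal to
    \<open>v\<close> as well as to \<open>G\<close>, and these span \<open>t\<close>.\<close>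
  have "v' \<in> t"
  proof (rule mem_if_orth_spanning[OF assms(1,2) v'(1), of "insert v G"])
    show "D \<le> dim (insert v G)" using assms v by (simp add: dim_insert_subspace)
    show "\<beta> v' u = 0" if "u \<in> insert v G" for u
      using that maxiso_orth[OF assms(3) v'(2) v(2)] maxiso_orth[OF assms(2) v'(1)] assms by auto
  qed (use v assms in auto)
  then show ?thesis
    using assms v' by (intro maxiso_eqI[of _ _ "insert v' G"]) (auto simp: dim_insert_subspace)
qed

text \<open>By the rank formula \<open>w \<inter> perp G\<close> has dimension
  \<open>dim w - dim G + dim (G \<inter> perp w)\<close>, which exceeds
  \<open>dim (G \<inter> w)\<close>. A vector of it outside \<open>G\<close> spans the required
  subspace together with \<open>G\<close>.\<close>

lemma line_gate_exists:
  assumes "y \<in> maxiso" "w \<in> maxiso" "subspace G" "G \<subseteq> y" "Suc (dim G) = D"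
  shows "\<exists>t\<in>maxiso. G \<subseteq> t \<and> \<not> t \<inter> w \<subseteq> G"
proof -
  have isoG: "iso G" using iso_subset[OF maxiso_iso[OF assms(1)] assms(3,4)] .
  have subw: "subspace w" using assms(2) by (rule maxiso_subspace)
  have "w \<subseteq> perp w" using maxiso_iso[OF assms(2)] by (simp add: iso_def)
  then have "dim (G \<inter> w) \<le> dim (G \<inter> perp w)" by (intro dim_subset) auto
  then have "dim (G \<inter> w) < dim (w \<inter> perp G)"
    using dim_perp[OF subw assms(3)] dim_maxiso[OF assms(2)] assms(5) by linarith
  then have "\<not> w \<inter> perp G \<subseteq> G \<inter> w" using dim_subset[of "w \<inter> perp G" "G \<inter> w"] by linarith
  then obtain v where v: "v \<in> w" "v \<in> perp G" "v \<notin> G" by auto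
  have "iso (span (insert v G))"
    using iso_insert[OF isoG _ v(2)] isoD(2)[OF maxiso_iso[OF assms(2)] v(1)] by blast
  moreover have "dim (span (insert v G)) = dim w"
    using v assms dim_maxiso[OF assms(2)] by (simp add: dim_insert_subspace)
  ultimately have "span (insert v G) \<in> maxiso" using maxiso_iff_dim[OF assms(2)] by blast
  moreover have "insert v G \<subseteq> span (insert v G)" by (rule span_superset)
  ultimately show ?thesis using v by (intro bexI[of _ "span (insert v G)"]) auto
qed

lemma dim_gate_Int:
  assumes "t \<in> maxiso" "w \<in> maxiso" "subspace G" "Suc (dim G) = D" "G \<subseteq> t" "\<not> t \<inter> w \<subseteq> G"
  shows "dim (t \<inter> w) = Suc (dim (G \<inter> w))"
proof -
  have e: "t \<inter> w \<inter> G = G \<inter> w" using assms by auto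
  have "dim (t \<inter> w) \<le> Suc (dim (G \<inter> w))"
    using dim_Int_codim_one[of t "t \<inter> w" G] assms dim_maxiso[OF assms(1)]
    by (simp add: e maxiso_subspace subspace_Int_maxiso)
  moreover have "dim (G \<inter> w) < dim (t \<inter> w)"
    using assms by (intro dim_strict_mono) (auto simp: maxiso_subspace subspace_inter)
  ultimately show ?thesis by simp
qed

section \<open>Levels of adjacent vertices\<close>

lemma dim_le_adj_Int:
  assumes "adj t w" "subspace B" "B \<subseteq> t"
  shows "dim B \<le> Suc (dim (B \<inter> w))"
proof -
  note a = adjD[OF assms(1)]
  have "dim B \<le> Suc (dim (B \<inter> (t \<inter> w)))"
    using dim_Int_codim_one[OF maxiso_subspace[OF a(1)] assms(2) subspace_Int_maxiso[OF a(1,2)] assms(3)]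
      a(3) dim_maxiso[OF a(1)] by simp
  moreover have "B \<inter> (t \<inter> w) = B \<inter> w" using assms(3) by auto
  ultimately show ?thesis by simp
qed

lemma dim_base_Int_le:
  assumes "adj y z"
  shows "dim (x \<inter> y) \<le> Suc (dim (x \<inter> y \<inter> z))"
  using dim_le_adj_Int[OF assms subspace_Int_maxiso[OF base adjD(1)[OF assms]]] by simp

lemma adj_level:
  assumes "adj y z"
  shows "dim (x \<inter> y) \<le> Suc (dim (x \<inter> z))"
proof -
  have "dim (x \<inter> y \<inter> z) \<le> dim (x \<inter> z)" by (intro dim_subset) auto
  then show ?thesis using dim_base_Int_le[OF assms] by simp
qed

lemma lowD:
  assumes "low y z"
  shows "adj y z" "y \<in> maxiso" "z \<in> maxiso" "dim (x \<inter> y) = Suc (dim (x \<inter> z))" "x \<inter> z \<subseteq> x \<inter> y"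
    "\<not> x \<inter> y \<subseteq> z"
proof -
  show a: "adj y z" "dim (x \<inter> y) = Suc (dim (x \<inter> z))" using assms by (auto simp: low_def)
  note a' = adjD[OF a(1)]
  then show "y \<in> maxiso" "z \<in> maxiso" by auto
  have "x \<inter> y \<inter> z = x \<inter> z"
    using a a' dim_base_Int_le[OF a(1)] base
    by (intro subspace_eqI subspace_inter) (auto simp: maxiso_subspace)
  then show "x \<inter> z \<subseteq> x \<inter> y" by auto
  show "\<not> x \<inter> y \<subseteq> z"
  proof
    assume "x \<inter> y \<subseteq> z"
    then have "dim (x \<inter> y) \<le> dim (x \<inter> z)" by (intro dim_subset) auto
    then show False using a by simp
  qed
qed

text \<open>\<open>y\<close> is then the point nearest to \<open>x\<close> on the line through
  \<open>y \<inter> z\<close>, and uniqueness of that point forces \<open>x \<inter> z\<close> into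
  \<open>y\<close>.\<close>

lemma lowI:
  assumes "adj y z" "\<not> x \<inter> y \<subseteq> z"
  shows "low y z"
proof -
  note a = adjD[OF assms(1)]
  have sub: "x \<inter> z \<subseteq> x \<inter> y"
  proof (rule ccontr)
    assume "\<not> x \<inter> z \<subseteq> x \<inter> y"
    then have "y = z"
      using a base assms(2)
      by (intro line_gate_unique[of y z x "y \<inter> z"]) (auto simp: subspace_Int_maxiso)
    then show False using a by simp
  qed
  have "dim (x \<inter> z) < dim (x \<inter> y)"
    using a base sub assms(2) by (intro dim_strict_mono subspace_Int_maxiso) auto
  then show ?thesis using adj_level[OF assms(1)] assms(1) by (simp add: low_def)
qed

lemma low_iff: "adj y z \<Longrightarrow> low y z \<longleftrightarrow> \<not> x \<inter> y \<subseteq> z"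
  using lowI lowD by blast

text \<open>Equal dimensions rule out \<open>low\<close> in both directions, and
  \<open>low_iff\<close> then gives both inclusions.\<close>

lemma flat_iff: "flat y z \<longleftrightarrow> adj y z \<and> x \<inter> y = x \<inter> z"
proof
  assume f: "flat y z"
  then have a: "adj y z" by (simp add: flat_def)
  have "\<not> low y z" "\<not> low z y" using f by (auto simp: low_def flat_def)
  then show "adj y z \<and> x \<inter> y = x \<inter> z"
    using a low_iff[of y z] low_iff[of z y] adj_sym by auto
qed (simp add: flat_def)

section \<open>Common neighbours\<close>

lemma common_neighbour_Int_subset:
  assumes "adj y t" "adj t w" "dim (y \<inter> w) + 2 = D"
  shows "y \<inter> w \<subseteq> t"
proof -
  note a = adjD[OF assms(1)] adjD[OF assms(2)]
  have "dim (t \<inter> y) \<le> Suc (dim (t \<inter> y \<inter> w))"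
    using dim_le_adj_Int[OF assms(2) subspace_Int_maxiso[OF a(2,1)]] by simp
  then have "dim (y \<inter> w) \<le> dim (t \<inter> y \<inter> w)"
    using a(3) assms(3) by (simp add: Int_commute)
  then have "t \<inter> y \<inter> w = y \<inter> w"
    using a(1,2,6) by (intro subspace_eqI subspace_Int_maxiso subspace_inter) (auto simp: maxiso_subspace)
  then show ?thesis by auto
qed

lemma common_neighbour_dim:
  assumes "adj y t" "adj t w" "y \<noteq> w" "\<not> adj y w"
  shows "dim (y \<inter> w) + 2 = D"
proof -
  note a = adjD[OF assms(1)] adjD[OF assms(2)]
  have "dim (t \<inter> y) \<le> Suc (dim (t \<inter> y \<inter> w))"
    using dim_le_adj_Int[OF assms(2) subspace_Int_maxiso[OF a(2,1)]] by simp
  moreover have "dim (t \<inter> y \<inter> w) \<le> dim (y \<inter> w)" by (intro dim_subset) auto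
  ultimately have "D \<le> dim (y \<inter> w) + 2" using a(3) by (simp add: Int_commute)
  moreover have "dim (y \<inter> w) < D" using dim_Int_lt a assms(3) by blast
  moreover have "Suc (dim (y \<inter> w)) \<noteq> D" using assms(4) a by (simp add: adj_def)
  ultimately show ?thesis by linarith
qed

text \<open>Pairwise adjacent vertices lie on one line: if \<open>y \<inter> w\<close> and
  \<open>z \<inter> w\<close> differ, a vector of \<open>z \<inter> w\<close> outside
  \<open>y\<close> spans \<open>w\<close> together with \<open>y \<inter> w\<close>, and
  \<open>y \<inter> z\<close> is orthogonal to both.\<close>

lemma triangle_subset:
  assumes "adj y z" "adj z w" "adj y w"
  shows "y \<inter> z \<subseteq> w"
proof (cases "y \<inter> w = z \<inter> w")
  case True
  note a = adjD[OF assms(1)] adjD[OF assms(3)]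
  have "y \<inter> w = y \<inter> z"
    using a True by (intro subspace_eqI subspace_Int_maxiso) auto
  then show ?thesis by auto
next
  case False
  note a = adjD[OF assms(1)] adjD[OF assms(2)] adjD[OF assms(3)]
  have "\<not> z \<inter> w \<subseteq> y \<inter> w"
    using a False subspace_eqI[of "z \<inter> w" "y \<inter> w"] by (auto simp: subspace_Int_maxiso)
  then obtain v where v: "v \<in> z" "v \<in> w" "v \<notin> y \<inter> w" by auto
  show ?thesis
  proof
    fix u assume u: "u \<in> y \<inter> z"
    show "u \<in> w"
    proof (rule mem_if_orth_spanning[of w y u "insert v (y \<inter> w)"])
      show "D \<le> dim (insert v (y \<inter> w))"
        using a v by (simp add: dim_insert_subspace subspace_Int_maxiso)
      show "\<beta> u u' = 0" if "u' \<in> insert v (y \<inter> w)" for u'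
        using that u v maxiso_orth[of y u u'] maxiso_orth[of z u v] a by auto
    qed (use a u v in auto)
  qed
qed

text \<open>A hyperplane \<open>G\<close> of \<open>y\<close> over \<open>y \<inter> w\<close> is a
  line through \<open>y\<close>, and its point nearest to \<open>w\<close> is the common neighbour
  belonging to \<open>G\<close>. Uniqueness of that point gives injectivity, existence
  surjectivity.\<close>

lemma bij_common_neighbours:
  assumes "y \<in> maxiso" "w \<in> maxiso" "dim (y \<inter> w) + 2 = D"
  shows "bij_betw (\<lambda>t. t \<inter> y) {t. adj y t \<and> adj t w} (hyperplanes (y \<inter> w) y)"
proof (rule bij_betwI')
  fix t t' assume "t \<in> {t. adj y t \<and> adj t w}" "t' \<in> {t. adj y t \<and> adj t w}"
  then have a: "adj y t" "adj t w" "adj y t'" "adj t' w" by auto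
  note a' = adjD[OF a(1)] adjD[OF a(2)] adjD[OF a(3)] adjD[OF a(4)]
  \<comment> \<open>\<open>r \<inter> w\<close> has dimension \<open>D - 1\<close>, more than
    \<open>y \<inter> w\<close>; so \<open>t\<close> and \<open>t'\<close> are both nearest to
    \<open>w\<close> on their line.\<close>
  have n: "\<not> r \<inter> w \<subseteq> y" if "adj r w" for r
  proof
    assume "r \<inter> w \<subseteq> y"
    then have "dim (r \<inter> w) \<le> dim (y \<inter> w)" by (intro dim_subset) auto
    then show False using adjD(3)[OF that] assms(3) by simp
  qed
  have "t = t'" if e: "t \<inter> y = t' \<inter> y"
  proof (rule line_gate_unique[of t t' w "t \<inter> y"])
    show "subspace (t \<inter> y)" using a'(1,2) by (simp add: subspace_Int_maxiso)
    show "Suc (dim (t \<inter> y)) = D" using a'(3) by (simp add: Int_commute)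
  qed (use a' n[OF a(2)] n[OF a(4)] assms(2) e in blast)+
  then show "(t \<inter> y = t' \<inter> y) = (t = t')" by auto
next
  fix t assume "t \<in> {t. adj y t \<and> adj t w}"
  then have a: "adj y t" "adj t w" by auto
  show "t \<inter> y \<in> hyperplanes (y \<inter> w) y"
    using common_neighbour_Int_subset[OF a assms(3)] adjD(1-3)[OF a(1)] dim_maxiso[OF assms(1)]
    by (auto simp: hyperplanes_def subspace_Int_maxiso Int_commute[of t])
next
  fix G assume G: "G \<in> hyperplanes (y \<inter> w) y"
  note G' = hyperplanesD[OF G]
  have dG: "Suc (dim G) = D" using G'(4) dim_maxiso[OF assms(1)] by simp
  obtain t where t: "t \<in> maxiso" "G \<subseteq> t" "\<not> t \<inter> w \<subseteq> G"
    using line_gate_exists[OF assms(1,2) G'(1,3) dG] by blast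
  have "G \<inter> w = y \<inter> w" using G' by auto
  then have d: "Suc (dim (t \<inter> w)) = D"
    using dim_gate_Int[OF t(1) assms(2) G'(1) dG t(2,3)] assms(3) by simp
  have "t \<noteq> y" using d assms(3) by auto
  then have a: "adj y t" using adjI[OF assms(1) t(1) _ G'(3) t(2) dG] by simp
  have "t \<inter> y = G" using adj_Int_eq[OF a G'(1,3) t(2) dG] by (simp add: Int_commute)
  moreover have "adj t w" using d t assms by (simp add: adj_def)
  ultimately show "\<exists>t\<in>{t. adj y t \<and> adj t w}. G = t \<inter> y" using a by (intro bexI[of _ t]) simp_all
qed

lemma card_common_neighbours:
  assumes "y \<in> maxiso" "w \<in> maxiso" "dim (y \<inter> w) + 2 = D"
  shows "card {t. adj y t \<and> adj t w \<and> P (t \<inter> y)} = card {G \<in> hyperplanes (y \<inter> w) y. P G}"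
proof -
  note bij = bij_common_neighbours[OF assms]
  have "card {t. adj y t \<and> adj t w \<and> P (t \<inter> y)}
      = card ((\<lambda>t. t \<inter> y) ` {t. adj y t \<and> adj t w \<and> P (t \<inter> y)})"
    by (intro card_image[symmetric] inj_on_subset[OF bij_betw_imp_inj_on[OF bij]]) auto
  also have "(\<lambda>t. t \<inter> y) ` {t. adj y t \<and> adj t w \<and> P (t \<inter> y)}
      = {G \<in> (\<lambda>t. t \<inter> y) ` {t. adj y t \<and> adj t w}. P G}"
    by auto
  finally show ?thesis by (simp only: bij_betw_imp_surj_on[OF bij])
qed

lemma card_common_neighbours_pencil:
  assumes "y \<in> maxiso" "w \<in> maxiso" "dim (y \<inter> w) + 2 = D" "S \<subseteq> y" "Suc (dim (y \<inter> w \<union> S)) = D"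
  shows "card {t. adj y t \<and> adj t w \<and> S \<subseteq> t} = 1"
    and "card {t. adj y t \<and> adj t w \<and> \<not> S \<subseteq> t} = CARD('a)"
proof -
  have "{t. adj y t \<and> adj t w \<and> S \<subseteq> t} = {t. adj y t \<and> adj t w \<and> S \<subseteq> t \<inter> y}"
    "{t. adj y t \<and> adj t w \<and> \<not> S \<subseteq> t} = {t. adj y t \<and> adj t w \<and> \<not> S \<subseteq> t \<inter> y}"
    using assms(4) by auto
  then show "card {t. adj y t \<and> adj t w \<and> S \<subseteq> t} = 1"
    "card {t. adj y t \<and> adj t w \<and> \<not> S \<subseteq> t} = CARD('a)"
    using card_common_neighbours[OF assms(1-3), of "\<lambda>G. S \<subseteq> G"]
      card_common_neighbours[OF assms(1-3), of "\<lambda>G. \<not> S \<subseteq> G"]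
      card_hyperplanes_pencil[of "y \<inter> w" y S] assms dim_maxiso[OF assms(1)]
    by (simp_all add: maxiso_subspace subspace_Int_maxiso)
qed

section \<open>Path counts\<close>

text \<open>Upper neighbours \<open>t\<close> are sorted by the hyperplane
  \<open>y \<inter> t\<close>: it must not contain \<open>x \<inter> y\<close>, and each such
  hyperplane is a line with \<open>s\<close> points besides \<open>y\<close>. The factor
  \<open>b - 1\<close> avoids a division.\<close>

lemma upper_degree:
  assumes "y \<in> maxiso"
  shows "int (card {t. low y t}) * (int CARD('a) - 1)
    = int s * (int CARD('a) ^ D - int CARD('a) ^ (D - dim (x \<inter> y)))"
proof -
  let ?H = "{G \<in> hyperplanes {0} y. \<not> x \<inter> y \<subseteq> G}"
  note suby = maxiso_subspace[OF assms]
  have H: "card {G \<in> ?H. t \<inter> y = G} = 1" if t: "low y t" for t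
  proof -
    note l = lowD[OF t]
    have "subspace (t \<inter> y)" using l(2,3) by (simp add: subspace_Int_maxiso)
    then have "t \<inter> y \<in> ?H"
      using subspace_0[OF suby] subspace_0[OF maxiso_subspace[OF l(3)]] adjD(3)[OF l(1)] l(6) dim_maxiso[OF assms]
      by (auto simp: hyperplanes_def subspace_0 Int_commute[of t])
    then have "{G \<in> ?H. t \<inter> y = G} = {t \<inter> y}" by blast
    then show ?thesis by simp
  qed
  have T: "card {t \<in> Collect (low y). t \<inter> y = G} = s" if G: "G \<in> ?H" for G
  proof -
    have G': "subspace G" "G \<subseteq> y" "Suc (dim G) = D" "\<not> x \<inter> y \<subseteq> G"
      using G dim_maxiso[OF assms] by (auto simp: hyperplanes_def)
    have "{t \<in> Collect (low y). t \<inter> y = G} = {t \<in> maxiso. G \<subseteq> t} - {y}"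
    proof (intro equalityI subsetI)
      fix t assume "t \<in> {t \<in> Collect (low y). t \<inter> y = G}"
      then have t: "low y t" "t \<inter> y = G" by auto
      then show "t \<in> {t \<in> maxiso. G \<subseteq> t} - {y}" using lowD(3)[OF t(1)] adjD(4)[OF lowD(1)[OF t(1)]] by blast
    next
      fix t assume "t \<in> {t \<in> maxiso. G \<subseteq> t} - {y}"
      then have t: "t \<in> maxiso" "G \<subseteq> t" "y \<noteq> t" by auto
      have a: "adj y t" by (rule adjI[OF assms t(1,3) G'(2) t(2) G'(3)])
      have e: "y \<inter> t = G" by (rule adj_Int_eq[OF a G'(1,2) t(2) G'(3)])
      then have "\<not> x \<inter> y \<subseteq> t" using G'(4) by blast
      then have "low y t" by (rule lowI[OF a])
      then show "t \<in> {t \<in> Collect (low y). t \<inter> y = G}" using e by (simp add: Int_commute)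
    qed
    moreover have "card {t \<in> maxiso. G \<subseteq> t} = Suc s"
      using card_line[OF iso_subset[OF maxiso_iso[OF assms] G'(1,2)] G'(3)] .
    ultimately show ?thesis using assms G'(2) by (simp add: card_Diff_singleton)
  qed
  have "card {t. low y t} = (\<Sum>t\<in>Collect (low y). card {G \<in> ?H. t \<inter> y = G})"
    using H by simp
  also have "\<dots> = (\<Sum>G\<in>?H. card {t \<in> Collect (low y). t \<inter> y = G})"
    by (rule double_counting) simp_all
  also have "\<dots> = card ?H * s" using T by simp
  finally have "int (card {t. low y t}) = int (card ?H) * int s" by simp
  moreover have "int (card ?H) * (int CARD('a) - 1) = int CARD('a) ^ D - int CARD('a) ^ (D - dim (x \<inter> y))"
    using card_hyperplanes_avoiding[of "{0}" y "x \<inter> y"] suby dim_maxiso[OF assms]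
    by (simp add: subspace_0 subspace_single_0 dim_insert span_zero)
  ultimately show ?thesis by (simp only: mult_ac)
qed

lemma mids_eq_common_neighbours:
  assumes "dim (x \<inter> u) = dim (x \<inter> z) + 2"
  shows "low u w \<and> low w z \<longleftrightarrow> adj u w \<and> adj w z"
proof
  assume a: "adj u w \<and> adj w z"
  then show "low u w \<and> low w z"
    using adj_level[of u w] adj_level[of w z] assms by (auto simp: low_def)
qed (auto dest: lowD(1))

lemma not_adj_level_two:
  assumes "dim (x \<inter> u) = dim (x \<inter> z) + 2"
  shows "\<not> adj u z" "u \<noteq> z"
  using assms adj_level[of u z] by auto

text \<open>These are the entries of \<open>L ** L\<close>: across two levels every common neighbour
  is a midpoint.\<close>

lemma card_mids:
  assumes "u \<in> maxiso" "z \<in> maxiso" "dim (x \<inter> u) = dim (x \<inter> z) + 2"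
  shows "card {w. low u w \<and> low w z} = (if dim (u \<inter> z) + 2 = D then CARD('a) + 1 else 0)"
proof (cases "dim (u \<inter> z) + 2 = D")
  case True
  then show ?thesis
    using card_common_neighbours[OF assms(1,2) True, of "\<lambda>_. True"] mids_eq_common_neighbours[OF assms(3)]
      card_hyperplanes_codim_two[of "u \<inter> z" u] assms(1,2) dim_maxiso[OF assms(1)]
    by (simp add: maxiso_subspace subspace_Int_maxiso)
next
  case False
  have "\<not> (low u w \<and> low w z)" for w
    using common_neighbour_dim[of u w z] not_adj_level_two[OF assms(3)] False lowD(1) by blast
  then show ?thesis using False by simp
qed

lemma base_Int_subset_level_two:
  assumes "u \<in> maxiso" "z \<in> maxiso" "dim (x \<inter> u) = dim (x \<inter> z) + 2" "dim (u \<inter> z) + 2 = D"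
  shows "x \<inter> z \<subseteq> u"
proof -
  have "{w. low u w \<and> low w z} \<noteq> {}"
    using card_mids[OF assms(1-3)] assms(4) by (metis card.empty add_is_0 one_neq_zero)
  then obtain w where "low u w" "low w z" by blast
  then show ?thesis using lowD(5)[of u w] lowD(5)[of w z] by blast
qed

text \<open>The common neighbours form the pencil of hyperplanes of \<open>y\<close> over
  \<open>y \<inter> w\<close>. Together with \<open>x \<inter> y\<close> the latter spans one of
  them, which gives the common lower neighbour; the other \<open>b\<close> give the upper ones. At
  distances other than two both sets are empty.\<close>

lemma common_uppers_lowers:
  assumes "y \<in> maxiso" "w \<in> maxiso" "dim (x \<inter> y) = dim (x \<inter> w)" "x \<inter> y \<noteq> x \<inter> w"
  shows "card {t. low y t \<and> low w t} = CARD('a) * card {u. low u y \<and> low u w}"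
proof (cases "dim (y \<inter> w) + 2 = D")
  case True
  have subs: "subspace (x \<inter> y)" "subspace (x \<inter> w)" "subspace (y \<inter> w)"
    using assms(1,2) base by (simp_all add: subspace_Int_maxiso)
  have nsub: "\<not> x \<inter> y \<subseteq> w" "\<not> x \<inter> w \<subseteq> y"
    using subspace_eqI[OF subs(1,2)] subspace_eqI[OF subs(2,1)] assms(3,4) by auto
  have up: "low y t \<and> low w t \<longleftrightarrow> adj y t \<and> adj t w \<and> \<not> x \<inter> y \<subseteq> t" for t
  proof
    assume "low y t \<and> low w t"
    then show "adj y t \<and> adj t w \<and> \<not> x \<inter> y \<subseteq> t"
      using lowD(1,6)[of y t] lowD(1)[of w t] adj_sym[of w t] by simp
  next
    assume t: "adj y t \<and> adj t w \<and> \<not> x \<inter> y \<subseteq> t"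
    then have "low y t" using lowI by simp
    then show "low y t \<and> low w t" using t assms(3) adj_sym[of w t] by (simp add: low_def)
  qed
  have down: "low t y \<and> low t w \<longleftrightarrow> adj y t \<and> adj t w \<and> x \<inter> y \<subseteq> t" for t
  proof
    assume "low t y \<and> low t w"
    then show "adj y t \<and> adj t w \<and> x \<inter> y \<subseteq> t"
      using lowD(1,5)[of t y] lowD(1)[of t w] adj_sym[of y t] by blast
  next
    assume t: "adj y t \<and> adj t w \<and> x \<inter> y \<subseteq> t"
    \<comment> \<open>Otherwise \<open>t\<close> would be on the level of \<open>w\<close>, and
      \<open>flat_iff\<close> would give \<open>x \<inter> t = x \<inter> w\<close>.\<close>
    have "\<not> x \<inter> t \<subseteq> y"
    proof
      assume "x \<inter> t \<subseteq> y"
      then have e: "x \<inter> t = x \<inter> y" using t by auto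
      then have "flat t w" using t assms(3) by (simp add: flat_def)
      then show False using flat_iff[of t w] e assms(4) by simp
    qed
    then have "low t y" using lowI[of t y] t adj_sym by blast
    then show "low t y \<and> low t w" using t assms(3) by (simp add: low_def)
  qed
  \<comment> \<open>If the two spanned \<open>y\<close>, a vector of \<open>x \<inter> w\<close>
    outside \<open>y\<close>, orthogonal to both, would have to lie in \<open>y\<close>.\<close>
  have "\<not> D \<le> dim (y \<inter> w \<union> x \<inter> y)"
  proof
    assume d: "D \<le> dim (y \<inter> w \<union> x \<inter> y)"
    obtain v where v: "v \<in> x" "v \<in> w" "v \<notin> y" using nsub by blast
    have "v \<in> y"
    proof (rule mem_if_orth_spanning[OF assms(1,2) v(2) _ d])
      fix u assume "u \<in> y \<inter> w \<union> x \<inter> y"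
      then show "\<beta> v u = 0"
        using maxiso_orth[OF assms(2) v(2), of u] maxiso_orth[OF base v(1), of u] by blast
    qed auto
    then show False using v by simp
  qed
  moreover have "dim (y \<inter> w) < dim (y \<inter> w \<union> x \<inter> y)"
  proof -
    have "dim (y \<inter> w) < dim (span (y \<inter> w \<union> x \<inter> y))"
      using subs(3) nsub(1) span_superset[of "y \<inter> w \<union> x \<inter> y"]
      by (intro dim_strict_mono subspace_span) auto
    then show ?thesis by simp
  qed
  ultimately have d: "Suc (dim (y \<inter> w \<union> x \<inter> y)) = D" using True by linarith
  show ?thesis
    unfolding up down using card_common_neighbours_pencil[OF assms(1,2) True _ d] by simp
next
  case False
  have ne: "y \<noteq> w" using assms(4) by auto
  have na: "\<not> adj y w" using assms(3,4) flat_iff[of y w] by (auto simp: flat_def)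
  have "\<not> (adj y t \<and> adj t w)" for t
    using common_neighbour_dim[of y t w] ne na False by blast
  then have "{t. low y t \<and> low w t} = {}" "{t. low t y \<and> low t w} = {}"
    using lowD(1) adj_sym by blast+
  then show ?thesis by (simp only: card.empty mult_0_right)
qed

text \<open>A vector \<open>v\<close> of \<open>x \<inter> y\<close> outside \<open>t\<close> spans
  \<open>w\<close> together with \<open>w \<inter> t\<close>. As \<open>y \<inter> t\<close> is
  orthogonal to both, it lies in \<open>w\<close>, and so does the span of \<open>v\<close> and
  \<open>y \<inter> t\<close>, which is \<open>y\<close>.\<close>

lemma no_common_upper:
  assumes "low y t" "low w t" "x \<inter> y = x \<inter> w"
  shows "y = w"
proof -
  note l = lowD[OF assms(1)] lowD[OF assms(2)]
  obtain v where v: "v \<in> x" "v \<in> y" "v \<notin> t" using l(6) by blast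
  have vw: "v \<in> w" using v assms(3) by blast
  have sub: "subspace (y \<inter> t)" "subspace (w \<inter> t)" using l(2,3,8) by (simp_all add: subspace_Int_maxiso)
  have "y \<inter> t \<subseteq> w"
  proof
    fix g assume g: "g \<in> y \<inter> t"
    show "g \<in> w"
    proof (rule mem_if_orth_spanning[of w y g "insert v (w \<inter> t)"])
      show "D \<le> dim (insert v (w \<inter> t))"
        using adjD(3)[OF l(7)] v(3) sub by (simp add: dim_insert_subspace)
      show "\<beta> g u = 0" if "u \<in> insert v (w \<inter> t)" for u
        using that g maxiso_orth[OF l(2), of g v] maxiso_orth[OF l(3), of g u] v(2) by blast
    qed (use l g vw in auto)
  qed
  then show ?thesis
    using v vw sub adjD(3)[OF l(1)] l(2,8)
    by (intro maxiso_eqI[of y w "insert v (y \<inter> t)"]) (auto simp: dim_insert_subspace)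
qed

section \<open>Two-step paths with one flat step\<close>

text \<open>On the line through \<open>y \<inter> z\<close> the vertex \<open>y\<close> is nearest
  to \<open>x\<close> and all other points share the level of \<open>z\<close>. Omitting
  \<open>y\<close> and \<open>z\<close> from its \<open>s + 1\<close> points leaves the midpoints; a
  path starting with the flat step would require a second nearest point.\<close>

lemma card_low_flat_adj:
  assumes "low y z"
  shows "card {w. low y w \<and> flat w z} + 1 = s" "card {w. flat y w \<and> low w z} = 0"
proof -
  note l = lowD[OF assms]
  let ?G = "y \<inter> z"
  have G: "subspace ?G" "Suc (dim ?G) = D" using l(2,3) adjD(3)[OF l(1)] by (simp_all add: subspace_Int_maxiso)
  have gate: "t = y" if "t \<in> maxiso" "?G \<subseteq> t" "x \<inter> y \<subseteq> t" for t
    using that l(2,6) G base by (intro line_gate_unique[of t y x ?G]) auto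
  have e: "{w. low y w \<and> flat w z} = {t \<in> maxiso. ?G \<subseteq> t} - {y, z}"
  proof (intro equalityI subsetI)
    fix w assume "w \<in> {w. low y w \<and> flat w z}"
    then have w: "low y w" "adj y w" "adj w z" using lowD(1) by (auto simp: flat_def)
    then show "w \<in> {t \<in> maxiso. ?G \<subseteq> t} - {y, z}"
      using triangle_subset[OF l(1), of w] adj_sym[of w z] adjD(2,4)[OF w(2)] adjD(4)[OF w(3)] by blast
  next
    fix w assume "w \<in> {t \<in> maxiso. ?G \<subseteq> t} - {y, z}"
    then have w: "w \<in> maxiso" "?G \<subseteq> w" "y \<noteq> w" "w \<noteq> z" by auto
    have "adj y w" using adjI[OF l(2) w(1,3) _ w(2) G(2)] by blast
    then have "low y w" using gate[OF w(1,2)] w(3) by (intro lowI) auto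
    moreover have "adj w z" using adjI[OF w(1) l(3) w(4) w(2) _ G(2)] by blast
    ultimately show "w \<in> {w. low y w \<and> flat w z}" using l(4) by (simp add: flat_def low_def)
  qed
  have "card {t \<in> maxiso. ?G \<subseteq> t} = Suc s"
    using card_line[OF iso_subset[OF maxiso_iso[OF l(2)] G(1)] G(2)] by simp
  moreover have "y \<noteq> z" using adjD(4)[OF l(1)] .
  moreover have "card ({t \<in> maxiso. ?G \<subseteq> t} - {y, z}) + card {y, z} = card {t \<in> maxiso. ?G \<subseteq> t}"
    using l(2,3) by (subst card_Diff_subset) (auto intro!: le_add_diff_inverse2 card_mono)
  ultimately show "card {w. low y w \<and> flat w z} + 1 = s" by (simp add: e)
  have "\<not> (flat y w \<and> low w z)" for w
  proof
    assume "flat y w \<and> low w z"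
    then have w: "adj y w" "x \<inter> y = x \<inter> w" "adj w z" using lowD(1) by (auto simp: flat_iff)
    have "?G \<subseteq> w" using triangle_subset[OF l(1), of w] w adj_sym[of w z] by blast
    then have "w = y" using gate[of w] w(2) adjD(2)[OF w(1)] by blast
    then show False using adjD(4)[OF w(1)] by simp
  qed
  then show "card {w. flat y w \<and> low w z} = 0" by simp
qed

text \<open>At distance two, a common neighbour containing \<open>x \<inter> y\<close> stays on the
  level of \<open>y\<close>, any other is already on the level of \<open>z\<close>; the pencil
  splits them as one to \<open>b\<close>. Hence the coefficient \<open>q\<^sup>2\<close> of
  \<open>F ** L\<close>.\<close>

lemma card_low_flat_nonadj:
  assumes "y \<in> maxiso" "z \<in> maxiso" "dim (x \<inter> y) = Suc (dim (x \<inter> z))" "\<not> low y z"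
  shows "card {w. low y w \<and> flat w z} = CARD('a) * card {w. flat y w \<and> low w z}"
proof (cases "dim (y \<inter> z) + 2 = D")
  case True
  have subs: "subspace (x \<inter> y)" "subspace (x \<inter> z)" "subspace (y \<inter> z)"
    using assms(1,2) base by (simp_all add: subspace_Int_maxiso)
  have e1: "low y w \<and> flat w z \<longleftrightarrow> adj y w \<and> adj w z \<and> \<not> x \<inter> y \<subseteq> w" for w
    using low_iff[of y w] assms(3) by (auto simp: flat_def low_def)
  have e2: "flat y w \<and> low w z \<longleftrightarrow> adj y w \<and> adj w z \<and> x \<inter> y \<subseteq> w" for w
  proof
    assume "flat y w \<and> low w z"
    then show "adj y w \<and> adj w z \<and> x \<inter> y \<subseteq> w" using lowD(1) by (auto simp: flat_iff)
  next
    assume w: "adj y w \<and> adj w z \<and> x \<inter> y \<subseteq> w"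
    then have "\<not> low y w" using low_iff by blast
    moreover have "dim (x \<inter> y) \<le> dim (x \<inter> w)" using w by (intro dim_subset) auto
    moreover have "dim (x \<inter> w) \<le> Suc (dim (x \<inter> z))" using w adj_level by blast
    ultimately show "flat y w \<and> low w z" using w assms(3) by (auto simp: flat_def low_def)
  qed
  \<comment> \<open>Were it false, \<open>y \<inter> z\<close> and \<open>x \<inter> y\<close> would
    not span \<open>y\<close>; their intersection would then be large enough to fill
    \<open>x \<inter> z\<close>.\<close>
  have sub: "x \<inter> z \<subseteq> y"
  proof (rule ccontr)
    assume "\<not> x \<inter> z \<subseteq> y"
    then obtain v where v: "v \<in> x" "v \<in> z" "v \<notin> y" by blast
    have "\<not> D \<le> dim (y \<inter> z \<union> x \<inter> y)"
    proof
      assume d: "D \<le> dim (y \<inter> z \<union> x \<inter> y)"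
      have "v \<in> y"
      proof (rule mem_if_orth_spanning[OF assms(1,2) v(2) _ d])
        fix u assume "u \<in> y \<inter> z \<union> x \<inter> y"
        then show "\<beta> v u = 0"
          using maxiso_orth[OF assms(2) v(2), of u] maxiso_orth[OF base v(1), of u] by blast
      qed auto
      then show False using v by simp
    qed
    then have "dim (x \<inter> z) \<le> dim (y \<inter> z \<inter> (x \<inter> y))"
      using dim_Un_Int[OF subs(3,1)] True assms(3) by linarith
    then have "y \<inter> z \<inter> (x \<inter> y) = x \<inter> z"
      using subs subspace_inter[OF subs(3,1)] by (intro subspace_eqI) auto
    then show False using v by blast
  qed
  then have "y \<inter> z \<inter> (x \<inter> y) = x \<inter> z" by blast
  then have d: "Suc (dim (y \<inter> z \<union> x \<inter> y)) = D"
    using dim_Un_Int[OF subs(3,1)] True assms(3) by simp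
  show ?thesis
    unfolding e1 e2 using card_common_neighbours_pencil[OF assms(1,2) True _ d] by simp
next
  case False
  have ne: "y \<noteq> z" using assms(3) by auto
  have na: "\<not> adj y z" using assms(3,4) by (auto simp: low_def)
  have "\<not> (adj y w \<and> adj w z)" for w
    using common_neighbour_dim[of y w z] ne na False by blast
  then have "{w. low y w \<and> flat w z} = {}" "{w. flat y w \<and> low w z} = {}"
    by (auto simp: low_def flat_def)
  then show ?thesis by (simp only: card.empty mult_0_right)
qed

section \<open>Three-step paths and the cubic relation\<close>

text \<open>Every midpoint \<open>w\<close> contains \<open>x \<inter> z\<close>, so
  \<open>x \<inter> w = x \<inter> y\<close> is impossible unless
  \<open>x \<inter> z \<subseteq> y\<close>. In that case it amounts to
  \<open>x \<inter> y \<subseteq> w\<close>, which singles out one hyperplane of the pencil.\<close>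

lemma card_mids_distinct:
  assumes "low u y" "z \<in> maxiso" "dim (x \<inter> y) = Suc (dim (x \<inter> z))"
  shows "\<not> x \<inter> z \<subseteq> y \<Longrightarrow> card {w. low u w \<and> low w z \<and> x \<inter> w \<noteq> x \<inter> y} = card {w. low u w \<and> low w z}"
    and "x \<inter> z \<subseteq> y \<Longrightarrow> card {w. low u w \<and> low w z \<and> x \<inter> w \<noteq> x \<inter> y}
      = (if dim (u \<inter> z) + 2 = D then CARD('a) else 0)"
proof -
  note l = lowD[OF assms(1)]
  have lev: "dim (x \<inter> u) = dim (x \<inter> z) + 2" using l(4) assms(3) by simp
  {
    assume n: "\<not> x \<inter> z \<subseteq> y"
    have "x \<inter> w \<noteq> x \<inter> y" if "low w z" for w
      using lowD(5)[OF that] n by blast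
    then have "{w. low u w \<and> low w z \<and> x \<inter> w \<noteq> x \<inter> y} = {w. low u w \<and> low w z}" by blast
    then show "card {w. low u w \<and> low w z \<and> x \<inter> w \<noteq> x \<inter> y} = card {w. low u w \<and> low w z}"
      by simp
  }
  assume c: "x \<inter> z \<subseteq> y"
  show "card {w. low u w \<and> low w z \<and> x \<inter> w \<noteq> x \<inter> y} = (if dim (u \<inter> z) + 2 = D then CARD('a) else 0)"
  proof (cases "dim (u \<inter> z) + 2 = D")
    case True
    have subs: "subspace (x \<inter> y)" "subspace (x \<inter> z)" "subspace (u \<inter> z)"
      using assms(2) l(2,3) base by (simp_all add: subspace_Int_maxiso)
    have e: "low u w \<and> low w z \<and> x \<inter> w \<noteq> x \<inter> y \<longleftrightarrow> adj u w \<and> adj w z \<and> \<not> x \<inter> y \<subseteq> w" for w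
    proof -
      have "x \<inter> w = x \<inter> y \<longleftrightarrow> x \<inter> y \<subseteq> w" if "low w z"
      proof
        assume "x \<inter> y \<subseteq> w"
        then have "x \<inter> y = x \<inter> w"
          using lowD(2,4)[OF that] assms(3) subs(1) base
          by (intro subspace_eqI) (auto simp: subspace_Int_maxiso)
        then show "x \<inter> w = x \<inter> y" by simp
      qed auto
      then show ?thesis using mids_eq_common_neighbours[OF lev, of w] by blast
    qed
    have "u \<inter> z \<inter> (x \<inter> y) = x \<inter> z" using c l(5) by blast
    then have "Suc (dim (u \<inter> z \<union> x \<inter> y)) = D"
      using dim_Un_Int[OF subs(3,1)] True assms(3) by simp
    moreover have "x \<inter> y \<subseteq> u" using l(5) by blast
    ultimately show ?thesis
      unfolding e using card_common_neighbours_pencil(2)[OF l(2) assms(2) True] True by simp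
  next
    case False
    have "\<not> (low u w \<and> low w z)" for w
      using card_mids[OF l(2) assms(2) lev] False by auto
    then show ?thesis using False by auto
  qed
qed

text \<open>A vector \<open>v\<close> of \<open>x \<inter> z\<close> outside \<open>t\<close> also
  lies in \<open>y\<close>. If \<open>y\<close> and \<open>t\<close> are at distance two,
  \<open>y \<inter> t\<close> is orthogonal to \<open>v\<close> and to \<open>z \<inter> t\<close>,
  hence contained in \<open>z\<close>, and adding \<open>v\<close> to it gives dimension
  \<open>D - 1\<close>.\<close>

lemma upper_paths_base_subset:
  assumes "y \<in> maxiso" "z \<in> maxiso" "dim (x \<inter> y) = Suc (dim (x \<inter> z))" "x \<inter> z \<subseteq> y" "low z t"
  shows "dim (y \<inter> t) + 2 = D \<longleftrightarrow> low y z"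
proof
  note l = lowD[OF assms(5)]
  have lev: "dim (x \<inter> y) = dim (x \<inter> t) + 2" using assms(3) l(4) by simp
  {
    assume "low y z"
    then show "dim (y \<inter> t) + 2 = D"
      using common_neighbour_dim[OF lowD(1) l(1)] not_adj_level_two[OF lev] by blast
  }
  assume d: "dim (y \<inter> t) + 2 = D"
  obtain v where v: "v \<in> x" "v \<in> z" "v \<notin> t" using l(6) by blast
  have vy: "v \<in> y" using v assms(4) by blast
  have "t \<inter> y \<subseteq> z"
  proof
    fix g assume g: "g \<in> t \<inter> y"
    show "g \<in> z"
    proof (rule mem_if_orth_spanning[of z t g "insert v (z \<inter> t)"])
      show "D \<le> dim (insert v (z \<inter> t))"
        using adjD(3)[OF l(1)] v(3) subspace_Int_maxiso[OF l(2,3)] by (simp add: dim_insert_subspace)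
      show "\<beta> g u = 0" if "u \<in> insert v (z \<inter> t)" for u
        using that g maxiso_orth[OF assms(1), of g v] maxiso_orth[OF l(3), of g u] vy by blast
    qed (use l g v in auto)
  qed
  then have "insert v (y \<inter> t) \<subseteq> y \<inter> z" using v vy by blast
  moreover have "dim (insert v (y \<inter> t)) = Suc (dim (y \<inter> t))"
    using v subspace_Int_maxiso[OF assms(1) l(3)] by (simp add: dim_insert_subspace)
  ultimately have "D \<le> Suc (dim (y \<inter> z))" using d dim_subset[of "insert v (y \<inter> t)" "y \<inter> z"] by simp
  moreover have "y \<noteq> z" using assms(3) by auto
  ultimately have "adj y z" using dim_Int_lt[OF assms(1,2)] assms(1,2) by (simp add: adj_def)
  then show "low y z" using assms(3) by (simp add: low_def)
qed

text \<open>A vector \<open>v\<close> of \<open>x \<inter> z\<close> outside \<open>y\<close>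
  determines the only candidate \<open>u0\<close> for \<open>u\<close>, spanned by \<open>v\<close>
  and \<open>y \<inter> perp {v}\<close>. Either both sets are empty, or
  \<open>dim (y \<inter> z) = D - 3\<close> and the \<open>t\<close> correspond to the hyperplanes
  of \<open>z\<close> that contain \<open>y \<inter> z\<close> but not \<open>v\<close>, which
  number \<open>(b ^ 3 - b ^ 2) / (b - 1)\<close>.\<close>

lemma upper_paths_base_not_subset:
  assumes "y \<in> maxiso" "z \<in> maxiso" "dim (x \<inter> y) = Suc (dim (x \<inter> z))" "\<not> x \<inter> z \<subseteq> y"
  shows "card {t. low z t \<and> dim (y \<inter> t) + 2 = D}
    = CARD('a)\<^sup>2 * card {u. low u y \<and> dim (u \<inter> z) + 2 = D}"
proof -
  obtain v where v: "v \<in> x" "v \<in> z" "v \<notin> y" using assms(4) by blast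
  note suby = maxiso_subspace[OF assms(1)] and subz = maxiso_subspace[OF assms(2)]
  define G where "G = y \<inter> perp {v}"
  have subG: "subspace G" unfolding G_def using suby subspace_perp by (rule subspace_inter)
  have perpv: "g \<in> perp {v} \<longleftrightarrow> \<beta> g v = 0" for g by (simp add: perp_def)
  have singv: "sing v" using isoD(2)[OF maxiso_iso[OF base] v(1)] .
  have "\<not> y \<subseteq> perp {v}"
  proof
    assume "y \<subseteq> perp {v}"
    then have "v \<in> perp y" using perp_sym[of y "{v}"] by simp
    then show False using maxiso_memI[OF assms(1) singv] v(3) by simp
  qed
  then have "dim G < dim y"
    unfolding G_def using suby subspace_perp by (intro dim_strict_mono subspace_inter) auto
  then have dG: "Suc (dim G) = D"
    using dim_perp_singleton[OF suby, of v] dim_maxiso[OF assms(1)] by (simp add: G_def)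
  have vG: "v \<notin> G" using v(3) by (simp add: G_def)
  define u0 where "u0 = span (insert v G)"
  have G_u0: "G \<subseteq> u0" "v \<in> u0" using span_superset[of "insert v G"] by (auto simp: u0_def)
  have "v \<in> perp G" using perp_sym[of G "{v}"] by (simp add: G_def)
  then have "iso u0"
    unfolding u0_def using iso_insert[OF iso_subset[OF maxiso_iso[OF assms(1)] subG] singv]
    by (simp add: G_def)
  moreover have "dim u0 = dim y"
    using vG subG dG dim_maxiso[OF assms(1)] by (simp add: u0_def dim_insert_subspace)
  ultimately have u0: "u0 \<in> maxiso" using maxiso_iff_dim[OF assms(1)] by blast
  have Gy: "G \<subseteq> y" by (simp add: G_def)
  have "u0 \<noteq> y" using G_u0 v(3) by blast
  then have adj_u0: "adj u0 y" by (rule adjI[OF u0 assms(1) _ G_u0(1) Gy dG])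
  then have low_u0: "low u0 y" using G_u0 v by (intro lowI) auto
  have lev: "dim (x \<inter> u0) = dim (x \<inter> z) + 2" using lowD(4)[OF low_u0] assms(3) by simp
  \<comment> \<open>The difference of two levels forces \<open>v\<close> into \<open>u\<close>, so
    \<open>u \<inter> y\<close> is orthogonal to \<open>v\<close> and equals
    \<open>G\<close>.\<close>
  have u0_unique: "u = u0" if "low u y" "dim (u \<inter> z) + 2 = D" for u
  proof -
    note l = lowD[OF that(1)]
    have "dim (x \<inter> u) = dim (x \<inter> z) + 2" using l(4) assms(3) by simp
    then have vu: "v \<in> u" using base_Int_subset_level_two[OF l(2) assms(2) _ that(2)] v by blast
    have "u \<inter> y \<subseteq> G" using maxiso_orth[OF l(2) _ vu] by (auto simp: G_def perpv)
    then have "u \<inter> y = G"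
      using adjD(3)[OF l(1)] dG subspace_Int_maxiso[OF l(2,3)] subG by (intro subspace_eqI) auto
    then have "insert v G \<subseteq> u" using vu by blast
    then show ?thesis
      using G_u0 vG subG dG by (intro maxiso_eqI[OF l(2) u0, of "insert v G"]) (auto simp: dim_insert_subspace)
  qed
  have yz_perp: "y \<inter> z \<subseteq> G" using maxiso_orth[OF assms(2) _ v(2)] by (auto simp: G_def perpv)
  \<comment> \<open>As \<open>x \<inter> t \<subseteq> y\<close>, the vector \<open>v\<close> is not
    in \<open>t\<close>; and \<open>t \<inter> G\<close> lies in \<open>z\<close>, being orthogonal
    to \<open>v\<close> and \<open>z \<inter> t\<close>. Adding \<open>v\<close> to it shows that
    the existence of \<open>t\<close> puts \<open>u0\<close> at distance two from
    \<open>z\<close>.\<close>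
  have t_props: "v \<notin> t \<and> t \<inter> G \<subseteq> z \<and> dim (y \<inter> t) \<le> Suc (dim (t \<inter> G)) \<and> dim (u0 \<inter> z) + 2 = D"
    if t: "low z t" "dim (y \<inter> t) + 2 = D" for t
  proof -
    note l = lowD[OF t(1)]
    have "dim (x \<inter> y) = dim (x \<inter> t) + 2" using l(4) assms(3) by simp
    then have vt: "v \<notin> t" using base_Int_subset_level_two[OF assms(1) l(3) _ t(2)] v by blast
    have tGz: "t \<inter> G \<subseteq> z"
    proof
      fix g assume g: "g \<in> t \<inter> G"
      show "g \<in> z"
      proof (rule mem_if_orth_spanning[of z t g "insert v (z \<inter> t)"])
        show "D \<le> dim (insert v (z \<inter> t))"
          using adjD(3)[OF l(1)] vt subspace_Int_maxiso[OF l(2,3)] by (simp add: dim_insert_subspace)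
        show "\<beta> g u = 0" if "u \<in> insert v (z \<inter> t)" for u
          using that g maxiso_orth[OF l(3), of g u] by (auto simp: G_def perpv)
      qed (use l g v in auto)
    qed
    have "y \<inter> t \<inter> perp {v} = t \<inter> G" by (auto simp: G_def)
    then have dtG: "dim (y \<inter> t) \<le> Suc (dim (t \<inter> G))"
      using dim_perp_singleton[OF subspace_Int_maxiso[OF assms(1) l(3)], of v] by simp
    have "subspace (t \<inter> G)" using maxiso_subspace[OF l(3)] subG by (rule subspace_inter)
    then have "dim (insert v (t \<inter> G)) = Suc (dim (t \<inter> G))" using vG by (simp add: dim_insert_subspace)
    moreover have "dim (insert v (t \<inter> G)) \<le> dim (u0 \<inter> z)"
      using tGz G_u0 v by (intro dim_subset) auto
    ultimately have "D \<le> dim (u0 \<inter> z) + 2" using dtG t(2) by linarith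
    moreover have "dim (u0 \<inter> z) < D" using dim_Int_lt[OF u0 assms(2)] not_adj_level_two[OF lev] by blast
    moreover have "Suc (dim (u0 \<inter> z)) \<noteq> D"
      using not_adj_level_two[OF lev] u0 assms(2) by (simp add: adj_def)
    ultimately show ?thesis using vt tGz dtG by linarith
  qed
  show ?thesis
  proof (cases "dim (u0 \<inter> z) + 2 = D")
    case False
    have "{t. low z t \<and> dim (y \<inter> t) + 2 = D} = {}" using t_props False by blast
    moreover have "{u. low u y \<and> dim (u \<inter> z) + 2 = D} = {}" using u0_unique False by blast
    ultimately show ?thesis by (simp only: card.empty mult_0_right)
  next
    case True
    have "{u. low u y \<and> dim (u \<inter> z) + 2 = D} = {u0}" using u0_unique low_u0 True by blast
    then have c1: "card {u. low u y \<and> dim (u \<inter> z) + 2 = D} = 1" by simp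
    let ?M = "y \<inter> z"
    have subM: "subspace ?M" using assms(1,2) by (rule subspace_Int_maxiso)
    have "u0 \<inter> z \<inter> y = ?M" using yz_perp G_u0 by blast
    then have "dim (u0 \<inter> z) \<le> Suc (dim ?M)"
      using dim_le_adj_Int[OF adj_u0 subspace_Int_maxiso[OF u0 assms(2)]] by simp
    moreover have "dim ?M < dim (u0 \<inter> z)"
    proof (rule dim_strict_mono[OF subM subspace_Int_maxiso[OF u0 assms(2)]])
      show "?M \<subseteq> u0 \<inter> z" using yz_perp G_u0 by blast
      show "?M \<noteq> u0 \<inter> z" using G_u0 v by blast
    qed
    ultimately have dM: "dim ?M + 3 = D" using True by linarith
    have M_t: "?M \<subseteq> t" if t: "low z t" "dim (y \<inter> t) + 2 = D" for t
    proof -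
      have "t \<inter> G \<subseteq> ?M" using t_props[OF t] Gy by blast
      then have "t \<inter> G = ?M"
        using t_props[OF t] t(2) dM subM subspace_inter[OF maxiso_subspace[OF lowD(3)[OF t(1)]] subG]
        by (intro subspace_eqI) auto
      then show ?thesis by blast
    qed
    have inj: "inj_on (\<lambda>t. t \<inter> z) {t. low z t \<and> dim (y \<inter> t) + 2 = D}"
    proof (rule inj_onI)
      fix t t' assume "t \<in> {t. low z t \<and> dim (y \<inter> t) + 2 = D}" "t' \<in> {t. low z t \<and> dim (y \<inter> t) + 2 = D}"
      then have t: "low z t" "dim (y \<inter> t) + 2 = D" "low z t'" "dim (y \<inter> t') + 2 = D" by auto
      assume e: "t \<inter> z = t' \<inter> z"
      have n: "\<not> r \<inter> y \<subseteq> z" if r: "dim (y \<inter> r) + 2 = D" for r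
      proof
        assume "r \<inter> y \<subseteq> z"
        then have "dim (y \<inter> r) \<le> dim ?M" by (intro dim_subset) auto
        then show False using r dM by linarith
      qed
      show "t = t'"
      proof (rule line_gate_unique[OF lowD(3)[OF t(1)] lowD(3)[OF t(3)] assms(1), of "t \<inter> z"])
        show "subspace (t \<inter> z)" using subspace_Int_maxiso[OF lowD(3)[OF t(1)] assms(2)] .
        show "Suc (dim (t \<inter> z)) = D"
          using adjD(3)[OF lowD(1)[OF t(1)]] by (simp add: Int_commute)
      qed (use n[OF t(2)] n[OF t(4)] e in blast)+
    qed
    \<comment> \<open>From a hyperplane \<open>H\<close> the vertex \<open>t\<close> is recovered as
      the point nearest to \<open>y\<close> on the line \<open>H\<close>.\<close>
    have img: "(\<lambda>t. t \<inter> z) ` {t. low z t \<and> dim (y \<inter> t) + 2 = D} = {H \<in> hyperplanes ?M z. \<not> {v} \<subseteq> H}"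
    proof (intro equalityI subsetI)
      fix H assume "H \<in> (\<lambda>t. t \<inter> z) ` {t. low z t \<and> dim (y \<inter> t) + 2 = D}"
      then obtain t where t: "low z t" "dim (y \<inter> t) + 2 = D" and H: "H = t \<inter> z" by blast
      have "subspace H" unfolding H using subspace_Int_maxiso[OF lowD(3)[OF t(1)] assms(2)] .
      moreover have "Suc (dim H) = dim z"
        using adjD(3)[OF lowD(1)[OF t(1)]] dim_maxiso[OF assms(2)] by (simp add: H Int_commute)
      ultimately show "H \<in> {H \<in> hyperplanes ?M z. \<not> {v} \<subseteq> H}"
        using t_props[OF t] M_t[OF t] by (auto simp: hyperplanes_def H)
    next
      fix H assume "H \<in> {H \<in> hyperplanes ?M z. \<not> {v} \<subseteq> H}"
      then have H: "subspace H" "?M \<subseteq> H" "H \<subseteq> z" "Suc (dim H) = D" "v \<notin> H"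
        using dim_maxiso[OF assms(2)] by (auto simp: hyperplanes_def)
      obtain t where t: "t \<in> maxiso" "H \<subseteq> t" "\<not> t \<inter> y \<subseteq> H"
        using line_gate_exists[OF assms(2,1) H(1,3,4)] by blast
      have "H \<inter> y = ?M" using H by blast
      then have d: "dim (y \<inter> t) + 2 = D"
        using dim_gate_Int[OF t(1) assms(1) H(1,4) t(2,3)] dM by (simp add: Int_commute)
      have "z \<noteq> t" using t(3) H(2) by blast
      then have a: "adj z t" by (rule adjI[OF assms(2) t(1) _ H(3) t(2) H(4)])
      have e: "z \<inter> t = H" by (rule adj_Int_eq[OF a H(1,3) t(2) H(4)])
      then have "low z t" using v H(5) by (intro lowI[OF a]) blast
      then show "H \<in> (\<lambda>t. t \<inter> z) ` {t. low z t \<and> dim (y \<inter> t) + 2 = D}"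
        using d e by (intro image_eqI[of _ _ t]) auto
    qed
    have "card {t. low z t \<and> dim (y \<inter> t) + 2 = D} = card {H \<in> hyperplanes ?M z. \<not> {v} \<subseteq> H}"
      using card_image[OF inj] img by simp
    moreover have "int (card {H \<in> hyperplanes ?M z. \<not> {v} \<subseteq> H}) * (int CARD('a) - 1)
        = (int CARD('a))\<^sup>2 * (int CARD('a) - 1)"
    proof -
      have dz: "dim z = dim ?M + 3" using dM dim_maxiso[OF assms(2)] by simp
      have du: "dim (?M \<union> {v}) = Suc (dim ?M)" using subM v by (simp add: dim_insert_subspace)
      have "dim z - dim ?M = 3" "dim z - dim (?M \<union> {v}) = 2" using dz du by linarith+
      moreover have "int CARD('a) ^ 3 - int CARD('a) ^ 2 = (int CARD('a))\<^sup>2 * (int CARD('a) - 1)"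
        by (simp add: power2_eq_square power3_eq_cube algebra_simps)
      ultimately show ?thesis
        using card_hyperplanes_avoiding[OF subM subz Int_lower2, of "{v}"] v(2) by simp
    qed
    ultimately have "int (card {t. low z t \<and> dim (y \<inter> t) + 2 = D}) = int (CARD('a)\<^sup>2)"
      using card_finite_field_ge_2[where 'a = 'a] by simp
    then show ?thesis using c1 by simp
  qed
qed

text \<open>An entry of \<open>L ** R ** L\<close> is split by the vertex \<open>w\<close> reached
  after two steps: \<open>w = y\<close> contributes an upper degree, other \<open>w\<close> with
  \<open>x \<inter> w = x \<inter> y\<close> contribute nothing by \<open>no_common_upper\<close>,
  and for the rest \<open>common_uppers_lowers\<close> trades upper for lower neighbours before the
  sums are exchanged.\<close>

lemma lower_upper_lower_paths:
  assumes "y \<in> maxiso" "z \<in> maxiso" "dim (x \<inter> y) = Suc (dim (x \<inter> z))"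
  shows "(\<Sum>w | low w z. card {t. low y t \<and> low w t})
    = (if low y z then card {t. low y t} else 0)
      + CARD('a) * (\<Sum>u | low u y. card {w. low u w \<and> low w z \<and> x \<inter> w \<noteq> x \<inter> y})"
proof -
  have "card {t. low y t \<and> low w t} = (if w = y then card {t. low y t} else 0)
      + CARD('a) * (if x \<inter> w \<noteq> x \<inter> y then card {u. low u y \<and> low u w} else 0)" if w: "low w z" for w
  proof -
    consider "w = y" | "w \<noteq> y" "x \<inter> w = x \<inter> y" | "w \<noteq> y" "x \<inter> w \<noteq> x \<inter> y" by blast
    then show ?thesis
    proof cases
      case 2
      have "{t. low y t \<and> low w t} = {}" using no_common_upper[of y _ w] 2 by auto
      then show ?thesis using 2 by (simp only: card.empty) simp
    next
      case 3
      have "dim (x \<inter> y) = dim (x \<inter> w)" using lowD(4)[OF w] assms(3) by simp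
      then show ?thesis using 3 common_uppers_lowers[OF assms(1) lowD(2)[OF w]] by auto
    qed simp
  qed
  then have "(\<Sum>w | low w z. card {t. low y t \<and> low w t})
      = (\<Sum>w | low w z. if w = y then card {t. low y t} else 0)
        + CARD('a) * (\<Sum>w | low w z. if x \<inter> w \<noteq> x \<inter> y then card {u. low u y \<and> low u w} else 0)"
    by (simp add: sum.distrib sum_distrib_left)
  also have "(\<Sum>w | low w z. if w = y then card {t. low y t} else 0) = (if low y z then card {t. low y t} else 0)"
    by (simp add: sum.delta)
  also have "(\<Sum>w | low w z. if x \<inter> w \<noteq> x \<inter> y then card {u. low u y \<and> low u w} else 0)
      = (\<Sum>w | low w z \<and> x \<inter> w \<noteq> x \<inter> y. card {u \<in> {u. low u y}. low u w})"
    by (simp add: sum.inter_filter[symmetric])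
  also have "\<dots> = (\<Sum>u | low u y. card {w \<in> {w. low w z \<and> x \<inter> w \<noteq> x \<inter> y}. low u w})"
    by (rule double_counting) simp_all
  also have "\<dots> = (\<Sum>u | low u y. card {w. low u w \<and> low w z \<and> x \<inter> w \<noteq> x \<inter> y})"
    by (intro sum.cong refl arg_cong[where f = card]) auto
  finally show ?thesis .
qed

text \<open>The sums are the entries of \<open>R ** L ** L\<close>, \<open>L ** R ** L\<close> and
  \<open>L ** L ** R\<close>. \<open>A\<close> and \<open>B\<close> count the possible
  \<open>u\<close> and \<open>t\<close>; each carries \<open>b + 1\<close> midpoints, which cancels
  the denominators.\<close>

lemma cubic_count:
  fixes b :: real
  assumes "y \<in> maxiso" "z \<in> maxiso" "dim (x \<inter> y) = Suc (dim (x \<inter> z))"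
  defines "b \<equiv> real CARD('a)"
  shows "b\<^sup>2 / (b + 1) * real (\<Sum>u | low u y. card {w. low u w \<and> low w z})
      - real (\<Sum>w | low w z. card {t. low y t \<and> low w t})
      + inverse b / (b + 1) * real (\<Sum>t | low z t. card {w. low y w \<and> low w t})
    = - (if low y z then real s * b ^ (D - 1) else 0)"
proof -
  define A where "A = card {u. low u y \<and> dim (u \<inter> z) + 2 = D}"
  define B where "B = card {t. low z t \<and> dim (y \<inter> t) + 2 = D}"
  define U where "U = (if low y z then card {t. low y t} else 0)"
  have b: "b \<ge> 2" using card_finite_field_ge_2[where 'a = 'a] by (simp add: b_def)
  have casts: "real ((CARD('a) + 1) * n) = (b + 1) * real n" "real (m + CARD('a) * n) = real m + b * real n"
    "real (CARD('a) * n) = b * real n" "real (CARD('a)\<^sup>2 * n) = b\<^sup>2 * real n" for m n :: nat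
    by (simp_all add: b_def distrib_right)
  have cancel: "c / (b + 1) * ((b + 1) * r) = c * r" for c r using b by simp
  have "(\<Sum>u | low u y. card {w. low u w \<and> low w z})
      = (\<Sum>u | low u y. if dim (u \<inter> z) + 2 = D then CARD('a) + 1 else 0)"
    using card_mids[of _ z] assms(2,3) lowD(2,4) by (intro sum.cong) auto
  then have RLL: "(\<Sum>u | low u y. card {w. low u w \<and> low w z}) = (CARD('a) + 1) * A"
    by (simp only: sum_Collect_if finite A_def of_nat_id mult.commute)
  have "(\<Sum>t | low z t. card {w. low y w \<and> low w t})
      = (\<Sum>t | low z t. if dim (y \<inter> t) + 2 = D then CARD('a) + 1 else 0)"
    using card_mids[of y] assms(1,3) lowD(3,4) by (intro sum.cong) auto
  then have LLR: "(\<Sum>t | low z t. card {w. low y w \<and> low w t}) = (CARD('a) + 1) * B"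
    by (simp only: sum_Collect_if finite B_def of_nat_id mult.commute)
  note LRL = lower_upper_lower_paths[OF assms(1-3), folded U_def]
  show ?thesis
  proof (cases "x \<inter> z \<subseteq> y")
    case True
    have "(\<Sum>u | low u y. card {w. low u w \<and> low w z \<and> x \<inter> w \<noteq> x \<inter> y})
        = (\<Sum>u | low u y. if dim (u \<inter> z) + 2 = D then CARD('a) else 0)"
      using card_mids_distinct(2)[OF _ assms(2,3) True] by (intro sum.cong) auto
    then have S: "(\<Sum>u | low u y. card {w. low u w \<and> low w z \<and> x \<inter> w \<noteq> x \<inter> y}) = CARD('a) * A"
      by (simp only: sum_Collect_if finite A_def of_nat_id mult.commute)
    have "{t. low z t \<and> dim (y \<inter> t) + 2 = D} = (if low y z then {t. low z t} else {})"
      using upper_paths_base_subset[OF assms(1-3) True] by auto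
    then have B: "B = (if low y z then card {t. low z t} else 0)" by (simp add: B_def)
    \<comment> \<open>This is what remains once the terms in \<open>A\<close> have cancelled. The
      second powers of \<open>b\<close> in the upper degrees of \<open>y\<close> and
      \<open>z\<close> differ by the factor \<open>b\<close> and cancel as well.\<close>
    have "inverse b * real B - real U = - (if low y z then real s * b ^ (D - 1) else 0)"
    proof (cases "low y z")
      case True
      have "dim (x \<inter> y) \<le> dim x" by (intro dim_subset) auto
      then have dy: "dim (x \<inter> y) \<le> D" using dim_maxiso[OF base] by simp
      then have D: "D = Suc (D - 1)" and dz: "D - dim (x \<inter> z) = Suc (D - dim (x \<inter> y))"
        using assms(3) by auto
      have "real_of_int (int (card {t. low y t}) * (int CARD('a) - 1))
          = real_of_int (int s * (int CARD('a) ^ D - int CARD('a) ^ (D - dim (x \<inter> y))))"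
        by (simp only: upper_degree[OF assms(1)])
      then have uy: "real U * (b - 1) = real s * (b ^ D - b ^ (D - dim (x \<inter> y)))"
        using True by (simp add: U_def b_def)
      have "real_of_int (int (card {t. low z t}) * (int CARD('a) - 1))
          = real_of_int (int s * (int CARD('a) ^ D - int CARD('a) ^ (D - dim (x \<inter> z))))"
        by (simp only: upper_degree[OF assms(2)])
      then have uz: "real B * (b - 1) = real s * (b ^ D - b * b ^ (D - dim (x \<inter> y)))"
        using True by (simp add: B b_def dz)
      have bD: "b ^ D = b * b ^ (D - 1)" by (subst D) simp
      have "(inverse b * real B - real U) * (b - 1) = inverse b * (real B * (b - 1)) - real U * (b - 1)"
        by (simp only: left_diff_distrib mult.assoc)
      also have "\<dots> = - (real s * b ^ (D - 1)) * (b - 1)"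
        unfolding uy uz bD using b by (simp add: field_simps)
      finally have "inverse b * real B - real U = - (real s * b ^ (D - 1))"
        using b by (simp only: mult_cancel_right) simp
      then show ?thesis using True by simp
    qed (simp add: U_def B)
    moreover have "b\<^sup>2 / (b + 1) * ((b + 1) * real A) - (real U + b * (b * real A))
        + inverse b / (b + 1) * ((b + 1) * real B) = inverse b * real B - real U"
      unfolding cancel by (simp add: power2_eq_square)
    ultimately show ?thesis
      unfolding RLL LLR LRL S casts by (simp only:)
  next
    case False
    have "(\<Sum>u | low u y. card {w. low u w \<and> low w z \<and> x \<inter> w \<noteq> x \<inter> y})
        = (\<Sum>u | low u y. card {w. low u w \<and> low w z})"
      using card_mids_distinct(1)[OF _ assms(2,3) False] by (intro sum.cong) auto
    then have S: "(\<Sum>u | low u y. card {w. low u w \<and> low w z \<and> x \<inter> w \<noteq> x \<inter> y}) = (CARD('a) + 1) * A"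
      by (simp only: RLL)
    have nl: "\<not> low y z" using lowD(5)[of y z] False by blast
    have B: "B = CARD('a)\<^sup>2 * A"
      unfolding A_def B_def by (rule upper_paths_base_not_subset[OF assms(1-3) False])
    \<comment> \<open>With \<open>B = b\<^sup>2 A\<close> the coefficient of \<open>A\<close> is
      \<open>b\<^sup>2 - b (b + 1) + b = 0\<close>.\<close>
    have "b\<^sup>2 / (b + 1) * ((b + 1) * real A) - b * ((b + 1) * real A)
        + inverse b / (b + 1) * ((b + 1) * (b\<^sup>2 * real A)) = 0"
      unfolding cancel using b by (simp add: field_simps power2_eq_square)
    moreover have "U = 0" using nl by (simp add: U_def)
    ultimately show ?thesis
      unfolding RLL LLR LRL S B casts using nl by (simp only: if_False of_nat_0 add_0 minus_zero)
  qed
qed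

section \<open>Path distance from the base vertex\<close>

text \<open>A step changes the level by at most one, which bounds the distance below. Conversely a
  hyperplane of \<open>y\<close> over \<open>x \<inter> y\<close> is a line whose point nearest to
  \<open>x\<close> is a neighbour of \<open>y\<close> one level closer.\<close>

lemma path_dist_adj:
  assumes "y \<in> maxiso"
  shows "path_dist {(y, z). adj y z} x y = D - dim (x \<inter> y)"
proof -
  let ?E = "{(y, z). adj y z}"
  have lower: "D \<le> dim (x \<inter> y) + n" if "(x, y) \<in> ?E ^^ n" for n y
    using that
  proof (induction n arbitrary: y)
    case 0
    then show ?case using dim_maxiso[OF base] by simp
  next
    case (Suc n)
    then obtain w where "(x, w) \<in> ?E ^^ n" "adj w y" by auto
    then show ?case using Suc.IH[of w] adj_level[of w y] by linarith
  qed
  have upper: "(x, y) \<in> ?E ^^ n" if "y \<in> maxiso" "D = dim (x \<inter> y) + n" for n y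
    using that
  proof (induction n arbitrary: y)
    case 0
    then have "x = y" using maxiso_eqI[OF base 0(1), of "x \<inter> y"] by simp
    then show ?case by simp
  next
    case (Suc n)
    have "dim y - dim (x \<inter> y) > 0" using Suc.prems dim_maxiso[OF Suc.prems(1)] by simp
    then have "int CARD('a) ^ (dim y - dim (x \<inter> y)) > 1"
      using card_finite_field_ge_2[where 'a = 'a] by (intro one_less_power) auto
    then have "hyperplanes (x \<inter> y) y \<noteq> {}"
      using card_hyperplanes_mult[OF subspace_Int_maxiso[OF base Suc.prems(1)] maxiso_subspace[OF Suc.prems(1)]]
      by auto
    then obtain G where "G \<in> hyperplanes (x \<inter> y) y" by blast
    then have G: "subspace G" "x \<inter> y \<subseteq> G" "G \<subseteq> y" "Suc (dim G) = D"
      using dim_maxiso[OF Suc.prems(1)] by (auto simp: hyperplanes_def)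
    obtain t where t: "t \<in> maxiso" "G \<subseteq> t" "\<not> t \<inter> x \<subseteq> G"
      using line_gate_exists[OF Suc.prems(1) base G(1,3,4)] by blast
    have "t \<noteq> y" using t(3) G(2) by blast
    then have a: "adj t y" by (rule adjI[OF t(1) Suc.prems(1) _ t(2) G(3,4)])
    have "low t y" using t(3) adj_Int_eq[OF a G(1) t(2) G(3,4)] by (intro lowI[OF a]) blast
    then have "dim (x \<inter> t) = Suc (dim (x \<inter> y))" by (rule lowD(4))
    then have "(x, t) \<in> ?E ^^ n" using Suc.IH[OF t(1)] Suc.prems(2) by simp
    then show ?case using a by auto
  qed
  have "dim (x \<inter> y) \<le> dim x" by (intro dim_subset) auto
  then have "dim (x \<inter> y) \<le> D" using dim_maxiso[OF base] by simp
  then have "(x, y) \<in> ?E ^^ (D - dim (x \<inter> y))" by (intro upper[OF assms]) simp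
  then show ?thesis
    unfolding path_dist_def using lower[of y] by (intro Least_equality) (auto simp: le_diff_conv add.commute)
qed

end

section \<open>Matrices\<close>

definition rel_matrix :: "('i::finite \<Rightarrow> 'i \<Rightarrow> bool) \<Rightarrow> complex ^ 'i ^ 'i" where
  "rel_matrix P = (\<chi> y z. if P y z then 1 else 0)"

definition diag_matrix :: "('i::finite \<Rightarrow> complex) \<Rightarrow> complex ^ 'i ^ 'i" where
  "diag_matrix k = (\<chi> y z. if y = z then k y else 0)"

lemma rel_matrix_mult_left: "(rel_matrix P ** M) $ y $ z = (\<Sum>w | P y w. M $ w $ z)"
proof -
  have "(rel_matrix P ** M) $ y $ z = (\<Sum>w\<in>UNIV. if P y w then M $ w $ z else 0)"
    by (simp add: matrix_matrix_mult_def rel_matrix_def) (intro sum.cong; simp)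
  then show ?thesis by (simp add: sum.If_cases)
qed

lemma rel_matrix_mult_right: "(M ** rel_matrix P) $ y $ z = (\<Sum>w | P w z. M $ y $ w)"
proof -
  have "(M ** rel_matrix P) $ y $ z = (\<Sum>w\<in>UNIV. if P w z then M $ y $ w else 0)"
    by (simp add: matrix_matrix_mult_def rel_matrix_def) (intro sum.cong; simp)
  then show ?thesis by (simp add: sum.If_cases)
qed

lemma rel_matrix_mult: "(rel_matrix P ** rel_matrix Q) $ y $ z = of_nat (card {w. P y w \<and> Q w z})"
  by (simp add: rel_matrix_mult_left) (simp add: rel_matrix_def sum_Collect_if)

lemma transpose_rel_matrix: "transpose (rel_matrix P) = rel_matrix (\<lambda>y z. P z y)"
  by (simp add: transpose_def rel_matrix_def)

lemma diag_matrix_mult_left: "(diag_matrix k ** M) $ y $ z = k y * M $ y $ z"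
proof -
  have "(diag_matrix k ** M) $ y $ z = (\<Sum>w\<in>UNIV. if w = y then k y * M $ y $ z else 0)"
    by (simp only: matrix_matrix_mult_def diag_matrix_def vec_lambda_beta) (intro sum.cong; auto)
  then show ?thesis by simp
qed

lemma diag_matrix_mult_right: "(M ** diag_matrix k) $ y $ z = M $ y $ z * k z"
proof -
  have "(M ** diag_matrix k) $ y $ z = (\<Sum>w\<in>UNIV. if w = z then M $ y $ z * k z else 0)"
    by (simp only: matrix_matrix_mult_def diag_matrix_def vec_lambda_beta) (intro sum.cong; auto)
  then show ?thesis by simp
qed

lemma dual_idempotent_eq_diag:
  "dual_idempotent X E x i = diag_matrix (\<lambda>y. if y \<in> X \<and> path_dist E x y = i then 1 else 0)"
  by (simp add: dual_idempotent_def diag_matrix_def vec_eq_iff)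

lemma dual_idempotent_sandwich:
  "(dual_idempotent X E x i ** A ** dual_idempotent X E x j) $ y $ z
    = (if y \<in> X \<and> path_dist E x y = i \<and> z \<in> X \<and> path_dist E x z = j then A $ y $ z else 0)"
  by (simp add: dual_idempotent_eq_diag diag_matrix_mult_left diag_matrix_mult_right)

lemma transpose_add: "transpose (M + N) = transpose M + transpose N"
  by (simp add: transpose_def vec_eq_iff)

lemma transpose_diff:
  fixes M N :: "complex ^ 'i ^ 'j"
  shows "transpose (M - N) = transpose M - transpose N"
  by (simp add: transpose_def vec_eq_iff)

lemma transpose_scaleR:
  fixes M :: "complex ^ 'i ^ 'j"
  shows "transpose (c *\<^sub>R M) = c *\<^sub>R transpose M"
  by (simp add: transpose_def vec_eq_iff)

section \<open>The matrices of a dual polar space and their relations\<close>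

context dual_polar_space
begin

abbreviation (input) edges :: "('v set \<times> 'v set) set" where
  "edges \<equiv> {(y, z). adj y z}"

lemma dim_base_Int_le_D: "dim (x \<inter> y) \<le> D"
  using dim_subset[of "x \<inter> y" x] dim_maxiso[OF base] by simp

lemma path_dist_low:
  assumes "low y z"
  shows "path_dist edges x z = Suc (path_dist edges x y)" "path_dist edges x z \<le> D"
  using lowD(2-4)[OF assms] path_dist_adj dim_base_Int_le_D[of y] by auto

lemma low_iff_path_dist:
  "low y z \<longleftrightarrow> adj y z \<and> path_dist edges x z = Suc (path_dist edges x y)"
proof
  assume a: "adj y z \<and> path_dist edges x z = Suc (path_dist edges x y)"
  then show "low y z"
    using adjD(1,2)[of y z] path_dist_adj[of y] path_dist_adj[of z] adj_level[of y z]
      dim_base_Int_le_D[of y] by (auto simp: low_def)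
qed (use path_dist_low lowD(1) in auto)

lemma flat_iff_path_dist:
  "flat y z \<longleftrightarrow> adj y z \<and> path_dist edges x z = path_dist edges x y"
proof
  assume a: "adj y z \<and> path_dist edges x z = path_dist edges x y"
  then show "flat y z"
    using adjD(1,2)[of y z] path_dist_adj[of y] path_dist_adj[of z]
      dim_base_Int_le_D[of y] dim_base_Int_le_D[of z] by (auto simp: flat_def)
qed (use adjD path_dist_adj in \<open>auto simp: flat_def\<close>)

text \<open>Only the summand with \<open>i\<close> the distance from \<open>x\<close> to
  \<open>z\<close> can be nonzero, and \<open>low\<close> is adjacency across consecutive
  distances.\<close>

lemma lowering_matrix_eq: "lowering_matrix maxiso edges x D = rel_matrix low"
proof -
  let ?d = "path_dist edges x"
  have "(\<Sum>i=1..D. if y \<in> maxiso \<and> ?d y = i - 1 \<and> z \<in> maxiso \<and> ?d z = i then (if adj y z then 1 else 0) else 0)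
      = (if low y z then 1 else 0 :: complex)" for y z
  proof (cases "low y z")
    case True
    note l = lowD[OF True] and d = path_dist_low[OF True]
    have "(\<Sum>i=1..D. if y \<in> maxiso \<and> ?d y = i - 1 \<and> z \<in> maxiso \<and> ?d z = i then (if adj y z then 1 else 0) else 0)
        = (\<Sum>i=1..D. if i = ?d z then 1 else 0 :: complex)"
      using l d by (intro sum.cong) auto
    then show ?thesis using True d by simp
  next
    case False
    then show ?thesis by (auto simp: low_iff_path_dist intro!: sum.neutral)
  qed
  then show ?thesis
    by (simp add: vec_eq_iff lowering_matrix_def rel_matrix_def dual_idempotent_sandwich adjacency_matrix_def
        cong: if_cong)
qed

lemma raising_matrix_eq: "raising_matrix maxiso edges x D = rel_matrix (\<lambda>y z. low z y)"
proof -
  let ?d = "path_dist edges x"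
  have "(\<Sum>i=0..<D. if y \<in> maxiso \<and> ?d y = i + 1 \<and> z \<in> maxiso \<and> ?d z = i then (if adj y z then 1 else 0) else 0)
      = (if low z y then 1 else 0 :: complex)" for y z
  proof (cases "low z y")
    case True
    note l = lowD[OF True] and d = path_dist_low[OF True]
    have "(\<Sum>i=0..<D. if y \<in> maxiso \<and> ?d y = i + 1 \<and> z \<in> maxiso \<and> ?d z = i then (if adj y z then 1 else 0) else 0)
        = (\<Sum>i=0..<D. if i = ?d z then 1 else 0 :: complex)"
      using l d adj_sym[of y z] by (intro sum.cong) auto
    then show ?thesis using True d by simp
  next
    case False
    then show ?thesis using adj_sym[of y z] by (auto simp: low_iff_path_dist intro!: sum.neutral)
  qed
  then show ?thesis
    by (simp add: vec_eq_iff raising_matrix_def rel_matrix_def dual_idempotent_sandwich adjacency_matrix_def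
        cong: if_cong)
qed

lemma flat_matrix_eq: "flat_matrix maxiso edges x D = rel_matrix flat"
proof -
  let ?d = "path_dist edges x"
  have "(\<Sum>i=0..D. if y \<in> maxiso \<and> ?d y = i \<and> z \<in> maxiso \<and> ?d z = i then (if adj y z then 1 else 0) else 0)
      = (if flat y z then 1 else 0 :: complex)" for y z
  proof (cases "flat y z")
    case True
    then have l: "adj y z" "?d z = ?d y" by (auto simp: flat_iff_path_dist)
    note a = adjD[OF l(1)]
    have "(\<Sum>i=0..D. if y \<in> maxiso \<and> ?d y = i \<and> z \<in> maxiso \<and> ?d z = i then (if adj y z then 1 else 0) else 0)
        = (\<Sum>i=0..D. if i = ?d z then 1 else 0 :: complex)"
      using l a by (intro sum.cong) auto
    moreover have "?d z \<le> D" using path_dist_adj[OF a(2)] by simp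
    ultimately show ?thesis using True by simp
  next
    case False
    then show ?thesis by (auto simp: flat_iff_path_dist intro!: sum.neutral)
  qed
  then show ?thesis
    by (simp add: vec_eq_iff flat_matrix_def rel_matrix_def dual_idempotent_sandwich adjacency_matrix_def
        cong: if_cong)
qed

lemma K_matrix_eq:
  "K_matrix maxiso edges x D q
    = diag_matrix (\<lambda>y. if y \<in> maxiso then of_real (q powi (- 2 * int (path_dist edges x y))) else 0)"
proof -
  let ?d = "path_dist edges x"
  have "(\<Sum>i=0..D. q powi (- 2 * int i) *\<^sub>R dual_idempotent maxiso edges x i $ y $ z)
      = (if y = z then if y \<in> maxiso then of_real (q powi (- 2 * int (?d y))) else 0 else 0)" for y z
  proof (cases "y = z \<and> y \<in> maxiso")
    case True
    then have yz: "y = z" "z \<in> maxiso" by auto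
    have "(\<Sum>i=0..D. q powi (- 2 * int i) *\<^sub>R dual_idempotent maxiso edges x i $ y $ z)
        = (\<Sum>i=0..D. if i = ?d y then of_real (q powi (- 2 * int (?d y))) else 0)"
      using yz by (intro sum.cong) (auto simp: dual_idempotent_def scaleR_conv_of_real)
    moreover have "?d y \<le> D" using path_dist_adj[OF yz(2)] yz(1) by simp
    ultimately show ?thesis using yz by simp
  qed (auto simp: dual_idempotent_def)
  then show ?thesis
    by (simp add: vec_eq_iff K_matrix_def diag_matrix_def)
qed

text \<open>The relation between \<open>L\<close> and \<open>F\<close> and the cubic one for
  \<open>L\<close> are checked entrywise by the path counts; their counterparts for \<open>R\<close>
  follow by transposition, which exchanges \<open>L\<close> with \<open>R\<close> and fixes
  \<open>F\<close>.\<close>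

theorem matrix_relations:
  fixes q e :: real
  assumes q: "q > 0" "q\<^sup>2 = real CARD('a)" and e: "q powr (2 * e) = real s" and D: "D \<ge> 1"
    and L_def: "L = lowering_matrix maxiso edges x D"
    and F_def: "F = flat_matrix maxiso edges x D"
    and R_def: "R = raising_matrix maxiso edges x D"
    and K_def: "K = K_matrix maxiso edges x D q"
  shows "K ** L = q\<^sup>2 *\<^sub>R (L ** K)
    \<and> K ** F = F ** K
    \<and> K ** R = q powi (-2) *\<^sub>R (R ** K)
    \<and> L ** F - q\<^sup>2 *\<^sub>R (F ** L) = (q powr (2 * e) - 1) *\<^sub>R L
    \<and> F ** R - q\<^sup>2 *\<^sub>R (R ** F) = (q powr (2 * e) - 1) *\<^sub>R R
    \<and> (q ^ 4 / (q\<^sup>2 + 1)) *\<^sub>R (R ** L ** L) - L ** R ** L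
        + (q powi (-2) / (q\<^sup>2 + 1)) *\<^sub>R (L ** L ** R)
      = - (q powr (2 * e + 2 * real D - 2)) *\<^sub>R L
    \<and> (q ^ 4 / (q\<^sup>2 + 1)) *\<^sub>R (R ** R ** L) - R ** L ** R
        + (q powi (-2) / (q\<^sup>2 + 1)) *\<^sub>R (L ** R ** R)
      = - (q powr (2 * e + 2 * real D - 2)) *\<^sub>R R"
proof -
  let ?b = "real CARD('a)" and ?d = "path_dist edges x"
  note L = L_def[unfolded lowering_matrix_eq] and F = F_def[unfolded flat_matrix_eq]
    and R = R_def[unfolded raising_matrix_eq] and K = K_def[unfolded K_matrix_eq]
  have tL: "transpose L = R" and tR: "transpose R = L"
    by (simp_all add: L R transpose_rel_matrix)
  have tF: "transpose F = F"
    unfolding F transpose_rel_matrix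
    by (intro arg_cong[where f = rel_matrix] ext) (auto simp: flat_def adj_sym)
  have powi2: "q powi (-2) = inverse ?b" using q by (simp add: power_int_minus)
  \<comment> \<open>Consecutive diagonal entries of \<open>K\<close> differ by the factor
    \<open>b = q\<^sup>2\<close>, which is what its relations with \<open>L\<close> and
    \<open>R\<close> express.\<close>
  have shift: "q powi (- 2 * int n) = ?b * q powi (- 2 * int (Suc n))" for n
  proof -
    have "q powi (- 2 * int n) = q powi (2 + (- 2 * int (Suc n)))" by simp
    also have "\<dots> = q powi 2 * q powi (- 2 * int (Suc n))"
      using q by (intro power_int_add) simp
    finally show ?thesis using q by simp
  qed
  have KL: "K ** L = q\<^sup>2 *\<^sub>R (L ** K)"
  proof -
    have "(K ** L) $ y $ z = (q\<^sup>2 *\<^sub>R (L ** K)) $ y $ z" for y z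
    proof (cases "low y z")
      case True
      note l = lowD[OF True] and d = path_dist_low[OF True]
      show ?thesis
        using True l d(1) q shift[of "?d y"] unfolding vector_scaleR_component
        by (simp add: K L diag_matrix_mult_left diag_matrix_mult_right rel_matrix_def scaleR_conv_of_real)
    qed (simp add: K L diag_matrix_mult_left diag_matrix_mult_right rel_matrix_def)
    then show ?thesis by (simp add: vec_eq_iff)
  qed
  have KR: "K ** R = q powi (-2) *\<^sub>R (R ** K)"
  proof -
    have "(K ** R) $ y $ z = (q powi (-2) *\<^sub>R (R ** K)) $ y $ z" for y z
    proof (cases "low z y")
      case True
      note l = lowD[OF True] and d = path_dist_low[OF True]
      have "q powi (- 2 * int (?d y)) = inverse ?b * q powi (- 2 * int (?d z))"
        using shift[of "?d z"] d(1) by simp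
      then show ?thesis
        using True l unfolding powi2 vector_scaleR_component
        by (simp add: K R diag_matrix_mult_left diag_matrix_mult_right rel_matrix_def scaleR_conv_of_real)
    qed (simp add: K R diag_matrix_mult_left diag_matrix_mult_right rel_matrix_def)
    then show ?thesis by (simp add: vec_eq_iff)
  qed
  have KF: "K ** F = F ** K"
  proof -
    have "(K ** F) $ y $ z = (F ** K) $ y $ z" for y z
      using adjD(1,2)[of y z]
      by (auto simp: K F diag_matrix_mult_left diag_matrix_mult_right rel_matrix_def flat_iff_path_dist)
    then show ?thesis by (simp add: vec_eq_iff)
  qed
  have LF: "L ** F - q\<^sup>2 *\<^sub>R (F ** L) = (q powr (2 * e) - 1) *\<^sub>R L"
  proof -
    have "complex_of_nat (card {w. low y w \<and> flat w z}) - of_real ?b * of_nat (card {w. flat y w \<and> low w z})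
        = of_real (real s - 1) * (if low y z then 1 else 0)" for y z
    proof -
      \<comment> \<open>In the third case the levels do not match and every term is zero.\<close>
      consider "low y z" | "\<not> low y z" "y \<in> maxiso" "z \<in> maxiso" "dim (x \<inter> y) = Suc (dim (x \<inter> z))"
        | "\<not> (y \<in> maxiso \<and> z \<in> maxiso \<and> dim (x \<inter> y) = Suc (dim (x \<inter> z)))" by blast
      then show ?thesis
      proof cases
        case 1
        have "card {w. flat y w \<and> low w z} = 0" by (rule card_low_flat_adj(2)[OF 1])
        moreover have "real s = real (card {w. low y w \<and> flat w z}) + 1"
          using card_low_flat_adj(1)[OF 1] by linarith
        ultimately show ?thesis using 1 by (simp only:) simp
      next
        case 2
        show ?thesis using card_low_flat_nonadj[OF 2(2-4,1)] 2 by (simp only:) simp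
      next
        case 3
        then have "{w. low y w \<and> flat w z} = {}" "{w. flat y w \<and> low w z} = {}" "\<not> low y z"
          by (auto simp: low_def flat_def adj_def)
        then show ?thesis by (simp only: card.empty) simp
      qed
    qed
    then show ?thesis
      unfolding vec_eq_iff vector_minus_component vector_scaleR_component L F rel_matrix_mult e q(2)
      by (simp add: rel_matrix_def scaleR_conv_of_real)
  qed
  have FR: "F ** R - q\<^sup>2 *\<^sub>R (R ** F) = (q powr (2 * e) - 1) *\<^sub>R R"
    using arg_cong[OF LF, of transpose]
    by (simp only: transpose_diff transpose_scaleR matrix_transpose_mul tL tF)
  have sD: "q powr (2 * e + 2 * real D - 2) = real s * ?b ^ (D - 1)"
  proof -
    have "q powr (2 * e + 2 * real D - 2) = q powr (2 * e) * q powr (real (2 * (D - 1)))"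
      using D by (simp add: powr_add[symmetric] of_nat_diff algebra_simps)
    then show ?thesis using q by (simp only: e powr_realpow power_mult)
  qed
  have RLL: "(q ^ 4 / (q\<^sup>2 + 1)) *\<^sub>R (R ** L ** L) - L ** R ** L
        + (q powi (-2) / (q\<^sup>2 + 1)) *\<^sub>R (L ** L ** R)
      = - (q powr (2 * e + 2 * real D - 2)) *\<^sub>R L"
  proof -
    define rll where "rll y z = (\<Sum>u | low u y. card {w. low u w \<and> low w z})" for y z
    define lrl where "lrl y z = (\<Sum>w | low w z. card {t. low y t \<and> low w t})" for y z
    define llr where "llr y z = (\<Sum>t | low z t. card {w. low y w \<and> low w t})" for y z
    have e1: "(R ** L ** L) $ y $ z = of_nat (rll y z)" for y z
      unfolding R L matrix_mul_assoc[symmetric] rel_matrix_mult_left[of "\<lambda>y z. low z y"] rel_matrix_mult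
      by (simp add: rll_def)
    have e2: "(L ** R ** L) $ y $ z = of_nat (lrl y z)" for y z
      unfolding R L rel_matrix_mult_right[of _ low] rel_matrix_mult by (simp add: lrl_def)
    have e3: "(L ** L ** R) $ y $ z = of_nat (llr y z)" for y z
      unfolding R L rel_matrix_mult_right[of _ "\<lambda>y z. low z y"] rel_matrix_mult by (simp add: llr_def)
    have "?b\<^sup>2 / (?b + 1) * real (rll y z) - real (lrl y z) + inverse ?b / (?b + 1) * real (llr y z)
        = - (if low y z then real s * ?b ^ (D - 1) else 0)" for y z
    proof (cases "y \<in> maxiso \<and> z \<in> maxiso \<and> dim (x \<inter> y) = Suc (dim (x \<inter> z))")
      case True
      then show ?thesis unfolding rll_def lrl_def llr_def by (intro cubic_count) auto
    next
      \<comment> \<open>Each kind of path forces its ends to be vertices on consecutive levels, so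
        all counts vanish.\<close>
      case False
      have n: "{w. low u w \<and> low w z} = {}" if "low u y" for u
        using False that by (auto simp: low_def adj_def)
      have n': "{t. low y t \<and> low w t} = {}" if "low w z" for w
        using False that by (auto simp: low_def adj_def)
      have n'': "{w. low y w \<and> low w t} = {}" if "low z t" for t
        using False that by (auto simp: low_def adj_def)
      have "rll y z = 0" "lrl y z = 0" "llr y z = 0" "\<not> low y z"
        using n n' n'' False by (auto simp: rll_def lrl_def llr_def low_def adj_def simp del: Collect_empty_eq)
      then show ?thesis by simp
    qed
    note count = this
    have main: "of_real (?b\<^sup>2 / (?b + 1)) * of_nat (rll y z) - of_nat (lrl y z)
          + of_real (inverse ?b / (?b + 1)) * of_nat (llr y z)
        = - of_real (real s * ?b ^ (D - 1)) * (if low y z then 1 else 0 :: complex)" for y z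
    proof -
      have "complex_of_real (?b\<^sup>2 / (?b + 1) * real (rll y z) - real (lrl y z)
            + inverse ?b / (?b + 1) * real (llr y z))
          = complex_of_real (- (if low y z then real s * ?b ^ (D - 1) else 0))"
        by (simp only: count)
      then show ?thesis
        unfolding of_real_add of_real_diff of_real_mult[of _ "real (rll y z)"]
          of_real_mult[of _ "real (llr y z)"] of_real_of_nat_eq
        by (cases "low y z") simp_all
    qed
    have q4: "q ^ 4 = ?b\<^sup>2" unfolding q(2)[symmetric] by (simp flip: power_mult)
    show ?thesis
      unfolding vec_eq_iff vector_minus_component vector_add_component vector_scaleR_component
        e1 e2 e3 sD q(2) q4 powi2
      using main by (simp add: L rel_matrix_def scaleR_conv_of_real)
  qed
  have RRL: "(q ^ 4 / (q\<^sup>2 + 1)) *\<^sub>R (R ** R ** L) - R ** L ** R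
        + (q powi (-2) / (q\<^sup>2 + 1)) *\<^sub>R (L ** R ** R)
      = - (q powr (2 * e + 2 * real D - 2)) *\<^sub>R R"
    using arg_cong[OF RLL, of transpose]
    by (simp only: transpose_add transpose_diff transpose_scaleR matrix_transpose_mul tL tR matrix_mul_assoc)
  show ?thesis using KL KF KR LF FR RLL RRL by blast
qed

end

section \<open>Finite fields\<close>

lemma card_le_fibres:
  assumes "finite A" "\<And>c. c \<in> f ` A \<Longrightarrow> card {x \<in> A. f x = c} \<le> m"
  shows "card A \<le> m * card (f ` A)"
proof -
  have "card A = card (\<Union>c\<in>f ` A. {x \<in> A. f x = c})"
    by (intro arg_cong[where f = card]) auto
  also have "\<dots> \<le> (\<Sum>c\<in>f ` A. card {x \<in> A. f x = c})"
    using assms(1) by (intro card_UN_le) auto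
  also have "\<dots> \<le> of_nat (card (f ` A)) * m"
    using assms(2) by (intro sum_bounded_above)
  finally show ?thesis by (simp add: mult.commute)
qed

text \<open>More than half of the field elements are squares, so the values
  \<open>a x\<^sup>2\<close> and the values \<open>d - c y\<^sup>2\<close> must overlap.\<close>

lemma sum_two_squares_exists:
  fixes a c d :: "'a::{field,finite}"
  assumes "a \<noteq> 0" "c \<noteq> 0"
  shows "\<exists>x y. a * x\<^sup>2 + c * y\<^sup>2 = d"
proof (rule ccontr)
  assume none: "\<nexists>x y. a * x\<^sup>2 + c * y\<^sup>2 = d"
  define S where "S = range (\<lambda>x::'a. x\<^sup>2)"
  have "card {x \<in> UNIV - {0}. x\<^sup>2 = t} \<le> 2" if t: "t \<in> (\<lambda>x. x\<^sup>2) ` (UNIV - {0})" for t :: 'a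
  proof -
    obtain r where "t = r\<^sup>2" using t by blast
    then have "{x \<in> UNIV - {0}. x\<^sup>2 = t} \<subseteq> {r, - r}" by (auto simp: power2_eq_iff)
    then have "card {x \<in> UNIV - {0}. x\<^sup>2 = t} \<le> card {r, - r}" by (intro card_mono) auto
    also have "\<dots> \<le> 2" by (simp add: card_insert_if)
    finally show ?thesis .
  qed
  then have "card (UNIV - {0::'a}) \<le> 2 * card ((\<lambda>x::'a. x\<^sup>2) ` (UNIV - {0}))"
    by (intro card_le_fibres) auto
  moreover have "(\<lambda>x::'a. x\<^sup>2) ` (UNIV - {0}) = S - {0}" by (auto simp: S_def)
  ultimately have "card (UNIV - {0::'a}) \<le> 2 * card (S - {0})" by (simp only:)
  moreover have "0 \<in> S" by (auto simp: S_def intro: image_eqI[of _ _ 0])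
  then have "Suc (card (S - {0})) = card S" by (intro card_Suc_Diff1) simp_all
  moreover have "Suc (card (UNIV - {0::'a})) = CARD('a)" by (intro card_Suc_Diff1) simp_all
  ultimately have S: "CARD('a) < 2 * card S" by linarith
  let ?A = "(\<lambda>t. a * t) ` S" and ?B = "(\<lambda>t. d - c * t) ` S"
  have "card ?A = card S" "card ?B = card S"
    using assms by (auto intro!: card_image inj_onI)
  moreover have "?A \<inter> ?B = {}"
  proof (rule ccontr)
    assume "?A \<inter> ?B \<noteq> {}"
    then obtain x y where "a * x\<^sup>2 = d - c * y\<^sup>2" unfolding S_def by blast
    then have "a * x\<^sup>2 + c * y\<^sup>2 = d" by simp
    then show False using none by blast
  qed
  then have "card ?A + card ?B = card (?A \<union> ?B)" by (simp add: card_Un_disjoint)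
  moreover have "card (?A \<union> ?B) \<le> CARD('a)" by (intro card_mono) auto
  ultimately show False using S by linarith
qed

lemma square_root_exists_char_two:
  fixes c :: "'a::{field,finite}"
  assumes "(1 + 1 :: 'a) = 0"
  shows "\<exists>x. x\<^sup>2 = c"
proof -
  have neg: "- x = x" for x :: 'a
  proof -
    have "x + x = (1 + 1) * x" by (simp only: distrib_right mult_1_left)
    then show ?thesis using assms by (simp add: eq_neg_iff_add_eq_0)
  qed
  have "inj (\<lambda>x::'a. x\<^sup>2)" by (auto intro!: injI simp: power2_eq_iff neg)
  then have "surj (\<lambda>x::'a. x\<^sup>2)" by (simp add: finite_UNIV_inj_surj)
  then show ?thesis unfolding surj_def by metis
qed

text \<open>The Sylow theorem gives an additive subgroup \<open>H\<close> of order \<open>l\<close>.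
  Translation by a nonzero \<open>x\<close> of \<open>H\<close> permutes it, and comparing sums over
  \<open>H\<close> gives \<open>l x = 0\<close>.\<close>

lemma prime_dvd_card_field:
  fixes l :: nat
  assumes "prime l" "l dvd CARD('a::{field,finite})"
  shows "l = CHAR('a)"
proof -
  let ?G = "\<lparr>carrier = UNIV, monoid.mult = (+), one = 0\<rparr> :: 'a monoid"
  have G: "group ?G"
  proof (rule groupI)
    show "\<exists>y\<in>carrier ?G. y \<otimes>\<^bsub>?G\<^esub> x = \<one>\<^bsub>?G\<^esub>" for x
      by (intro bexI[of _ "- x"]) simp_all
  qed (simp_all add: add.assoc)
  obtain m where "order ?G = l ^ 1 * m" using assms(2) by (auto simp: order_def)
  then obtain H where H: "subgroup H ?G" "card H = l"
    using sylow_thm[OF assms(1) G, of 1 m] by auto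
  have "H \<noteq> {0}" using H(2) assms(1) by auto
  then obtain x where x: "x \<in> H" "x \<noteq> 0" using subgroup.one_closed[OF H(1)] by auto
  have "bij_betw (\<lambda>h. h + x) H H"
  proof (rule bij_betwI')
    show "\<exists>h'\<in>H. h = h' + x" if "h \<in> H" for h
    proof
      have "inv\<^bsub>?G\<^esub> x = - x"
        by (rule group.inv_equality[OF G]) simp_all
      then show "h - x \<in> H"
        using subgroup.m_closed[OF H(1) that subgroup.m_inv_closed[OF H(1) x(1)]] by simp
    qed simp
  qed (use subgroup.m_closed[OF H(1)] x in auto)
  then have "(\<Sum>h\<in>H. h + x) = (\<Sum>h\<in>H. h)" by (rule sum.reindex_bij_betw)
  then have "of_nat l * x = 0" by (simp add: sum.distrib H(2))
  then have "CHAR('a) dvd l" using x(2) by (simp flip: of_nat_eq_0_iff_char_dvd)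
  moreover have "CHAR('a) \<noteq> 1" using CHAR_eqI by auto
  ultimately show ?thesis using assms(1) by (metis prime_nat_iff)
qed

text \<open>Every prime factor of \<open>r\<close> divides the size of the field, hence is its
  characteristic; so \<open>r\<close> is a power of the characteristic and Frobenius
  applies.\<close>

lemma power_card_sqrt_add:
  fixes a c :: "'a::{field,finite}"
  assumes "CARD('a) = r\<^sup>2"
  shows "(a + c) ^ r = a ^ r + c ^ r"
proof (rule freshmans_dream')
  have r: "r \<noteq> 0" using assms by (auto intro: ccontr)
  show p: "prime CHAR('a)" by (intro prime_CHAR_semidom finite_imp_CHAR_pos finite)
  have "prime_factors r \<subseteq> {CHAR('a)}"
    using prime_dvd_card_field[where 'a = 'a] assms by (auto simp: in_prime_factors_iff power2_eq_square)
  then have "(\<Prod>l\<in>prime_factors r. l ^ multiplicity l r) = (\<Prod>l\<in>{CHAR('a)}. l ^ multiplicity l r)"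
    using p by (intro prod.mono_neutral_left) (auto simp: prime_factors_multiplicity)
  then show "r = CHAR('a) ^ multiplicity CHAR('a) r" using prod_prime_factors[OF r] by simp
qed

lemma card_trinomial_roots:
  fixes a c :: "'a::{field,finite}"
  assumes "n \<ge> 2"
  shows "card {x. x ^ n + a * x = c} \<le> n"
proof -
  let ?p = "monom 1 n + [:- c, a:]"
  have "degree [:- c, a:] < degree (monom (1::'a) n)"
    using assms by (simp add: degree_monom_eq)
  then have d: "degree ?p = n" by (subst degree_add_eq_left) (simp_all add: degree_monom_eq)
  then have "?p \<noteq> 0" using assms by auto
  then have "card {x. poly ?p x = 0} \<le> n" using card_poly_roots_bound[of ?p] d by simp
  moreover have "{x. poly ?p x = 0} = {x. x ^ n + a * x = c}"
    by (auto simp: poly_monom algebra_simps eq_neg_iff_add_eq_0)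
  ultimately show ?thesis by simp
qed

section \<open>Trace and norm for the \<open>r\<close>-th power map\<close>

context
  fixes r :: nat
  assumes card_field: "CARD('a::{field,finite}) = r\<^sup>2"
    and power_card: "\<And>a :: 'a. (a ^ r) ^ r = a"
begin

lemma r_ge_2: "2 \<le> r"
proof (rule ccontr)
  assume "\<not> 2 \<le> r"
  then have "r = 0 \<or> r = 1" by auto
  then have "r\<^sup>2 \<le> 1" by auto
  then show False using card_finite_field_ge_2[where 'a = 'a] card_field by simp
qed

lemma card_fixed_le: "card {c :: 'a. c ^ r = c} \<le> r"
  using card_trinomial_roots[OF r_ge_2, of "-1" "0 :: 'a"] by simp

text \<open>The kernel of \<open>m ^ r + m\<close> has at most \<open>r\<close> elements by degree,
  and so has its image, which consists of fixed points of the \<open>r\<close>-th power. The product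
  of the two sizes is at least \<open>r\<^sup>2\<close>, so both bounds are attained.\<close>

lemma card_trace_fibre:
  fixes c :: 'a
  assumes "c ^ r = c"
  shows "card {m. m ^ r + m = c} = r"
proof -
  let ?T = "\<lambda>m :: 'a. m ^ r + m"
  note add = power_card_sqrt_add[OF card_field]
  have fib: "card {m. ?T m = ?T a} = card {m. ?T m = 0}" for a
  proof -
    have "bij_betw (\<lambda>m. m + a) {m. ?T m = 0} {m. ?T m = ?T a}"
    proof (rule bij_betw_byWitness[of _ "\<lambda>m. m - a"])
      show "(\<lambda>m. m - a) ` {m. ?T m = ?T a} \<subseteq> {m. ?T m = 0}"
      proof (intro image_subsetI CollectI)
        fix m assume "m \<in> {m. ?T m = ?T a}"
        then show "?T (m - a) = 0" using add[of "m - a" a] by (simp add: algebra_simps)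
      qed
    qed (auto simp: add algebra_simps)
    then show ?thesis by (simp add: bij_betw_same_card)
  qed
  have ker: "card {m. ?T m = 0} \<le> r" using card_trinomial_roots[OF r_ge_2, of 1 "0::'a"] by simp
  have img: "range ?T \<subseteq> {c. c ^ r = c}" by (auto simp: add power_card add.commute)
  have cimg: "card (range ?T) \<le> r" using card_mono[OF finite img] card_fixed_le by linarith
  have "CARD('a) \<le> card {m. ?T m = 0} * card (range ?T)"
    by (rule card_le_fibres) (use fib in auto)
  then have le: "r * r \<le> card {m. ?T m = 0} * card (range ?T)" using card_field by (simp add: power2_eq_square)
  have k: "card {m. ?T m = 0} = r"
  proof (rule ccontr)
    assume "card {m. ?T m = 0} \<noteq> r"
    then have "card {m. ?T m = 0} < r" using ker by simp
    then have "card {m. ?T m = 0} * r < r * r" using r_ge_2 by (intro mult_less_mono1) auto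
    moreover have "card {m. ?T m = 0} * card (range ?T) \<le> card {m. ?T m = 0} * r"
      using cimg by (rule mult_le_mono2)
    ultimately have "card {m. ?T m = 0} * card (range ?T) < r * r" by linarith
    then show False using le by simp
  qed
  then have "r \<le> card (range ?T)" using le r_ge_2 by simp
  then have "card {c :: 'a. c ^ r = c} \<le> card (range ?T)" using card_fixed_le by linarith
  then have "range ?T = {c. c ^ r = c}" by (intro card_seteq img) auto
  then obtain a where "c = ?T a" using assms by blast
  then show ?thesis using fib[of a] k by simp
qed

text \<open>On the \<open>r\<^sup>2 - 1\<close> nonzero elements the norm has fibres of size at most
  \<open>r + 1\<close>, so it takes at least \<open>r - 1\<close> values; these exhaust the nonzero
  fixed points.\<close>

lemma norm_exists:
  fixes c :: 'a
  assumes "c ^ r = c" "c \<noteq> 0"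
  shows "\<exists>x. x ^ r * x = c"
proof -
  let ?N = "\<lambda>x :: 'a. x ^ r * x"
  have "card {x \<in> UNIV - {0}. ?N x = t} \<le> r + 1" for t
  proof -
    have "card {x \<in> UNIV - {0}. ?N x = t} \<le> card {x. x ^ (r + 1) + 0 * x = t}"
      by (intro card_mono) (auto simp: mult.commute)
    also have "\<dots> \<le> r + 1" using r_ge_2 by (intro card_trinomial_roots) simp
    finally show ?thesis .
  qed
  then have "card (UNIV - {0::'a}) \<le> (r + 1) * card (?N ` (UNIV - {0}))"
    by (intro card_le_fibres) auto
  moreover have "Suc (card (UNIV - {0::'a})) = r * r"
    using card_field card_Suc_Diff1[of UNIV "0::'a"] by (simp add: power2_eq_square)
  moreover have "r * r = Suc ((r + 1) * (r - 1))" using r_ge_2 by (cases r) (simp_all add: algebra_simps)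
  ultimately have "(r + 1) * (r - 1) \<le> (r + 1) * card (?N ` (UNIV - {0}))" by linarith
  then have le: "r - 1 \<le> card (?N ` (UNIV - {0}))" by (subst (asm) mult_le_cancel1) simp
  have img: "?N ` (UNIV - {0}) \<subseteq> {c. c ^ r = c} - {0}"
    by (auto simp: power_mult_distrib power_card mult.commute)
  have "card ({c :: 'a. c ^ r = c} - {0}) = card {c :: 'a. c ^ r = c} - 1"
    using r_ge_2 by (simp add: card_Diff_singleton)
  then have "card ({c :: 'a. c ^ r = c} - {0}) \<le> card (?N ` (UNIV - {0}))" using le card_fixed_le by linarith
  then have "?N ` (UNIV - {0}) = {c. c ^ r = c} - {0}" by (intro card_seteq img) auto
  then have "c \<in> ?N ` (UNIV - {0})" using assms by simp
  then show ?thesis by auto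
qed

end

section \<open>The classical forms\<close>

context polar_space
begin

lemma maxiso_subset_perp: "W \<in> maxiso \<Longrightarrow> W \<subseteq> perp W"
  using maxiso_iso by (simp add: iso_def)

lemma dim_maxiso_bound:
  assumes "W \<in> maxiso"
  shows "2 * dim W \<le> dim (UNIV :: 'v set)"
  using dim_perp_iso[OF maxiso_iso[OF assms]] dim_subset[OF maxiso_subset_perp[OF assms]] by linarith

text \<open>Interface for the kinds of forms: each has to supply the translation of isotropy, the
  dimension of the maximal isotropic subspaces, and the numbers \<open>\<tau>\<close> and
  \<open>s\<close>.\<close>

lemma relations_if_isotropic_iff:
  fixes f :: "('a, 'v) form" and q e :: real
  assumes iso: "\<And>W. isotropic scale f W \<longleftrightarrow> iso W"
    and D: "\<And>W. W \<in> maxiso \<Longrightarrow> dim W = D"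
    and \<tau>: "\<And>p v. \<lbrakk>sing p; \<beta> v p = 1\<rbrakk> \<Longrightarrow> card {k. sing (v + k *s p)} = \<tau>"
    and s: "s * CARD('a) ^ (2 * D) = CARD('a) ^ dim (UNIV :: 'v set) * \<tau>"
    and q: "q = sqrt (real CARD('a))" and e: "q powr (2 * e) = real s" and "D \<ge> 1"
    and "X = maximal_isotropic scale f"
    and "E = dual_polar_edges scale f D"
    and "x \<in> X"
    and "L = lowering_matrix X E x D"
    and "F = flat_matrix X E x D"
    and "R = raising_matrix X E x D"
    and "K = K_matrix X E x D q"
  shows "K ** L = q\<^sup>2 *\<^sub>R (L ** K)
    \<and> K ** F = F ** K
    \<and> K ** R = q powi (-2) *\<^sub>R (R ** K)
    \<and> L ** F - q\<^sup>2 *\<^sub>R (F ** L) = (q powr (2 * e) - 1) *\<^sub>R L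
    \<and> F ** R - q\<^sup>2 *\<^sub>R (R ** F) = (q powr (2 * e) - 1) *\<^sub>R R
    \<and> (q ^ 4 / (q\<^sup>2 + 1)) *\<^sub>R (R ** L ** L) - L ** R ** L
        + (q powi (-2) / (q\<^sup>2 + 1)) *\<^sub>R (L ** L ** R)
      = - (q powr (2 * e + 2 * real D - 2)) *\<^sub>R L
    \<and> (q ^ 4 / (q\<^sup>2 + 1)) *\<^sub>R (R ** R ** L) - R ** L ** R
        + (q powi (-2) / (q\<^sup>2 + 1)) *\<^sub>R (L ** R ** R)
      = - (q powr (2 * e + 2 * real D - 2)) *\<^sub>R R"
proof -
  have X: "X = maxiso" using assms(8) by (simp add: maximal_isotropic_def maxiso_def iso)
  interpret dual_polar_space scale \<beta> sing D s x
  proof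
    show "card {t \<in> maxiso. G \<subseteq> t} = Suc s" if "iso G" "Suc (dim G) = D" for G
      using D \<tau> s that by (rule card_maxiso_over_codim_one)
  qed (use D X assms(10) in auto)
  \<comment> \<open>\<open>D \<ge> 1\<close> reconciles the truncated \<open>D - 1\<close> in the
    edges with \<open>Suc (dim (y \<inter> z)) = D\<close>.\<close>
  have E: "E = edges"
    using assms(7) unfolding assms(9) dual_polar_edges_def adj_def X[symmetric] assms(8)[symmetric] by auto
  have "q > 0" "q\<^sup>2 = real CARD('a)" using card_finite_field_ge_2[where 'a = 'a] by (auto simp: q)
  then show ?thesis
    using e assms(7) by (rule matrix_relations) (use assms X E in simp_all)
qed

end

section \<open>Symplectic, quadratic and Hermitean forms as polar spaces\<close>

lemma linear_functionalD:
  assumes "Vector_Spaces.linear smul (*) g"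
  shows "g (u + v) = g u + g v" "g (smul k u) = k * g u"
  using assms by (simp_all add: Vector_Spaces.linear_iff)

lemma symplectic_polar_space:
  fixes smul :: "'a::{field,finite} \<Rightarrow> 'v::{ab_group_add,finite} \<Rightarrow> 'v"
  assumes "vector_space smul" "symplectic_form smul B" "nondegenerate B"
  shows "polar_space smul B (\<lambda>_. True)"
proof -
  interpret vector_space smul by fact
  have lin: "Vector_Spaces.linear smul (*) (\<lambda>u. B u v)" "Vector_Spaces.linear smul (*) (\<lambda>v. B u v)" for u v
    using assms(2) by (auto simp: symplectic_form_def bilinear_form_def)
  note left = linear_functionalD[OF lin(1)] and right = linear_functionalD[OF lin(2)]
  have alt: "B u u = 0" for u using assms(2) by (simp add: symplectic_form_def)
  have "B u v + B v u = 0" for u v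
  proof -
    have "B (u + v) (u + v) = B u u + B v u + (B u v + B v v)" by (simp only: left(1) right(1))
    then show ?thesis by (simp add: alt add.commute)
  qed
  then have sym: "B v u = 0" if "B u v = 0" for u v using that by (metis add_0)
  show ?thesis
  proof unfold_locales
    show "u = 0" if "\<And>v. B u v = 0" for u using assms(3) that by (simp add: nondegenerate_def)
  qed (simp_all add: alt left sym)
qed

lemma polarization_commute: "polarization Q u v = polarization Q v u"
  by (simp add: polarization_def add.commute)

lemma quadratic_polar_space:
  fixes smul :: "'a::{field,finite} \<Rightarrow> 'v::{ab_group_add,finite} \<Rightarrow> 'v"
  assumes "vector_space smul" "quadratic_form smul Q" "nondegenerate_quadratic Q"
  shows "polar_space smul (polarization Q) (\<lambda>v. Q v = 0)"
proof -
  interpret vector_space smul by fact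
  have lin: "Vector_Spaces.linear smul (*) (\<lambda>u. polarization Q u v)" for v
    using assms(2) by (auto simp: quadratic_form_def bilinear_form_def)
  note left = linear_functionalD[OF lin]
  have Q: "Q (smul a u) = a\<^sup>2 * Q u" for a u using assms(2) by (simp add: quadratic_form_def)
  have Q0: "Q 0 = 0" using Q[of 0 0] by simp
  have self: "polarization Q u u = 0" if "Q u = 0" for u
  proof -
    \<comment> \<open>\<open>Q (u + u)\<close> is four times \<open>Q u\<close>, so a singular
      \<open>u\<close> is orthogonal to itself in every characteristic.\<close>
    have "u + u = smul (1 + 1) u" by (simp only: scale_left_distrib scale_one)
    then have "Q (u + u) = (1 + 1)\<^sup>2 * Q u" by (simp only: Q)
    then show ?thesis using that by (simp add: polarization_def)
  qed
  have "Q (u + v) = Q u + Q v + polarization Q u v" for u v by (simp add: polarization_def)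
  note add = this
  show ?thesis
  proof unfold_locales
    show "polarization Q v u = 0" if "polarization Q u v = 0" for u v
      using that by (simp only: polarization_commute)
    show "u = 0" if "Q u = 0" "\<And>v. polarization Q u v = 0" for u
      using assms(3) that by (simp add: nondegenerate_quadratic_def)
  qed (simp_all add: left Q Q0 self add)
qed

lemma hermitean_polar_space:
  fixes smul :: "'a::{field,finite} \<Rightarrow> 'v::{ab_group_add,finite} \<Rightarrow> 'v"
  assumes "vector_space smul" "hermitean_form smul r H" "nondegenerate H" "r \<noteq> 0"
  shows "polar_space smul H (\<lambda>v. H v v = 0)"
proof -
  interpret vector_space smul by fact
  have lin: "Vector_Spaces.linear smul (*) (\<lambda>u. H u v)" for v
    using assms(2) unfolding hermitean_form_def by blast
  note left = linear_functionalD[OF lin]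
  have conj: "H v u = H u v ^ r" for u v using assms(2) unfolding hermitean_form_def by blast
  have sym: "H u v = 0 \<Longrightarrow> H v u = 0" for u v using conj[of v u] assms(4) by simp
  have scale: "H (smul k u) (smul k u) = 0" if "H u u = 0" for k u
    using sym[of "smul k u" u] that left(2)[of k u] by simp
  have add: "H (u + v) (u + v) = 0" if "H u u = 0" "H v v = 0" "H u v = 0" for u v
  proof -
    have "H (u + v) u = 0" "H (u + v) v = 0" using that sym[of u v] by (simp_all add: left(1))
    then show ?thesis using sym[of "u + v" u] sym[of "u + v" v] by (simp add: left(1)[of u v "u + v"])
  qed
  show ?thesis
  proof unfold_locales
    show "H 0 0 = 0" using left(2)[of 0 0 0] by simp
    show "u = 0" if "\<And>v. H u v = 0" for u
      using assms(3) that by (simp add: nondegenerate_def)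
  qed (auto intro: left sym scale add)
qed

section \<open>Dimension of the maximal isotropic subspaces\<close>

text \<open>If \<open>dim W < D\<close>, then \<open>perp W\<close> modulo \<open>W\<close> has
  dimension at least three, while all singular vectors of \<open>perp W\<close> lie in
  \<open>W\<close>. But two orthogonal vectors in characteristic two, or three in odd
  characteristic, combine to a singular one outside \<open>W\<close>.\<close>

lemma quadratic_odd_maxiso_dim:
  fixes smul :: "'a::{field,finite} \<Rightarrow> 'v::{ab_group_add,finite} \<Rightarrow> 'v"
  assumes "polar_space smul (polarization Q) (\<lambda>v. Q v = 0)" "quadratic_form smul Q"
    and dim: "vector_space.dim smul (UNIV :: 'v set) = 2 * D + 1"
    and W: "W \<in> polar_space.maxiso smul (polarization Q) (\<lambda>v. Q v = 0)"
  shows "vector_space.dim smul W = D"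
proof (rule ccontr)
  interpret polar_space smul "polarization Q" "\<lambda>v. Q v = 0" by fact
  let ?P = "perp W"
  note subW = maxiso_subspace[OF W]
  assume "dim W \<noteq> D"
  then have dP: "dim W + 3 \<le> dim ?P"
    using dim_maxiso_bound[OF W] dim_perp_iso[OF maxiso_iso[OF W]] dim by linarith
  have Q: "Q (smul a u) = a\<^sup>2 * Q u" for a u using assms(2) by (simp add: quadratic_form_def)
  have Qadd: "Q (u + v) = Q u + Q v + polarization Q u v" for u v by (simp add: polarization_def)
  have mem: "u \<in> W" if "u \<in> ?P" "Q u = 0" for u using maxiso_memI[OF W] that by blast
  have avoid: "\<exists>v. v \<in> A \<and> v \<notin> C" if "dim C < dim A" for A C
    using dim_subset[of A C] that by (meson not_le subsetI)
  obtain v1 where v1: "v1 \<in> ?P" "v1 \<notin> W" using avoid[of W ?P] dP by auto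
  have a: "Q v1 \<noteq> 0" using mem v1 by blast
  let ?P1 = "?P \<inter> perp {v1}"
  have subP1: "subspace ?P1" using subspace_perp subspace_perp by (rule subspace_inter)
  have dP1: "dim W + 2 \<le> dim ?P1" using dim_perp_singleton[OF subspace_perp, of W v1] dP by simp
  show False
  proof (cases "(1 + 1 :: 'a) = 0")
    case True
    \<comment> \<open>In characteristic two \<open>v1\<close> is orthogonal to itself, so
      \<open>v2\<close> is chosen outside the span of \<open>v1\<close> and \<open>W\<close>, not
      just outside \<open>W\<close>.\<close>
    have "dim (span (insert v1 W)) < dim ?P1" using dP1 subW v1 by (simp add: dim_insert_subspace)
    then obtain v2 where v2: "v2 \<in> ?P1" "v2 \<notin> span (insert v1 W)" using avoid by blast
    obtain k where k: "k\<^sup>2 = Q v2 / Q v1" using square_root_exists_char_two[OF True] by blast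
    let ?u = "smul k v1 + v2"
    have "polarization Q v1 v2 = 0"
      using v2 by (simp add: perp_def polarization_commute[of Q v1])
    then have "Q ?u = k\<^sup>2 * Q v1 + Q v2" by (simp add: Qadd Q form_scale)
    also have "\<dots> = (1 + 1) * Q v2" using a by (simp add: k distrib_right)
    finally have "Q ?u = 0" using True by simp
    moreover have "?u \<in> ?P" using v1 v2 subspace_perp[of W] by (simp add: subspace_add subspace_scale)
    ultimately have "?u \<in> W" using mem by blast
    then have "?u - smul k v1 \<in> span (insert v1 W)"
      by (intro span_diff span_scale) (auto intro: span_base)
    then show False using v2 by simp
  next
    case False
    have self: "polarization Q v v = (1 + 1) * Q v" for v
    proof -
      have "v + v = smul (1 + 1) v" by (simp only: scale_left_distrib scale_one)
      then have "Q (v + v) = (1 + 1)\<^sup>2 * Q v" by (simp only: Q)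
      then show ?thesis by (simp add: polarization_def power2_eq_square algebra_simps)
    qed
    obtain v2 where v2: "v2 \<in> ?P1" "v2 \<notin> W" using avoid[of W ?P1] dP1 by auto
    have c: "Q v2 \<noteq> 0" using mem v2 by blast
    have "dim W + 1 \<le> dim (?P1 \<inter> perp {v2})" using dim_perp_singleton[OF subP1, of v2] dP1 by simp
    then obtain v3 where v3: "v3 \<in> ?P1 \<inter> perp {v2}" "v3 \<notin> W" using avoid[of W "?P1 \<inter> perp {v2}"] by auto
    have d: "Q v3 \<noteq> 0" using mem v3 by blast
    obtain k l where kl: "Q v1 * k\<^sup>2 + Q v2 * l\<^sup>2 = - Q v3" using sum_two_squares_exists[OF a c] by blast
    let ?u = "smul k v1 + smul l v2 + v3"
    have orth: "polarization Q v1 v2 = 0" "polarization Q v1 v3 = 0" "polarization Q v2 v3 = 0"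
      using v2 v3 by (auto simp: perp_def intro: form_zero_sym)
    have orth': "polarization Q v1 (smul l v2) = 0"
      using v2 by (intro form_zero_sym[of "smul l v2"]) (simp add: form_scale perp_def)
    have "Q ?u = Q v1 * k\<^sup>2 + Q v2 * l\<^sup>2 + Q v3"
      by (simp add: Qadd Q form_scale form_add orth orth' mult.commute)
    then have "Q ?u = 0" by (simp add: kl)
    moreover have "?u \<in> ?P" using v1 v2 v3 subspace_perp[of W] by (simp add: subspace_add subspace_scale)
    ultimately have "?u \<in> W" using mem by blast
    \<comment> \<open>A vector of \<open>W\<close> is orthogonal to \<open>v3\<close>, but the
      product of \<open>?u\<close> with \<open>v3\<close> is twice \<open>Q v3\<close>.\<close>
    then have "polarization Q v3 ?u = 0" using v3(1) by (simp add: perp_def)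
    then have "polarization Q ?u v3 = 0" by (rule form_zero_sym)
    then have "(1 + 1) * Q v3 = 0" by (simp add: form_add form_scale orth self)
    then show False using False d by simp
  qed
qed

text \<open>If \<open>dim W < D\<close>, then \<open>perp W\<close> modulo \<open>W\<close> has
  dimension at least two, and orthogonal \<open>v1\<close>, \<open>v2\<close> with nonzero values
  combine to a singular vector by solving a norm equation.\<close>

lemma hermitean_maxiso_dim:
  fixes smul :: "'a::{field,finite} \<Rightarrow> 'v::{ab_group_add,finite} \<Rightarrow> 'v"
  assumes "polar_space smul H (\<lambda>v. H v v = 0)" "CARD('a) = r\<^sup>2" "\<And>u v. H v u = H u v ^ r"
    and dim: "2 * D \<le> vector_space.dim smul (UNIV :: 'v set)" "vector_space.dim smul (UNIV :: 'v set) \<le> 2 * D + 1"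
    and W: "W \<in> polar_space.maxiso smul H (\<lambda>v. H v v = 0)"
  shows "vector_space.dim smul W = D"
proof (rule ccontr)
  interpret polar_space smul H "\<lambda>v. H v v = 0" by fact
  let ?P = "perp W"
  assume "dim W \<noteq> D"
  then have dP: "dim W + 2 \<le> dim ?P"
    using dim_maxiso_bound[OF W] dim_perp_iso[OF maxiso_iso[OF W]] dim by linarith
  have conj: "H v u = H u v ^ r" for u v by fact
  have mem: "u \<in> W" if "u \<in> ?P" "H u u = 0" for u using maxiso_memI[OF W] that by blast
  have avoid: "\<exists>v. v \<in> A \<and> v \<notin> W" if "dim W < dim A" for A
    using dim_subset[of A W] that by (meson not_le subsetI)
  obtain v1 where v1: "v1 \<in> ?P" "v1 \<notin> W" using avoid[of ?P] dP by auto
  have a: "H v1 v1 \<noteq> 0" using mem v1 by blast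
  \<comment> \<open>A multiple \<open>w\<close> of \<open>v1\<close> realises any \<open>c\<close>
    as a value of \<open>H\<close>; applying the Hermitean symmetry twice returns it.\<close>
  have power_card: "(c ^ r) ^ r = c" for c :: 'a
  proof -
    define w where "w = smul (c / H v1 v1) v1"
    have w: "H w v1 = c" using a by (simp add: w_def form_scale)
    have "H w v1 = (H w v1 ^ r) ^ r" by (subst conj, subst conj) (rule refl)
    then show ?thesis by (simp only: w)
  qed
  let ?P1 = "?P \<inter> perp {v1}"
  have "dim W < dim ?P1" using dim_perp_singleton[OF subspace_perp, of W v1] dP by simp
  then obtain v2 where v2: "v2 \<in> ?P1" "v2 \<notin> W" using avoid by blast
  have c: "H v2 v2 \<noteq> 0" using mem v2 by blast
  have self: "H v v ^ r = H v v" for v by (rule conj[symmetric])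
  have "r > 0" using r_ge_2[OF assms(2) power_card] by simp
  \<comment> \<open>Additivity gives \<open>(- 1) ^ r = - 1\<close> for either parity of
    \<open>r\<close>, so the right-hand side of the norm equation is a fixed point.\<close>
  have "1 ^ r + (- 1) ^ r = (1 + - 1 :: 'a) ^ r"
    by (rule power_card_sqrt_add[OF assms(2), symmetric])
  also have "(1 + - 1 :: 'a) = 0" by simp
  also have "(0 :: 'a) ^ r = 0" using \<open>r > 0\<close> by (rule zero_power)
  finally have "- 1 = (- 1 :: 'a) ^ r" unfolding power_one by (rule minus_unique)
  then have "(- 1 :: 'a) ^ r = - 1" by (rule sym)
  then have "(- H v2 v2) ^ r = - H v2 v2"
    using power_mult_distrib[of "- 1" "H v2 v2" r] by (simp add: self)
  then have "(- H v2 v2 / H v1 v1) ^ r = - H v2 v2 / H v1 v1"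
    by (simp only: power_divide self)
  then obtain k where k: "k ^ r * k = - H v2 v2 / H v1 v1"
    using norm_exists[OF assms(2) power_card, of "- H v2 v2 / H v1 v1"] a c by auto
  let ?u = "smul k v1 + v2"
  have o: "H v2 v1 = 0" "H v1 v2 = 0" using v2 form_zero_sym by (auto simp: perp_def)
  have u1: "H ?u v1 = k * H v1 v1" and u2: "H ?u v2 = H v2 v2"
    by (simp_all add: form_add form_scale o)
  have "H ?u ?u = k * H v1 ?u + H v2 ?u" by (simp add: form_add form_scale)
  also have "\<dots> = k * (k * H v1 v1) ^ r + H v2 v2 ^ r" by (simp only: conj[of _ ?u] u1 u2)
  also have "\<dots> = (k ^ r * k) * H v1 v1 + H v2 v2"
    by (simp add: power_mult_distrib self mult_ac)
  also have "\<dots> = 0" using a by (simp add: k)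
  finally have "H ?u ?u = 0" .
  moreover have "?u \<in> ?P" using v1 v2 subspace_perp[of W] by (simp add: subspace_add subspace_scale)
  ultimately have "?u \<in> W" using mem by blast
  then have "H v2 ?u = 0" using v2(1) by (simp add: perp_def)
  then have "H ?u v2 = 0" by (rule form_zero_sym)
  then show False using u2 c by simp
qed

section \<open>Isotropy, and singular vectors on affine lines\<close>

lemma quadratic_isotropic_iff:
  assumes "polar_space smul (polarization Q) (\<lambda>v. Q v = 0)"
  shows "isotropic smul (Quadratic Q) W \<longleftrightarrow> polar_space.iso smul (polarization Q) (\<lambda>v. Q v = 0) W"
proof -
  interpret polar_space smul "polarization Q" "\<lambda>v. Q v = 0" by fact
  have "polarization Q u v = 0" if "subspace W" "\<forall>u\<in>W. Q u = 0" "u \<in> W" "v \<in> W" for u v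
    using that subspace_add[OF that(1,3,4)] by (simp add: polarization_def)
  then show ?thesis by (auto simp: isotropic_def iso_def perp_def)
qed

lemma quadratic_card_singular:
  fixes Q :: "'v::{ab_group_add,finite} \<Rightarrow> 'a::{field,finite}"
  assumes "polar_space smul (polarization Q) (\<lambda>v. Q v = 0)" "quadratic_form smul Q"
    and "Q p = 0" "polarization Q v p = 1"
  shows "card {k. Q (v + smul k p) = 0} = 1"
proof -
  interpret polar_space smul "polarization Q" "\<lambda>v. Q v = 0" by fact
  have "Q (v + smul k p) = Q v + k" for k
  proof -
    have "polarization Q v (smul k p) = k"
      using assms(4) by (simp add: polarization_commute[of Q v] form_scale)
    moreover have "Q (smul k p) = 0" using sing_scale[of p k] assms(3) by simp
    ultimately show ?thesis by (simp add: polarization_def algebra_simps)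
  qed
  then have "{k. Q (v + smul k p) = 0} = {- Q v}"
    by (auto simp: eq_neg_iff_add_eq_0 add.commute)
  then show ?thesis by simp
qed

text \<open>With \<open>c = H v v\<close>, the value at \<open>v + k p\<close> is
  \<open>(c + k) ^ r + k\<close>; substituting \<open>m = c + k\<close> turns its zeros into the
  trace fibre over the fixed point \<open>c\<close>.\<close>

lemma hermitean_card_singular:
  fixes H :: "'v::{ab_group_add,finite} \<Rightarrow> 'v \<Rightarrow> 'a::{field,finite}"
  assumes "polar_space smul H (\<lambda>v. H v v = 0)" "CARD('a) = r\<^sup>2" "\<And>u v. H v u = H u v ^ r"
    and "H p p = 0" "H v p = 1"
  shows "card {k. H (v + smul k p) (v + smul k p) = 0} = r"
proof -
  interpret polar_space smul H "\<lambda>v. H v v = 0" by fact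
  have conj: "H v u = H u v ^ r" for u v by fact
  have power_card: "(c ^ r) ^ r = c" for c :: 'a
  proof -
    have w: "H (smul c v) p = c" using assms(5) by (simp add: form_scale)
    have "H (smul c v) p = (H (smul c v) p ^ r) ^ r" by (subst conj, subst conj) (rule refl)
    then show ?thesis by (simp only: w)
  qed
  have pv: "H p v = 1" using conj[of p v] assms(5) by simp
  let ?c = "H v v"
  have "H (v + smul k p) (v + smul k p) = (?c + k) ^ r + k" for k
  proof -
    let ?u = "v + smul k p"
    have "H ?u v = ?c + k" "H ?u p = 1" by (simp_all add: form_add form_scale pv assms(4,5))
    moreover have "H ?u ?u = H v ?u + k * H p ?u" by (simp add: form_add form_scale)
    ultimately show ?thesis by (simp only: conj[of v ?u] conj[of p ?u] power_one mult_1_right)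
  qed
  then have "card {k. H (v + smul k p) (v + smul k p) = 0} = card {k. (?c + k) ^ r + k = 0}" by simp
  also have "\<dots> = card {m. m ^ r + m = ?c}"
  proof (rule bij_betw_same_card[OF bij_betw_byWitness[of _ "\<lambda>m. m - ?c" "\<lambda>k. ?c + k"]])
    show "(\<lambda>k. ?c + k) ` {k. (?c + k) ^ r + k = 0} \<subseteq> {m. m ^ r + m = ?c}"
    proof (intro image_subsetI CollectI)
      fix k assume "k \<in> {k. (?c + k) ^ r + k = 0}"
      then have "(?c + k) ^ r + k = 0" by simp
      then show "(?c + k) ^ r + (?c + k) = ?c" by (simp add: add.left_commute)
    qed
  qed (auto simp: add_diff_eq)
  also have "\<dots> = r" by (rule card_trace_fibre[OF assms(2) power_card conj[symmetric]])
  finally show ?thesis .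
qed

text \<open>No isotropic subspace exceeds the dimension of a maximal one, so the maximum defining
  the Witt index is attained at each of them.\<close>

lemma maxiso_dim_witt_index:
  fixes f :: "('a::{field,finite}, 'v::{ab_group_add,finite}) form"
  assumes "polar_space smul \<beta> sing" "\<And>W. isotropic smul f W \<longleftrightarrow> polar_space.iso smul \<beta> sing W"
    and "W \<in> polar_space.maxiso smul \<beta> sing"
  shows "vector_space.dim smul W = witt_index smul f"
proof -
  interpret polar_space smul \<beta> sing by fact
  have "Max (dim ` {W. isotropic smul f W}) = dim W"
    using assms(2,3) maxiso_iso[OF assms(3)] dim_iso_le_maxiso[OF _ assms(3)]
    by (intro Max_eqI) auto
  then show ?thesis by (simp add: witt_index_def)
qed

theorem theorem1p10:
  fixes smul :: "'a::{field, finite} \<Rightarrow> 'v::{ab_group_add, finite} \<Rightarrow> 'v"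
    and f :: "('a, 'v) form"
    and b D :: nat and e q :: real
    and X :: "'v set set" and E :: "('v set \<times> 'v set) set" and x :: "'v set"
    and L F R K :: "complex ^ 'v set ^ 'v set"
  assumes "vector_space smul"
    and "CARD('a) = b"
    and "D \<ge> 3"
    and "polar_type smul f D e"
    and "q = sqrt (real b)"
    and "X = maximal_isotropic smul f"
    and "E = dual_polar_edges smul f D"
    and "x \<in> X"
    and "L = lowering_matrix X E x D"
    and "F = flat_matrix X E x D"
    and "R = raising_matrix X E x D"
    and "K = K_matrix X E x D q"
  shows "K ** L = q\<^sup>2 *\<^sub>R (L ** K)
    \<and> K ** F = F ** K
    \<and> K ** R = q powi (-2) *\<^sub>R (R ** K)
    \<and> L ** F - q\<^sup>2 *\<^sub>R (F ** L) = (q powr (2 * e) - 1) *\<^sub>R L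
    \<and> F ** R - q\<^sup>2 *\<^sub>R (R ** F) = (q powr (2 * e) - 1) *\<^sub>R R
    \<and> (q ^ 4 / (q\<^sup>2 + 1)) *\<^sub>R (R ** L ** L) - L ** R ** L
        + (q powi (-2) / (q\<^sup>2 + 1)) *\<^sub>R (L ** L ** R)
      = - (q powr (2 * e + 2 * real D - 2)) *\<^sub>R L
    \<and> (q ^ 4 / (q\<^sup>2 + 1)) *\<^sub>R (R ** R ** L) - R ** L ** R
        + (q powi (-2) / (q\<^sup>2 + 1)) *\<^sub>R (L ** R ** R)
      = - (q powr (2 * e + 2 * real D - 2)) *\<^sub>R R"
proof -
  have D1: "D \<ge> 1" using assms(3) by simp
  have q: "q = sqrt (real CARD('a))" using assms(2,5) by simp
  have q_pos: "q > 0" using card_finite_field_ge_2[where 'a = 'a] by (simp add: q)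
  have q_powr: "q powr (2 * real n) = real (CARD('a) ^ n)" for n
  proof -
    have "q powr (2 * real n) = q powr real (2 * n)" by simp
    also have "\<dots> = (q\<^sup>2) ^ n" using q_pos by (simp only: powr_realpow power_mult)
    finally show ?thesis by (simp add: q)
  qed
  show ?thesis using assms(4)
  proof cases
    case (symplectic B)
    interpret polar_space smul B "\<lambda>_. True"
      using symplectic_polar_space[OF assms(1)] symplectic by blast
    show ?thesis
    \<comment> \<open>Every vector is singular, so \<open>\<tau> = b\<close>; with
      \<open>dim U = 2 D\<close> also \<open>s = b\<close>.\<close>
    proof (rule relations_if_isotropic_iff[where s = "CARD('a)" and \<tau> = "CARD('a)", OF _ _ _ _ q _ D1 assms(6-12)])
      show "isotropic smul f W \<longleftrightarrow> iso W" for W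
        by (auto simp: symplectic isotropic_def iso_def perp_def)
      show "dim W = D" if W: "W \<in> maxiso" for W
      proof -
        have "perp W = W" using maxiso_memI[OF W] maxiso_subset_perp[OF W] by blast
        then show ?thesis using dim_perp_iso[OF maxiso_iso[OF W]] symplectic(5) by simp
      qed
      show "CARD('a) * CARD('a) ^ (2 * D) = CARD('a) ^ dim (UNIV :: 'v set) * CARD('a)"
        by (simp only: symplectic(5) mult.commute)
      show "q powr (2 * e) = real CARD('a)" using q_powr[of 1] symplectic(2) by simp
    qed simp
  next
    case (quadratic_odd Q)
    have ps: "polar_space smul (polarization Q) (\<lambda>v. Q v = 0)"
      using quadratic_polar_space[OF assms(1)] quadratic_odd by blast
    then interpret polar_space smul "polarization Q" "\<lambda>v. Q v = 0" .
    show ?thesis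
    proof (rule relations_if_isotropic_iff[where s = "CARD('a)" and \<tau> = "1", OF _ _ _ _ q _ D1 assms(6-12)])
      show iso: "isotropic smul f W \<longleftrightarrow> iso W" for W
        unfolding quadratic_odd(1) by (rule quadratic_isotropic_iff[OF ps])
      show "dim W = D" if W: "W \<in> maxiso" for W
        by (rule quadratic_odd_maxiso_dim[OF ps quadratic_odd(3,5) W])
      show "card {k. Q (v + smul k p) = 0} = 1" if "Q p = 0" "polarization Q v p = 1" for p v
        by (rule quadratic_card_singular[OF ps quadratic_odd(3) that])
      show "CARD('a) * CARD('a) ^ (2 * D) = CARD('a) ^ dim (UNIV :: 'v set) * 1"
        by (simp only: quadratic_odd(5) power_add power_one_right mult_1 mult_1_right mult.commute)
      show "q powr (2 * e) = real (CARD('a))" using q_powr[of 1] quadratic_odd(2) by simp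
    qed
  next
    case (quadratic_plus Q)
    have ps: "polar_space smul (polarization Q) (\<lambda>v. Q v = 0)"
      using quadratic_polar_space[OF assms(1)] quadratic_plus by blast
    then interpret polar_space smul "polarization Q" "\<lambda>v. Q v = 0" .
    show ?thesis
    proof (rule relations_if_isotropic_iff[where s = "1" and \<tau> = "1", OF _ _ _ _ q _ D1 assms(6-12)])
      show iso: "isotropic smul f W \<longleftrightarrow> iso W" for W
        unfolding quadratic_plus(1) by (rule quadratic_isotropic_iff[OF ps])
      show "dim W = D" if W: "W \<in> maxiso" for W
        using maxiso_dim_witt_index[OF ps iso W] quadratic_plus by simp
      show "card {k. Q (v + smul k p) = 0} = 1" if "Q p = 0" "polarization Q v p = 1" for p v
        by (rule quadratic_card_singular[OF ps quadratic_plus(3) that])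
      show "1 * CARD('a) ^ (2 * D) = CARD('a) ^ dim (UNIV :: 'v set) * 1"
        by (simp only: quadratic_plus(5) power_add power_one_right mult_1 mult_1_right mult.commute)
      show "q powr (2 * e) = real (1)" using q_powr[of 0] quadratic_plus(2) by simp
    qed
  next
    case (quadratic_minus Q)
    have ps: "polar_space smul (polarization Q) (\<lambda>v. Q v = 0)"
      using quadratic_polar_space[OF assms(1)] quadratic_minus by blast
    then interpret polar_space smul "polarization Q" "\<lambda>v. Q v = 0" .
    show ?thesis
    \<comment> \<open>\<open>dim U = 2 D + 2\<close> contributes \<open>b ^ 2\<close>, and each
      affine line has one singular vector.\<close>
    proof (rule relations_if_isotropic_iff[where s = "CARD('a)\<^sup>2" and \<tau> = "1", OF _ _ _ _ q _ D1 assms(6-12)])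
      show iso: "isotropic smul f W \<longleftrightarrow> iso W" for W
        unfolding quadratic_minus(1) by (rule quadratic_isotropic_iff[OF ps])
      show "dim W = D" if W: "W \<in> maxiso" for W
        using maxiso_dim_witt_index[OF ps iso W] quadratic_minus by simp
      show "card {k. Q (v + smul k p) = 0} = 1" if "Q p = 0" "polarization Q v p = 1" for p v
        by (rule quadratic_card_singular[OF ps quadratic_minus(3) that])
      show "CARD('a)\<^sup>2 * CARD('a) ^ (2 * D) = CARD('a) ^ dim (UNIV :: 'v set) * 1"
        by (simp only: quadratic_minus(5) power_add power_one_right mult_1 mult_1_right mult.commute)
      show "q powr (2 * e) = real (CARD('a)\<^sup>2)" using q_powr[of 2] quadratic_minus(2) by simp
    qed
  next
    case (hermitean_odd r H)
    have r: "r \<noteq> 0" "real CARD('a) = (real r)\<^sup>2" using hermitean_odd(3) by (auto intro: ccontr)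
    have conj: "H v u = H u v ^ r" for u v
      using hermitean_odd(4) unfolding hermitean_form_def by blast
    have ps: "polar_space smul H (\<lambda>v. H v v = 0)"
      using hermitean_polar_space[OF assms(1) hermitean_odd(4,5) r(1)] .
    then interpret polar_space smul H "\<lambda>v. H v v = 0" .
    show ?thesis
    \<comment> \<open>\<open>dim U = 2 D + 1\<close> contributes \<open>b = r ^ 2\<close> and the
      affine lines contribute \<open>r\<close>; since \<open>q = r\<close>, this is \<open>q\<close>
      to the power \<open>2 e = 3\<close>.\<close>
    proof (rule relations_if_isotropic_iff[where s = "r ^ 3" and \<tau> = "r", OF _ _ _ _ q _ D1 assms(6-12)])
      show "isotropic smul f W \<longleftrightarrow> iso W" for W
        unfolding hermitean_odd(1) by (auto simp: isotropic_def iso_def perp_def)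
      show "dim W = D" if W: "W \<in> maxiso" for W
        by (rule hermitean_maxiso_dim[OF ps hermitean_odd(3) conj _ _ W]) (use hermitean_odd(6) in simp_all)
      show "card {k. H (v + smul k p) (v + smul k p) = 0} = r" if "H p p = 0" "H v p = 1" for p v
        by (rule hermitean_card_singular[OF ps hermitean_odd(3) conj that])
      show "r ^ 3 * CARD('a) ^ (2 * D) = CARD('a) ^ dim (UNIV :: 'v set) * r"
        unfolding hermitean_odd(6) by (simp add: hermitean_odd(3) power2_eq_square power3_eq_cube)
      have "q = real r" using r by (simp add: q)
      moreover have "2 * e = real 3" using hermitean_odd(2) by simp
      ultimately show "q powr (2 * e) = real (r ^ 3)"
        using powr_realpow[OF q_pos, of 3] by simp
    qed
  next
    case (hermitean_even r H)
    have r: "r \<noteq> 0" "real CARD('a) = (real r)\<^sup>2" using hermitean_even(3) by (auto intro: ccontr)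
    have conj: "H v u = H u v ^ r" for u v
      using hermitean_even(4) unfolding hermitean_form_def by blast
    have ps: "polar_space smul H (\<lambda>v. H v v = 0)"
      using hermitean_polar_space[OF assms(1) hermitean_even(4,5) r(1)] .
    then interpret polar_space smul H "\<lambda>v. H v v = 0" .
    show ?thesis
    proof (rule relations_if_isotropic_iff[where s = "r" and \<tau> = "r", OF _ _ _ _ q _ D1 assms(6-12)])
      show "isotropic smul f W \<longleftrightarrow> iso W" for W
        unfolding hermitean_even(1) by (auto simp: isotropic_def iso_def perp_def)
      show "dim W = D" if W: "W \<in> maxiso" for W
        by (rule hermitean_maxiso_dim[OF ps hermitean_even(3) conj _ _ W]) (use hermitean_even(6) in simp_all)
      show "card {k. H (v + smul k p) (v + smul k p) = 0} = r" if "H p p = 0" "H v p = 1" for p v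
        by (rule hermitean_card_singular[OF ps hermitean_even(3) conj that])
      show "r * CARD('a) ^ (2 * D) = CARD('a) ^ dim (UNIV :: 'v set) * r"
        unfolding hermitean_even(6) by (simp add: hermitean_even(3) power2_eq_square power3_eq_cube)
      have "q = real r" using r by (simp add: q)
      moreover have "2 * e = real 1" using hermitean_even(2) by simp
      ultimately show "q powr (2 * e) = real r"
        using powr_realpow[OF q_pos, of 1] by simp
    qed
  qed
qed

end
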